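(* Let $\mathcal{L}_0$ be the closure in $L^2(\mathcal{H}_3)$ of the sub-Laplacian $\mathcal{L}=-(X^2+Y^2)$ with domain $\mathcal{S}(\mathcal{H}_3)$ on the three-dimensional Heisenberg group $\mathcal{H}_3$. Then the essential spectra of $\mathcal{L}_0$ in the senses of Dunford–Schwartz, Wolf and Schechter satisfy $$\Sigma_{DS}(\mathcal{L}_0)=\Sigma_W(\mathcal{L}_0)=\Sigma_S(\mathcal{L}_0)=[0,\infty).$$
   Context: $\mathcal{H}_3=\mathbb{C}\times\mathbb{R}$ is the three-dimensional Heisenberg group, with coordinates $(y_1,y_2,\tau)\in\mathbb{R}^3$ (where $z=y_1+iy_2$) and Haar measure equal to Lebesgue measure on $\mathbb{R}^3$; $L^2(\mathcal{H}_3)$ is the complex $L^2$ space and $\mathcal{S}(\mathcal{H}_3)$ the Schwartz space on $\mathbb{R}^3$. The left-invariant vector fields are $X=\partial_{y_1}-2y_2\partial_\tau$ and $Y=\partial_{y_2}+2y_1\partial_\tau$. The sub-Laplacian $\mathcal{L}=-(X^2+Y^2)$ is regarded as an unbounded operator on $L^2(\mathcal{H}_3)$ with dense domain $\mathcal{S}(\mathcal{H}_3)$; it is essentially self-adjoint, and its closure $\mathcal{L}_0$ is its unique self-adjoint extension. Let $T$ be a closed densely defined linear operator on a complex Banach space $B$. Such an operator is Fredholm if its kernel is finite-dimensional, its range is closed, and its cokernel (the quotient of $B$ by the range) is finite-dimensional; its index is then $\dim\ker-\dim\mathrm{coker}$. Define $\Sigma_{DS}(T)=\{\lambda\in\mathbb{C}:\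 \mathrm{Range}(T-\lambda I)\text{ is not closed in }B\}$; $\Sigma_W(T)=\mathbb{C}\setminus\Phi_W(T)$, where $\Phi_W(T)$ is the set of $\lambda\in\mathbb{C}$ such that $T-\lambda I$ is Fredholm; $\Sigma_S(T)=\mathbb{C}\setminus\Phi_S(T)$, where $\Phi_S(T)$ is the set of $\lambda\in\mathbb{C}$ such that $T-\lambda I$ is Fredholm of index $0$. *)

theory Defs
  imports "HOL-Analysis.Analysis"
begin

section \<open>Complex Banach spaces\<close>

class scaleC =
  fixes scaleC :: "complex \<Rightarrow> 'a \<Rightarrow> 'a" (infixr "*\<^sub>C" 75)

class complex_vector = real_vector + scaleC +
  assumes scaleC_add_right: "a *\<^sub>C (x + y) = a *\<^sub>C x + a *\<^sub>C y"
    and scaleC_add_left: "(a + b) *\<^sub>C x = a *\<^sub>C x + b *\<^sub>C x"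
    and scaleC_scaleC: "a *\<^sub>C b *\<^sub>C x = (a * b) *\<^sub>C x"
    and scaleC_of_real: "complex_of_real r *\<^sub>C x = r *\<^sub>R x"

class complex_normed_vector = complex_vector + real_normed_vector +
  assumes norm_scaleC: "norm (a *\<^sub>C x) = cmod a * norm x"

class complex_banach = complex_normed_vector + banach

global_interpretation complex_vector: vector_space "scaleC :: complex \<Rightarrow> 'a \<Rightarrow> 'a::complex_vector"
proof
  fix x :: 'a
  show "1 *\<^sub>C x = x"
    using scaleC_of_real[of 1 x] by simp
qed (simp_all add: scaleC_add_right scaleC_add_left scaleC_scaleC)


section \<open>Quotients by a subspace\<close>

definition coset :: "'a::complex_vector set \<Rightarrow> 'a \<Rightarrow> 'a set" where
  "coset R x = {y. y - x \<in> R}"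

text \<open>The quotient by \<open>R\<close> is the space of all \<open>coset R x\<close> with the operations induced by
  representatives, so the coset of \<open>\<Sum>s\<in>S. c s *\<^sub>C s\<close> is the linear combination of the
  cosets of the \<open>s \<in> S\<close> with coefficients \<open>c\<close>. Thus \<open>quotient_basis R S\<close> says that
  \<open>coset R\<close> maps the finite set \<open>S\<close> one-to-one onto a basis of the quotient.\<close>

definition quotient_basis :: "'a::complex_vector set \<Rightarrow> 'a set \<Rightarrow> bool" where
  "quotient_basis R S \<longleftrightarrow> finite S \<and>
     (\<forall>x. \<exists>!c. (\<forall>s. s \<notin> S \<longrightarrow> c s = 0) \<and> coset R (\<Sum>s\<in>S. c s *\<^sub>C s) = coset R x)"

definition finite_dim_quotient :: "'a::complex_vector set \<Rightarrow> bool" where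
  "finite_dim_quotient R \<longleftrightarrow> (\<exists>S. quotient_basis R S)"

definition dim_quotient :: "'a::complex_vector set \<Rightarrow> nat" where
  "dim_quotient R = card (SOME S. quotient_basis R S)"

lemma coset_eq_iff:
  assumes "complex_vector.subspace R"
  shows "coset R x = coset R y \<longleftrightarrow> x - y \<in> R"
proof
  assume "coset R x = coset R y"
  moreover have "x \<in> coset R x"
    by (simp add: coset_def complex_vector.subspace_0[OF assms])
  ultimately show "x - y \<in> R"
    by (auto simp: coset_def)
next
  assume *: "x - y \<in> R"
  have "z - x \<in> R \<longleftrightarrow> z - y \<in> R" for z
    using complex_vector.subspace_add[OF assms _ *, of "z - x"]
      complex_vector.subspace_diff[OF assms _ *, of "z - y"] by auto
  then show "coset R x = coset R y"
    by (auto simp: coset_def)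
qed

lemma quotient_basis_card_le:
  assumes R: "complex_vector.subspace R" and S: "quotient_basis R S" and S': "quotient_basis R S'"
  shows "card S \<le> card S'"
proof -
  have fin: "finite S" "finite S'"
    using S S' by (auto simp: quotient_basis_def)
  have "\<exists>y \<in> complex_vector.span S'. y - x \<in> R" for x
  proof -
    obtain c where "coset R (\<Sum>s\<in>S'. c s *\<^sub>C s) = coset R x"
      using S' unfolding quotient_basis_def by blast
    moreover have "(\<Sum>s\<in>S'. c s *\<^sub>C s) \<in> complex_vector.span S'"
      by (intro complex_vector.span_sum complex_vector.span_scale complex_vector.span_base)
    ultimately show ?thesis
      using coset_eq_iff[OF R] by blast
  qed
  then obtain g where g: "\<And>x. g x \<in> complex_vector.span S'" "\<And>x. g x - x \<in> R"
    by metis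
  have indep: "\<forall>s\<in>S. a s = 0" if "(\<Sum>s\<in>S. a s *\<^sub>C g s) = 0" for a
  proof -
    define b where "b s = (if s \<in> S then a s else 0)" for s
    have "(\<Sum>s\<in>S. a s *\<^sub>C (g s - s)) \<in> R"
      by (intro complex_vector.subspace_sum[OF R] complex_vector.subspace_scale[OF R] g)
    then have "- (\<Sum>s\<in>S. b s *\<^sub>C s) \<in> R"
      using that by (simp add: b_def complex_vector.scale_right_diff_distrib sum_subtractf cong: sum.cong)
    then have "coset R (\<Sum>s\<in>S. b s *\<^sub>C s) = coset R 0"
      using complex_vector.subspace_neg[OF R] coset_eq_iff[OF R] by fastforce
    moreover have "\<forall>s. s \<notin> S \<longrightarrow> b s = 0"
      by (simp add: b_def)
    moreover obtain c0 where c0: "\<And>c. (\<forall>s. s \<notin> S \<longrightarrow> c s = 0) \<Longrightarrow>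
        coset R (\<Sum>s\<in>S. c s *\<^sub>C s) = coset R 0 \<Longrightarrow> c = c0"
      using S unfolding quotient_basis_def by (blast elim: ex1E)
    ultimately have "b = c0" by blast
    moreover have "(\<lambda>s. 0) = c0"
      by (rule c0) simp_all
    ultimately have "b = (\<lambda>s. 0)" by simp
    then show ?thesis
      by (metis b_def)
  qed
  have inj: "inj_on g S"
  proof (rule inj_onI, rule ccontr)
    fix s t assume st: "s \<in> S" "t \<in> S" "g s = g t" "s \<noteq> t"
    define a :: "'a \<Rightarrow> complex" where "a u = (if u = s then 1 else if u = t then - 1 else 0)" for u
    have "(\<Sum>u\<in>S. a u *\<^sub>C g u) = (\<Sum>u\<in>{s, t}. a u *\<^sub>C g u)"
      by (rule sum.mono_neutral_right) (use fin st in \<open>auto simp: a_def\<close>)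
    also have "\<dots> = 0"
      using st by (simp add: a_def)
    finally show False
      using indep[of a] st by (auto simp: a_def)
  qed
  have "complex_vector.independent (g ` S)"
  proof (rule complex_vector.independent_if_scalars_zero)
    fix f x assume "(\<Sum>x\<in>g ` S. f x *\<^sub>C x) = 0" "x \<in> g ` S"
    then show "f x = 0"
      using indep[of "f \<circ> g"] inj by (auto simp: sum.reindex)
  qed (use fin in simp)
  then have "card (g ` S) \<le> card S'"
    using complex_vector.independent_span_bound[of S' "g ` S"] fin g by auto
  then show ?thesis
    using card_image[OF inj] by simp
qed

lemma dim_quotient_eq_card:
  assumes "complex_vector.subspace R" "quotient_basis R S"
  shows "dim_quotient R = card S"
  unfolding dim_quotient_def
  using someI[of "quotient_basis R" S] quotient_basis_card_le assms by (metis order_antisym)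


section \<open>Unbounded operators and essential spectra\<close>

text \<open>An unbounded operator is represented by its graph: its domain and range are the library's
  \<^const>\<open>Domain\<close> and \<^const>\<open>Range\<close>, and the closure of a closable operator is the topological
  \<^const>\<open>closure\<close> of its graph in the product space.\<close>

type_synonym 'a operator = "('a \<times> 'a) set"

definition op_minus :: "'a::complex_vector operator \<Rightarrow> complex \<Rightarrow> 'a operator" where
  "op_minus T z = {(u, v - z *\<^sub>C u) |u v. (u, v) \<in> T}"

definition op_kernel :: "'a::complex_vector operator \<Rightarrow> 'a set" where
  "op_kernel T = {u. (u, 0) \<in> T}"

definition fredholm :: "'a::complex_banach operator \<Rightarrow> bool" where
  "fredholm T \<longleftrightarrow> (\<exists>B. finite B \<and> op_kernel T = complex_vector.span B) \<and>
     closed (Range T) \<and> finite_dim_quotient (Range T)"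

definition fredholm_index :: "'a::complex_banach operator \<Rightarrow> int" where
  "fredholm_index T = int (complex_vector.dim (op_kernel T)) - int (dim_quotient (Range T))"

definition essspec_DS :: "'a::complex_banach operator \<Rightarrow> complex set" where
  "essspec_DS T = {z. \<not> closed (Range (op_minus T z))}"

definition essspec_Wolf :: "'a::complex_banach operator \<Rightarrow> complex set" where
  "essspec_Wolf T = UNIV - {z. fredholm (op_minus T z)}"

definition essspec_Schechter :: "'a::complex_banach operator \<Rightarrow> complex set" where
  "essspec_Schechter T =
     UNIV - {z. fredholm (op_minus T z) \<and> fredholm_index (op_minus T z) = 0}"


section \<open>The space \<open>L\<^sup>2\<close> on the Heisenberg group\<close>

text \<open>Points are \<open>(y\<^sub>1, y\<^sub>2, \<tau>)\<close>; the group structure enters only through Haar measure,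
  which is \<^const>\<open>lborel\<close>, and through the left-invariant vector fields below.\<close>

type_synonym heis = "real \<times> real \<times> real"

definition square_integrable :: "(heis \<Rightarrow> complex) \<Rightarrow> bool" where
  "square_integrable f \<longleftrightarrow> f \<in> borel_measurable lborel \<and> integrable lborel (\<lambda>x. (cmod (f x))\<^sup>2)"

lemma square_integrable_zero: "square_integrable (\<lambda>x. 0)"
  by (simp add: square_integrable_def)

lemma square_integrable_mult:
  assumes "square_integrable f" shows "square_integrable (\<lambda>x. c * f x)"
  using assms by (auto simp: square_integrable_def norm_mult power_mult_distrib)

lemma square_integrable_add:
  assumes f: "square_integrable f" and g: "square_integrable g"
  shows "square_integrable (\<lambda>x. f x + g x)"
  unfolding square_integrable_def
proof
  show m: "(\<lambda>x. f x + g x) \<in> borel_measurable lborel"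
    using f g by (auto simp: square_integrable_def)
  show "integrable lborel (\<lambda>x. (cmod (f x + g x))\<^sup>2)"
  proof (rule Bochner_Integration.integrable_bound)
    show "integrable lborel (\<lambda>x. 2 * (cmod (f x))\<^sup>2 + 2 * (cmod (g x))\<^sup>2)"
      using f g by (auto simp: square_integrable_def)
    show "AE x in lborel. norm ((cmod (f x + g x))\<^sup>2)
        \<le> norm (2 * (cmod (f x))\<^sup>2 + 2 * (cmod (g x))\<^sup>2)"
    proof (rule AE_I2)
      fix x
      have "(cmod (f x + g x))\<^sup>2 \<le> (cmod (f x) + cmod (g x))\<^sup>2"
        by (intro power_mono norm_triangle_ineq) simp
      also have "\<dots> \<le> 2 * (cmod (f x))\<^sup>2 + 2 * (cmod (g x))\<^sup>2"
        using sum_squares_bound[of "cmod (f x)" "cmod (g x)"] by (simp add: power2_sum)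
      finally show "norm ((cmod (f x + g x))\<^sup>2)
          \<le> norm (2 * (cmod (f x))\<^sup>2 + 2 * (cmod (g x))\<^sup>2)" by simp
    qed
  qed (use m in measurable)
qed

lemma square_integrable_diff:
  assumes "square_integrable f" "square_integrable g"
  shows "square_integrable (\<lambda>x. f x - g x)"
  using square_integrable_add[OF assms(1) square_integrable_mult[OF assms(2), of "- 1"]] by simp

lemma square_integrable_inner:
  assumes f: "square_integrable f" and g: "square_integrable g"
  shows "integrable lborel (\<lambda>x. f x \<bullet> g x)"
proof (rule Bochner_Integration.integrable_bound)
  show "integrable lborel (\<lambda>x. (cmod (f x))\<^sup>2 + (cmod (g x))\<^sup>2)"
    using f g by (auto simp: square_integrable_def)
  show "(\<lambda>x. f x \<bullet> g x) \<in> borel_measurable lborel"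
    using f g by (auto simp: square_integrable_def)
  show "AE x in lborel. norm (f x \<bullet> g x) \<le> norm ((cmod (f x))\<^sup>2 + (cmod (g x))\<^sup>2)"
  proof (rule AE_I2)
    fix x
    have "\<bar>f x \<bullet> g x\<bar> \<le> cmod (f x) * cmod (g x)"
      by (rule Cauchy_Schwarz_ineq2)
    moreover have "0 \<le> cmod (f x) * cmod (g x)" by simp
    ultimately show "norm (f x \<bullet> g x) \<le> norm ((cmod (f x))\<^sup>2 + (cmod (g x))\<^sup>2)"
      using sum_squares_bound[of "cmod (f x)" "cmod (g x)"] by simp
  qed
qed

definition l2_rel :: "(heis \<Rightarrow> complex) \<Rightarrow> (heis \<Rightarrow> complex) \<Rightarrow> bool" where
  "l2_rel f g \<longleftrightarrow> square_integrable f \<and> square_integrable g \<and> (AE x in lborel. f x = g x)"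

quotient_type heis_L2 = "heis \<Rightarrow> complex" / partial: l2_rel
proof (rule part_equivpI)
  show "\<exists>f. l2_rel f f"
    using square_integrable_zero by (auto simp: l2_rel_def)
  show "symp l2_rel"
    by (auto simp: symp_def l2_rel_def eq_commute)
  show "transp l2_rel"
  proof (rule transpI)
    fix f g h assume fg: "l2_rel f g" and gh: "l2_rel g h"
    have "AE x in lborel. f x = g x" "AE x in lborel. g x = h x"
      using fg gh by (simp_all add: l2_rel_def)
    then have "AE x in lborel. f x = h x"
      by eventually_elim simp
    then show "l2_rel f h"
      using fg gh by (simp add: l2_rel_def)
  qed
qed

instantiation heis_L2 :: real_inner
begin

lift_definition zero_heis_L2 :: heis_L2 is "\<lambda>x. 0"
  by (simp add: l2_rel_def square_integrable_zero)

lift_definition plus_heis_L2 :: "heis_L2 \<Rightarrow> heis_L2 \<Rightarrow> heis_L2" is "\<lambda>f g x. f x + g x"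
  by (auto simp: l2_rel_def square_integrable_add)

lift_definition minus_heis_L2 :: "heis_L2 \<Rightarrow> heis_L2 \<Rightarrow> heis_L2" is "\<lambda>f g x. f x - g x"
  by (auto simp: l2_rel_def square_integrable_diff)

lift_definition uminus_heis_L2 :: "heis_L2 \<Rightarrow> heis_L2" is "\<lambda>f x. - f x"
  using square_integrable_mult[of _ "- 1"] by (auto simp: l2_rel_def)

lift_definition scaleR_heis_L2 :: "real \<Rightarrow> heis_L2 \<Rightarrow> heis_L2" is "\<lambda>r f x. r *\<^sub>R f x"
  by (auto simp: l2_rel_def scaleR_conv_of_real square_integrable_mult)

text \<open>On \<^typ>\<open>complex\<close>, \<open>u \<bullet> v\<close> is the real part of \<open>u * cnj v\<close>, so this is the real part of
  the Hermitian inner product and induces the usual \<open>L\<^sup>2\<close> norm.\<close>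

lift_definition inner_heis_L2 :: "heis_L2 \<Rightarrow> heis_L2 \<Rightarrow> real"
  is "\<lambda>f g. integral\<^sup>L lborel (\<lambda>x. f x \<bullet> g x)"
  unfolding l2_rel_def
  by (intro integral_cong_AE) (auto simp: square_integrable_def)

definition norm_heis_L2 :: "heis_L2 \<Rightarrow> real" where "norm_heis_L2 u = sqrt (u \<bullet> u)"
definition sgn_heis_L2 :: "heis_L2 \<Rightarrow> heis_L2" where "sgn_heis_L2 u = inverse (norm u) *\<^sub>R u"
definition dist_heis_L2 :: "heis_L2 \<Rightarrow> heis_L2 \<Rightarrow> real" where "dist_heis_L2 u v = norm (u - v)"
definition uniformity_heis_L2 :: "(heis_L2 \<times> heis_L2) filter" where
  "uniformity_heis_L2 = (INF e\<in>{0 <..}. principal {(x, y). dist x y < e})"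
definition open_heis_L2 :: "heis_L2 set \<Rightarrow> bool" where
  "open_heis_L2 U \<longleftrightarrow> (\<forall>x\<in>U. eventually (\<lambda>(x', y). x' = x \<longrightarrow> y \<in> U) uniformity)"

instance
proof
  fix a b c :: heis_L2 and r s :: real
  show "a + b + c = a + (b + c)"
    by transfer (auto simp: l2_rel_def square_integrable_add add.assoc)
  show "a + b = b + a"
    by transfer (auto simp: l2_rel_def square_integrable_add add.commute)
  show "0 + a = a"
    by transfer (auto simp: l2_rel_def)
  show "- a + a = 0"
    by transfer (auto simp: l2_rel_def square_integrable_zero)
  show "a - b = a + - b"
    by transfer (auto simp: l2_rel_def square_integrable_diff)
  show "r *\<^sub>R (a + b) = r *\<^sub>R a + r *\<^sub>R b"
    by transfer (auto simp: l2_rel_def scaleR_conv_of_real distrib_left square_integrable_add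
        square_integrable_mult)
  show "(r + s) *\<^sub>R a = r *\<^sub>R a + s *\<^sub>R a"
    by transfer (auto simp: l2_rel_def scaleR_conv_of_real distrib_right square_integrable_add
        square_integrable_mult)
  show "r *\<^sub>R s *\<^sub>R a = (r * s) *\<^sub>R a"
    by transfer (auto simp: l2_rel_def scaleR_conv_of_real square_integrable_mult mult.assoc)
  show "1 *\<^sub>R a = a"
    by transfer (auto simp: l2_rel_def)
  show "a \<bullet> b = b \<bullet> a"
    by transfer (simp add: inner_commute)
  show "(a + b) \<bullet> c = a \<bullet> c + b \<bullet> c"
    by transfer (auto simp: l2_rel_def inner_add_left square_integrable_inner)
  show "(r *\<^sub>R a) \<bullet> b = r * (a \<bullet> b)"
    by transfer simp
  show "0 \<le> a \<bullet> a"
    by transfer simp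
  show "a \<bullet> a = 0 \<longleftrightarrow> a = 0"
  proof transfer
    fix f assume "l2_rel f f"
    then have f: "square_integrable f" by (simp add: l2_rel_def)
    have "integral\<^sup>L lborel (\<lambda>x. f x \<bullet> f x) = 0 \<longleftrightarrow> (AE x in lborel. f x \<bullet> f x = 0)"
      by (rule integral_nonneg_eq_0_iff_AE) (use f square_integrable_inner in auto)
    then show "integral\<^sup>L lborel (\<lambda>x. f x \<bullet> f x) = 0 \<longleftrightarrow> l2_rel f (\<lambda>x. 0)"
      using f by (simp add: l2_rel_def square_integrable_zero)
  qed
qed (simp_all add: norm_heis_L2_def sgn_heis_L2_def dist_heis_L2_def uniformity_heis_L2_def
    open_heis_L2_def)

end


instantiation heis_L2 :: complex_normed_vector
begin

lift_definition scaleC_heis_L2 :: "complex \<Rightarrow> heis_L2 \<Rightarrow> heis_L2" is "\<lambda>c f x. c * f x"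
  by (auto simp: l2_rel_def square_integrable_mult)

instance
proof
  fix a b :: complex and x y :: heis_L2 and r :: real
  show "a *\<^sub>C (x + y) = a *\<^sub>C x + a *\<^sub>C y"
    by transfer (auto simp: l2_rel_def distrib_left square_integrable_add square_integrable_mult)
  show "(a + b) *\<^sub>C x = a *\<^sub>C x + b *\<^sub>C x"
    by transfer (auto simp: l2_rel_def distrib_right square_integrable_add square_integrable_mult)
  show "a *\<^sub>C b *\<^sub>C x = (a * b) *\<^sub>C x"
    by transfer (auto simp: l2_rel_def mult.assoc square_integrable_mult)
  show "complex_of_real r *\<^sub>C x = r *\<^sub>R x"
    by transfer (auto simp: l2_rel_def scaleR_conv_of_real square_integrable_mult)
  have "(a *\<^sub>C x) \<bullet> (a *\<^sub>C x) = (cmod a)\<^sup>2 * (x \<bullet> x)"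
  proof transfer
    fix a :: complex and f :: "heis \<Rightarrow> complex"
    have "(a * f x) \<bullet> (a * f x) = (cmod a)\<^sup>2 * (f x \<bullet> f x)" for x
      by (simp only: power2_norm_eq_inner[symmetric] norm_mult power_mult_distrib)
    then show "integral\<^sup>L lborel (\<lambda>x. (a * f x) \<bullet> (a * f x))
        = (cmod a)\<^sup>2 * integral\<^sup>L lborel (\<lambda>x. f x \<bullet> f x)"
      by simp
  qed
  then show "norm (a *\<^sub>C x) = cmod a * norm x"
    by (simp add: norm_heis_L2_def real_sqrt_mult)
qed

end

definition L2_represents :: "heis_L2 \<Rightarrow> (heis \<Rightarrow> complex) \<Rightarrow> bool" where
  "L2_represents u f \<longleftrightarrow> square_integrable f \<and> u = abs_heis_L2 f"

lemma L2_represents_ex: "\<exists>f. L2_represents u f"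
proof -
  have "l2_rel (rep_heis_L2 u) (rep_heis_L2 u)"
    by (rule Quotient3_rep_reflp[OF Quotient3_heis_L2])
  then show ?thesis
    unfolding L2_represents_def l2_rel_def
    using Quotient3_abs_rep[OF Quotient3_heis_L2] by metis
qed

lemma L2_represents_diff:
  assumes "L2_represents u f" "L2_represents v g"
  shows "L2_represents (u - v) (\<lambda>x. f x - g x)"
  using assms by (auto simp: L2_represents_def square_integrable_diff minus_heis_L2.abs_eq l2_rel_def)

lemma L2_represents_norm:
  assumes "L2_represents u f"
  shows "(norm u)\<^sup>2 = integral\<^sup>L lborel (\<lambda>x. (cmod (f x))\<^sup>2)"
proof -
  have "l2_rel f f" using assms by (simp add: L2_represents_def l2_rel_def)
  then have "u \<bullet> u = integral\<^sup>L lborel (\<lambda>x. f x \<bullet> f x)"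
    using assms by (simp add: L2_represents_def inner_heis_L2.abs_eq)
  then show ?thesis
    by (simp add: power2_norm_eq_inner)
qed

lemma L2_represents_nn_norm:
  assumes "L2_represents u f"
  shows "(\<integral>\<^sup>+x. ennreal ((cmod (f x))\<^sup>2) \<partial>lborel) = ennreal ((norm u)\<^sup>2)"
  using assms unfolding L2_represents_norm[OF assms]
  by (intro nn_integral_eq_integral) (auto simp: L2_represents_def square_integrable_def)

lemma L2_fast_Cauchy_convergent:
  fixes u :: "nat \<Rightarrow> heis_L2"
  assumes fast: "\<And>m n. n \<le> m \<Longrightarrow> norm (u m - u n) \<le> (1 / 2) ^ n"
  shows "convergent u"
proof -
  obtain f where f: "\<And>n. L2_represents (u n) (f n)"
    using choice[of "\<lambda>n. L2_represents (u n)"] L2_represents_ex by blast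
  have sq: "square_integrable (f n)" for n
    using f by (simp add: L2_represents_def)
  have [measurable]: "f n \<in> borel_measurable lborel" for n
    using sq by (simp add: square_integrable_def)
  have step: "(\<integral>\<^sup>+x. ennreal ((cmod (f m x - f n x))\<^sup>2) \<partial>lborel) \<le> ennreal ((1 / 4) ^ n)"
    if "n \<le> m" for m n
  proof -
    have "(norm (u m - u n))\<^sup>2 \<le> ((1 / 2) ^ n)\<^sup>2"
      by (intro power_mono fast that) simp
    also have "((1 / 2 :: real) ^ n)\<^sup>2 = (1 / 4) ^ n"
      by (simp add: power2_eq_square flip: power_mult_distrib)
    finally show ?thesis
      using L2_represents_nn_norm[OF L2_represents_diff[OF f f]] by (simp add: ennreal_leI)
  qed
  define d where "d n x = 2 ^ n * (cmod (f (Suc n) x - f n x))\<^sup>2" for n x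
  have [measurable]: "d n \<in> borel_measurable lborel" for n
    unfolding d_def by measurable
  have d0: "0 \<le> d n x" for n x by (simp add: d_def)
  have dle: "(\<integral>\<^sup>+x. ennreal (d n x) \<partial>lborel) \<le> ennreal ((1 / 2) ^ n)" for n
  proof -
    have "(\<integral>\<^sup>+x. ennreal (d n x) \<partial>lborel)
        = ennreal (2 ^ n) * (\<integral>\<^sup>+x. ennreal ((cmod (f (Suc n) x - f n x))\<^sup>2) \<partial>lborel)"
      unfolding d_def by (simp add: ennreal_mult nn_integral_cmult)
    also have "\<dots> \<le> ennreal (2 ^ n) * ennreal ((1 / 4) ^ n)"
      by (intro mult_left_mono step) auto
    also have "\<dots> = ennreal ((1 / 2) ^ n)"
      by (simp add: ennreal_mult[symmetric] power_mult_distrib[symmetric])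
    finally show ?thesis .
  qed
  have "(\<integral>\<^sup>+x. (\<Sum>n. ennreal (d n x)) \<partial>lborel) = (\<Sum>n. \<integral>\<^sup>+x. ennreal (d n x) \<partial>lborel)"
    by (rule nn_integral_suminf) measurable
  also have "\<dots> \<le> (\<Sum>n. ennreal ((1 / 2) ^ n))"
    by (intro suminf_le dle) auto
  also have "\<dots> = ennreal (\<Sum>n. (1 / 2) ^ n)"
    by (rule suminf_ennreal2) (auto intro: summable_geometric)
  also have "\<dots> < \<infinity>" by simp
  finally have "AE x in lborel. (\<Sum>n. ennreal (d n x)) \<noteq> \<infinity>"
    by (intro nn_integral_PInf_AE) auto
  then have ae: "AE x in lborel. convergent (\<lambda>n. f n x)"
  proof eventually_elim
    case (elim x)
    have "summable (\<lambda>n. d n x)"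
      by (rule summable_suminf_not_top) (use elim d0 in \<open>auto simp: infinity_ennreal_def\<close>)
    then have "Bseq (\<lambda>n. d n x)"
      by (intro convergent_imp_Bseq convergentI[OF summable_LIMSEQ_zero])
    then obtain K where K: "K > 0" "\<And>n. norm (d n x) \<le> K"
      by (elim BseqE) blast
    have "cmod (f (Suc n) x - f n x) \<le> sqrt K * (1 / sqrt 2) ^ n" for n
    proof -
      have "(cmod (f (Suc n) x - f n x))\<^sup>2 \<le> K / 2 ^ n"
        using K(2)[of n] by (simp add: d_def field_simps)
      then have "cmod (f (Suc n) x - f n x) \<le> sqrt (K / 2 ^ n)"
        by (rule real_le_rsqrt)
      then show ?thesis
        by (simp add: real_sqrt_divide real_sqrt_power power_divide)
    qed
    then have "summable (\<lambda>n. f (Suc n) x - f n x)"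
      by (rule summable_comparison_test'[where N = 0, rotated])
        (intro summable_mult summable_geometric, simp)
    then have "convergent (\<lambda>n. \<Sum>i<n. f (Suc i) x - f i x)"
      by (simp add: summable_iff_convergent)
    then have "convergent (\<lambda>n. f n x - f 0 x)"
      by (simp only: sum_lessThan_telescope[of "\<lambda>n. f n x"])
    then have "convergent (\<lambda>n. (f n x - f 0 x) + f 0 x)"
      by (intro convergent_add convergent_const)
    then show "convergent (\<lambda>n. f n x)" by simp
  qed
  define g where "g x = lim (\<lambda>n. f n x)" for x
  have [measurable]: "g \<in> borel_measurable lborel"
    unfolding g_def by measurable
  have close: "(\<integral>\<^sup>+x. ennreal ((cmod (f n x - g x))\<^sup>2) \<partial>lborel) \<le> ennreal ((1 / 4) ^ n)" for n
  proof -
    have "(\<integral>\<^sup>+x. ennreal ((cmod (f n x - g x))\<^sup>2) \<partial>lborel)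
        = (\<integral>\<^sup>+x. liminf (\<lambda>m. ennreal ((cmod (f n x - f m x))\<^sup>2)) \<partial>lborel)"
    proof (rule nn_integral_cong_AE, use ae in eventually_elim)
      case (elim x)
      then have "(\<lambda>m. f m x) \<longlonglongrightarrow> g x"
        by (simp add: g_def convergent_LIMSEQ_iff)
      then have "(\<lambda>m. ennreal ((cmod (f n x - f m x))\<^sup>2)) \<longlonglongrightarrow> ennreal ((cmod (f n x - g x))\<^sup>2)"
        by (intro tendsto_ennrealI tendsto_intros)
      then show ?case
        using lim_imp_Liminf by force
    qed
    also have "\<dots> \<le> liminf (\<lambda>m. \<integral>\<^sup>+x. ennreal ((cmod (f n x - f m x))\<^sup>2) \<partial>lborel)"
      by (rule nn_integral_liminf) measurable
    also have "\<dots> \<le> ennreal ((1 / 4) ^ n)"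
    proof (rule Liminf_le)
      show "\<forall>\<^sub>F m in sequentially.
          (\<integral>\<^sup>+x. ennreal ((cmod (f n x - f m x))\<^sup>2) \<partial>lborel) \<le> ennreal ((1 / 4) ^ n)"
        using eventually_ge_at_top[of n]
      proof eventually_elim
        case (elim m)
        then show ?case
          using step[of n m] norm_minus_commute[of "f n _" "f m _"] by simp
      qed
    qed simp
    finally show ?thesis .
  qed
  have sqd: "square_integrable (\<lambda>x. f n x - g x)" for n
    unfolding square_integrable_def
  proof
    show "integrable lborel (\<lambda>x. (cmod (f n x - g x))\<^sup>2)"
      by (rule integrableI_nonneg) (simp_all add: le_less_trans[OF close])
  qed measurable
  have "square_integrable g"
    using square_integrable_diff[OF sq[of 0] sqd[of 0]] by simp
  then have g: "L2_represents (abs_heis_L2 g) g"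
    by (simp add: L2_represents_def)
  have "norm (u n - abs_heis_L2 g) \<le> (1 / 2) ^ n" for n
  proof -
    have "ennreal ((norm (u n - abs_heis_L2 g))\<^sup>2) \<le> ennreal ((1 / 4) ^ n)"
      using close[of n] L2_represents_nn_norm[OF L2_represents_diff[OF f g]] by simp
    then have "(norm (u n - abs_heis_L2 g))\<^sup>2 \<le> (1 / 4) ^ n"
      by (simp add: ennreal_le_iff)
    also have "\<dots> = ((1 / 2 :: real) ^ n)\<^sup>2"
      by (simp add: power2_eq_square flip: power_mult_distrib)
    finally show ?thesis
      by (rule power2_le_imp_le) simp
  qed
  then have "\<forall>\<^sub>F n in sequentially. norm (u n - abs_heis_L2 g) \<le> (1 / 2) ^ n"
    by simp
  moreover have "(\<lambda>n. (1 / 2 :: real) ^ n) \<longlonglongrightarrow> 0"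
    by (rule LIMSEQ_realpow_zero) auto
  ultimately have "(\<lambda>n. u n - abs_heis_L2 g) \<longlonglongrightarrow> 0"
    by (rule Lim_null_comparison)
  then show ?thesis
    by (rule convergentI[OF LIM_zero_cancel])
qed

instance heis_L2 :: complex_banach
proof
  fix u :: "nat \<Rightarrow> heis_L2"
  assume u: "Cauchy u"
  have "\<exists>N. \<forall>m\<ge>N. \<forall>n\<ge>N. norm (u m - u n) < (1 / 2) ^ k" for k
    using CauchyD[OF u, of "(1 / 2) ^ k"] by simp
  then obtain N where N: "\<And>k m n. m \<ge> N k \<Longrightarrow> n \<ge> N k \<Longrightarrow> norm (u m - u n) < (1 / 2) ^ k"
    by metis
  define r where "r = rec_nat (N 0) (\<lambda>k p. max (Suc p) (N (Suc k)))"
  have r: "strict_mono r"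
    by (intro strict_mono_Suc_iff[THEN iffD2]) (simp add: r_def less_max_iff_disj)
  have rN: "N k \<le> r k" for k
    by (cases k) (simp_all add: r_def)
  have "convergent (u \<circ> r)"
  proof (rule L2_fast_Cauchy_convergent)
    fix m n :: nat assume "n \<le> m"
    then have "N n \<le> r m"
      using rN[of n] monoD[OF strict_mono_mono[OF r]] order_trans by blast
    then show "norm ((u \<circ> r) m - (u \<circ> r) n) \<le> (1 / 2) ^ n"
      using N[of n "r m" "r n"] rN by (simp add: less_imp_le)
  qed
  then obtain l where "(u \<circ> r) \<longlonglongrightarrow> l"
    by (auto simp: convergent_def)
  then show "convergent u"
    using Cauchy_converges_subseq[OF u r] by (auto simp: convergent_def)
qed


section \<open>The sub-Laplacian\<close>

definition dir_deriv ::
  "'a::real_normed_vector \<Rightarrow> ('a \<Rightarrow> 'b::real_normed_vector) \<Rightarrow> 'a \<Rightarrow> 'b" where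
  "dir_deriv e f x = frechet_derivative f (at x) e"

text \<open>\<open>foldr dir_deriv es f\<close> is the iterated partial derivative of \<open>f\<close> along the list \<open>es\<close> of
  coordinate directions. \<^const>\<open>frechet_derivative\<close> is unspecified at points where the function
  is not differentiable, so smoothness is the separate requirement that every iterated partial
  derivative is differentiable everywhere.\<close>

definition schwartz :: "('a::euclidean_space \<Rightarrow> complex) \<Rightarrow> bool" where
  "schwartz f \<longleftrightarrow> (\<forall>es. set es \<subseteq> Basis \<longrightarrow>
     (\<forall>x. foldr dir_deriv es f differentiable (at x)) \<and>
     (\<forall>k::nat. bounded (range (\<lambda>x. norm x ^ k *\<^sub>R foldr dir_deriv es f x))))"

definition vf_X :: "(heis \<Rightarrow> complex) \<Rightarrow> heis \<Rightarrow> complex" where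
  "vf_X f = (\<lambda>(y1, y2, \<tau>). dir_deriv (1, 0, 0) f (y1, y2, \<tau>)
     - 2 * complex_of_real y2 * dir_deriv (0, 0, 1) f (y1, y2, \<tau>))"

definition vf_Y :: "(heis \<Rightarrow> complex) \<Rightarrow> heis \<Rightarrow> complex" where
  "vf_Y f = (\<lambda>(y1, y2, \<tau>). dir_deriv (0, 1, 0) f (y1, y2, \<tau>)
     + 2 * complex_of_real y1 * dir_deriv (0, 0, 1) f (y1, y2, \<tau>))"

definition sublaplacian :: "(heis \<Rightarrow> complex) \<Rightarrow> heis \<Rightarrow> complex" where
  "sublaplacian f = (\<lambda>x. - (vf_X (vf_X f) x + vf_Y (vf_Y f) x))"

definition sublaplacian_op :: "heis_L2 operator" where
  "sublaplacian_op =
     {(u, v). \<exists>f. schwartz f \<and> L2_represents u f \<and> L2_represents v (sublaplacian f)}"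

definition sublaplacian_closure :: "heis_L2 operator" where
  "sublaplacian_closure = closure sublaplacian_op"

end

theory Submission
  imports Defs "HOL-Probability.Levy" "HOL-Probability.Sinc_Integral" "HOL-Complex_Analysis.Cauchy_Integral_Formula"
begin

text \<open>
  Outside \<open>[0, \<infinity>)\<close> the closure \<open>T\<close> of the sub-Laplacian is positive and symmetric, so \<open>T - z\<close>
  is bounded below and has closed range, and it remains to see that this range is dense. With
  \<open>z = y\<^sub>1 + \<i> y\<^sub>2\<close> and \<open>\<zeta> = 1 + \<bar>z\<bar>\<^sup>2 - \<i> \<tau>\<close>, the sub-Laplacian sends \<open>z\<^sup>j cnj z\<^sup>l G \<zeta>\<close> to
  \<open>- 4 (2 j + 1) z\<^sup>j cnj z\<^sup>l G' \<zeta>\<close> plus a term of lower degree in \<open>z\<close>. If \<open>u\<close> is orthogonal to the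
  range of \<open>T - z\<close>, induction on \<open>j\<close> therefore turns the pairing of \<open>u\<close> with
  \<open>z\<^sup>j cnj z\<^sup>l G (\<zeta> + s \<theta>)\<close> into a solution of \<open>H' = w H\<close> in \<open>s \<ge> 0\<close>, where \<open>\<theta>\<close> can be chosen with
  \<open>Re w > 0\<close>; as \<open>H\<close> grows at most polynomially, it vanishes. Moments in \<open>y\<^sub>1\<close>, \<open>y\<^sub>2\<close> and a Fourier
  argument in \<open>\<tau>\<close> then give \<open>u = 0\<close>.

  For \<open>\<lambda> = 4 m \<ge> 0\<close> the functions \<open>exp (- m \<zeta> - sqrt (\<zeta> + t))\<close> with \<open>t \<longlonglongrightarrow> \<infinity>\<close> produce
  approximate eigenvectors that lie in the range of \<open>T - \<lambda>\<close>; a gliding hump shows that this range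
  cannot be closed.
\<close>

section \<open>Fourier uniqueness and moments\<close>

text \<open>Since X zeta = i Y zeta, one has (X zeta)^2 + (Y zeta)^2 = 0, so on functions of zeta
  the second-order operator acts to first order. This is why an ordinary differential equation in a
  single shift parameter appears, and why exp (- m zeta) is a generalized eigenfunction for every m
  \<ge> 0. The price is one-sidedness: the available exponentials exp (- m zeta) carry only
  frequencies m \<ge> 0 in tau. The other half comes from the conjugated test functions, that is,
  from running the same argument with cnj z in place of z; the excluded half-line is invariant under
  conjugation. These exponentials also fail to decay in tau, which is the reason for all damping
  factors built from square roots. On the half-line, approximate eigenvectors alone would only show
  the lack of a lower bound, which a nontrivial kernel could explain even if the range were closed.
  Vectors of the range are orthogonal to the kernel by symmetry, so approximate eigenvectors inside
  the range decide the matter.\<close>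

lemma has_vector_derivative_at_iff_quotient:
  fixes f :: "real \<Rightarrow> 'b::real_normed_vector"
  shows "(f has_vector_derivative f') (at t) \<longleftrightarrow> ((\<lambda>s. (f s - f t) /\<^sub>R (s - t)) \<longlongrightarrow> f') (at t)"
proof -
  have "(f has_vector_derivative f') (at t) \<longleftrightarrow>
      ((\<lambda>s. norm (f s - f t - (s - t) *\<^sub>R f') / norm (s - t)) \<longlongrightarrow> 0) (at t)"
    by (simp add: has_vector_derivative_def has_derivative_iff_norm bounded_linear_scaleR_left)
  also have "\<dots> \<longleftrightarrow> ((\<lambda>s. norm ((f s - f t) /\<^sub>R (s - t) - f')) \<longlongrightarrow> 0) (at t)"
  proof (rule filterlim_cong[OF refl refl])
    show "\<forall>\<^sub>F s in at t. norm (f s - f t - (s - t) *\<^sub>R f') / norm (s - t) = norm ((f s - f t) /\<^sub>R (s - t) - f')"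
      unfolding eventually_at_filter
    proof (rule always_eventually, intro allI impI)
      fix s assume "s \<noteq> t"
      then have "(f s - f t) /\<^sub>R (s - t) - f' = (f s - f t - (s - t) *\<^sub>R f') /\<^sub>R (s - t)"
        by (simp add: scaleR_diff_right)
      then show "norm (f s - f t - (s - t) *\<^sub>R f') / norm (s - t) = norm ((f s - f t) /\<^sub>R (s - t) - f')"
        by (simp add: divide_inverse mult.commute)
    qed
  qed
  also have "\<dots> \<longleftrightarrow> ((\<lambda>s. (f s - f t) /\<^sub>R (s - t)) \<longlongrightarrow> f') (at t)"
    by (simp add: tendsto_norm_zero_iff LIM_zero_iff)
  finally show ?thesis .
qed

text \<open>The mean value inequality bounds the difference quotients by \<open>w\<close>, after
  which dominated convergence applies along every sequence tending to \<open>t0\<close>. It serves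
  for the Fourier-type integral in the frequency, for the pairing in the shift of
  \<open>zeta\<close>, and for translations in the integration by parts.\<close>

lemma has_vector_derivative_lebesgue_integral:
  fixes f f' :: "real \<Rightarrow> 'a \<Rightarrow> 'b::{banach, second_countable_topology}"
  assumes t0: "t0 \<in> {a<..<b}"
    and int: "\<And>t. t \<in> {a<..<b} \<Longrightarrow> integrable M (f t)"
    and der: "\<And>t x. t \<in> {a<..<b} \<Longrightarrow> x \<in> space M \<Longrightarrow> ((\<lambda>t. f t x) has_vector_derivative f' t x) (at t)"
    and w: "integrable M w" "\<And>t x. t \<in> {a<..<b} \<Longrightarrow> x \<in> space M \<Longrightarrow> norm (f' t x) \<le> w x"
    and meas: "f' t0 \<in> borel_measurable M"
  shows "((\<lambda>t. integral\<^sup>L M (f t)) has_vector_derivative integral\<^sup>L M (f' t0)) (at t0)"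
proof -
  let ?S = "{a<..<b}"
  have lip: "norm (f t x - f t0 x) \<le> w x * \<bar>t - t0\<bar>" if t: "t \<in> ?S" and x: "x \<in> space M" for t x
  proof -
    have "norm (f t x - f t0 x) \<le> w x * norm (t - t0)"
    proof (rule differentiable_bound[of ?S "\<lambda>t. f t x" "\<lambda>t h. h *\<^sub>R f' t x"])
      fix s assume s: "s \<in> ?S"
      show "((\<lambda>t. f t x) has_derivative (\<lambda>h. h *\<^sub>R f' s x)) (at s within ?S)"
        using der[OF s x] by (simp add: has_vector_derivative_def has_derivative_at_withinI)
      show "onorm (\<lambda>h. h *\<^sub>R f' s x) \<le> w x"
        by (rule onorm_bound) (use w(2)[OF s x] order_trans[OF norm_ge_zero w(2)[OF s x]] in
            \<open>auto simp: mult.commute[of "w x"] intro!: mult_left_mono\<close>)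
    qed (use t t0 in auto)
    then show ?thesis by simp
  qed
  have "((\<lambda>t. (integral\<^sup>L M (f t) - integral\<^sup>L M (f t0)) /\<^sub>R (t - t0)) \<longlongrightarrow> integral\<^sup>L M (f' t0)) (at t0 within ?S)"
    unfolding tendsto_at_iff_sequentially comp_def
  proof (intro allI impI)
    fix X assume X: "\<forall>i. X i \<in> ?S - {t0}" "X \<longlonglongrightarrow> t0"
    have "(\<lambda>i. integral\<^sup>L M (\<lambda>x. (f (X i) x - f t0 x) /\<^sub>R (X i - t0))) \<longlonglongrightarrow> integral\<^sup>L M (f' t0)"
    proof (rule integral_dominated_convergence[OF meas _ w(1)])
      show "(\<lambda>x. (f (X i) x - f t0 x) /\<^sub>R (X i - t0)) \<in> borel_measurable M" for i
        using int[of "X i"] int[OF t0] X(1) by auto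
      show "AE x in M. (\<lambda>i. (f (X i) x - f t0 x) /\<^sub>R (X i - t0)) \<longlonglongrightarrow> f' t0 x"
      proof (rule AE_I2)
        fix x assume x: "x \<in> space M"
        have "((\<lambda>t. (f t x - f t0 x) /\<^sub>R (t - t0)) \<longlongrightarrow> f' t0 x) (at t0)"
          using der[OF t0 x] by (simp add: has_vector_derivative_at_iff_quotient)
        then show "(\<lambda>i. (f (X i) x - f t0 x) /\<^sub>R (X i - t0)) \<longlonglongrightarrow> f' t0 x"
          unfolding tendsto_at_iff_sequentially comp_def using X by auto
      qed
      show "AE x in M. norm ((f (X i) x - f t0 x) /\<^sub>R (X i - t0)) \<le> w x" for i
      proof (rule AE_I2)
        fix x assume x: "x \<in> space M"
        have "X i \<noteq> t0" "X i \<in> ?S" using X by auto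
        moreover have "norm ((f (X i) x - f t0 x) /\<^sub>R (X i - t0)) = norm (f (X i) x - f t0 x) / \<bar>X i - t0\<bar>"
          by (simp add: divide_inverse mult.commute)
        ultimately show "norm ((f (X i) x - f t0 x) /\<^sub>R (X i - t0)) \<le> w x"
          using lip[OF _ x, of "X i"] by (simp add: pos_divide_le_eq)
      qed
    qed
    moreover have "integral\<^sup>L M (\<lambda>x. (f (X i) x - f t0 x) /\<^sub>R (X i - t0))
        = (integral\<^sup>L M (f (X i)) - integral\<^sup>L M (f t0)) /\<^sub>R (X i - t0)" for i
      using int[of "X i"] int[OF t0] X(1) by (subst integral_scaleR_right, subst Bochner_Integration.integral_diff) auto
    ultimately show "(\<lambda>i. (integral\<^sup>L M (f (X i)) - integral\<^sup>L M (f t0)) /\<^sub>R (X i - t0)) \<longlonglongrightarrow> integral\<^sup>L M (f' t0)"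
      by (simp only:)
  qed
  then have "((\<lambda>t. (integral\<^sup>L M (f t) - integral\<^sup>L M (f t0)) /\<^sub>R (t - t0)) \<longlongrightarrow> integral\<^sup>L M (f' t0)) (at t0)"
    using at_within_open[OF t0] by simp
  then show ?thesis
    by (simp add: has_vector_derivative_at_iff_quotient)
qed

lemma integrable_one_over_1_plus_square:
  "integrable lborel (\<lambda>x::real. 1 / (1 + x\<^sup>2))"
proof -
  have "set_integrable lborel (einterval (-\<infinity>) \<infinity>) (\<lambda>x::real. inverse (1 + x^2))"
    by (rule integrable_inverse_1_plus_square)
  then show ?thesis by (simp add: set_integrable_def inverse_eq_divide)
qed

text \<open>The positive and negative parts of \<open>g\<close> have equal Fourier transforms, hence
  equal mass (frequency 0). After normalisation both are probability densities, and uniqueness of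
  characteristic functions identifies them.\<close>

lemma fourier_zero_real:
  fixes g :: "real \<Rightarrow> real"
  assumes g: "integrable lborel g"
    and zero: "\<And>t. (\<integral>x. iexp (t * x) * g x \<partial>lborel) = 0"
  shows "AE x in lborel. g x = 0"
proof -
  \<comment> \<open>\<open>p 1\<close> is the positive part of \<open>g\<close> and
    \<open>p (-1)\<close> the negative part, so one argument serves both.\<close>
  define p where "p s x = max 0 (s * g x)" for s x :: real
  have [measurable]: "g \<in> borel_measurable lborel" using g by auto
  have pint: "integrable lborel (p s)" for s
    unfolding p_def using g by auto
  have diff: "p 1 x - p (-1) x = g x" for x by (auto simp: p_def)
  have iint: "integrable lborel (\<lambda>x. iexp (t * x) * complex_of_real (p s x))" for t s
    by (rule Bochner_Integration.integrable_bound[OF pint[of s]]) (auto simp: norm_mult p_def)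
  have eq: "(\<integral>x. iexp (t * x) * p 1 x \<partial>lborel) = (\<integral>x. iexp (t * x) * p (-1) x \<partial>lborel)" for t
  proof -
    have "(\<integral>x. iexp (t * x) * g x \<partial>lborel) = (\<integral>x. iexp (t * x) * p 1 x - iexp (t * x) * p (-1) x \<partial>lborel)"
      by (intro Bochner_Integration.integral_cong refl) (simp add: diff[symmetric] algebra_simps)
    also have "\<dots> = (\<integral>x. iexp (t * x) * p 1 x \<partial>lborel) - (\<integral>x. iexp (t * x) * p (-1) x \<partial>lborel)"
      by (rule Bochner_Integration.integral_diff[OF iint iint])
    finally show ?thesis using zero by simp
  qed
  define m where "m = integral\<^sup>L lborel (p 1)"
  have m: "integral\<^sup>L lborel (p s) = m" if "s = 1 \<or> s = -1" for s
    using that eq[of 0] by (auto simp: m_def)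
  have m0: "m \<ge> 0" unfolding m_def by (simp add: p_def)
  show ?thesis
  proof (cases "m = 0")
    \<comment> \<open>Zero mass cannot be normalised, but then both parts vanish almost
      everywhere.\<close>
    case True
    have "AE x in lborel. p s x = 0" if "s = 1 \<or> s = -1" for s
    proof -
      have "AE x in lborel. 0 \<le> p s x" by (simp add: p_def)
      then show ?thesis
        using integral_nonneg_eq_0_iff_AE[OF pint] m[OF that] True by simp
    qed
    from this[of 1] this[of "-1"] have "AE x in lborel. p 1 x = 0" "AE x in lborel. p (-1) x = 0" by auto
    then show ?thesis by eventually_elim (simp add: diff[symmetric])
  next
    case False
    then have mp: "m > 0" using m0 by simp
    define M where "M s = density lborel (\<lambda>x. ennreal (p s x / m))" for s
    have pr: "real_distribution (M s)" if "s = 1 \<or> s = -1" for s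
    proof -
      have "emeasure (M s) (space (M s)) = (\<integral>\<^sup>+x. ennreal (p s x / m) \<partial>lborel)"
        unfolding M_def by (subst emeasure_density) (auto simp: p_def)
      also have "\<dots> = ennreal (\<integral>x. p s x / m \<partial>lborel)"
      proof (rule nn_integral_eq_integral)
        show "integrable lborel (\<lambda>x. p s x / m)" using pint[of s] by simp
      qed (use mp in \<open>simp add: p_def\<close>)
      also have "\<dots> = 1" using m[OF that] mp by simp
      finally have "prob_space (M s)" by (rule prob_spaceI)
      then show ?thesis
        by (simp add: real_distribution_def real_distribution_axioms_def M_def)
    qed
    have "char (M 1) = char (M (-1))"
    proof
      fix t
      have "char (M s) t = (\<integral>x. iexp (t * x) * p s x \<partial>lborel) / m" for s
      proof -
        have "char (M s) t = (\<integral>x. (p s x / m) *\<^sub>R iexp (t * x) \<partial>lborel)"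
          unfolding char_def M_def by (rule integral_density) (use mp in \<open>auto simp: p_def\<close>)
        also have "\<dots> = (\<integral>x. iexp (t * x) * p s x / m \<partial>lborel)"
          by (intro Bochner_Integration.integral_cong refl) (simp add: scaleR_conv_of_real mult.commute)
        finally show ?thesis by simp
      qed
      then show "char (M 1) t = char (M (-1)) t" using eq by simp
    qed
    then have "M 1 = M (-1)"
      by (intro Levy_uniqueness pr) auto
    then have "AE x in lborel. ennreal (p 1 x / m) = ennreal (p (-1) x / m)"
      unfolding M_def by (intro sigma_finite_measure.density_unique[OF lborel.sigma_finite_measure_axioms]) (auto simp: p_def)
    then show ?thesis
      by eventually_elim (use diff mp in \<open>auto simp: p_def max_def split: if_splits\<close>)
  qed
qed

text \<open>The transform of \<open>cnj g\<close> at t is the conjugate of the transform of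
  \<open>g\<close> at - t, so it vanishes too, and with it the transforms of the real and imaginary
  parts.\<close>

lemma fourier_zero:
  fixes g :: "real \<Rightarrow> complex"
  assumes g: "integrable lborel g"
    and zero: "\<And>t. (\<integral>x. iexp (t * x) * g x \<partial>lborel) = 0"
  shows "AE x in lborel. g x = 0"
proof -
  have [measurable]: "g \<in> borel_measurable lborel" using g by auto
  have i1: "integrable lborel (\<lambda>x. iexp (t * x) * g x)" for t
    by (rule Bochner_Integration.integrable_bound[OF g]) (auto simp: norm_mult)
  have cz: "(\<integral>x. iexp (t * x) * cnj (g x) \<partial>lborel) = 0" for t
  proof -
    have "(\<integral>x. iexp (t * x) * cnj (g x) \<partial>lborel) = (\<integral>x. cnj (iexp (- t * x) * g x) \<partial>lborel)"
      by (intro Bochner_Integration.integral_cong refl) (simp add: exp_cnj)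
    also have "\<dots> = cnj (\<integral>x. iexp (- t * x) * g x \<partial>lborel)"
      by (simp del: complex_cnj_mult flip: integral_cnj)
    also have "\<dots> = 0" using zero[of "-t"] by simp
    finally show ?thesis .
  qed
  have [measurable]: "(\<lambda>x. cnj (g x)) \<in> borel_measurable lborel"
    using g by (intro borel_measurable_integrable) simp
  have i2: "integrable lborel (\<lambda>x. iexp (t * x) * cnj (g x))" for t
    by (rule Bochner_Integration.integrable_bound[OF g]) (auto simp: norm_mult)
  have "AE x in lborel. Re (g x) = 0"
  proof (rule fourier_zero_real)
    fix t
    have "(\<integral>x. iexp (t * x) * Re (g x) \<partial>lborel) = (\<integral>x. (iexp (t * x) * g x + iexp (t * x) * cnj (g x)) / 2 \<partial>lborel)"
      by (intro Bochner_Integration.integral_cong refl)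
        (simp add: distrib_left[symmetric] complex_add_cnj)
    also have "\<dots> = 0" using Bochner_Integration.integral_add[OF i1 i2, of t t] zero[of t] cz[of t] by simp
    finally show "(\<integral>x. iexp (t * x) * Re (g x) \<partial>lborel) = 0" .
  qed (use g in auto)
  moreover have "AE x in lborel. Im (g x) = 0"
  proof (rule fourier_zero_real)
    fix t
    have "(\<integral>x. iexp (t * x) * Im (g x) \<partial>lborel) = (\<integral>x. (iexp (t * x) * g x - iexp (t * x) * cnj (g x)) / (2 * \<i>) \<partial>lborel)"
      by (intro Bochner_Integration.integral_cong refl)
        (simp add: right_diff_distrib[symmetric] complex_diff_cnj, simp add: mult_ac)
    also have "\<dots> = 0" using Bochner_Integration.integral_diff[OF i1 i2, of t t] zero[of t] cz[of t] by simp
    finally show "(\<integral>x. iexp (t * x) * Im (g x) \<partial>lborel) = 0" .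
  qed (use g in auto)
  ultimately show ?thesis by eventually_elim (simp add: complex_eq_iff)
qed

text \<open>Exponential moments make the moment problem determinate: they dominate all partial sums
  of the series of exp (i t x), so vanishing moments force the Fourier transform of the marginal of
  \<open>F\<close> in its first coordinate to vanish.\<close>

lemma moments_zero:
  fixes F :: "real \<times> 'b \<Rightarrow> complex"
  assumes N: "sigma_finite_measure N"
    and F[measurable]: "F \<in> borel_measurable (lborel \<Otimes>\<^sub>M N)"
    and int: "\<And>c. integrable (lborel \<Otimes>\<^sub>M N) (\<lambda>p. exp (c * \<bar>fst p\<bar>) * norm (F p))"
    and zero: "\<And>n. (\<integral>p. of_real (fst p) ^ n * F p \<partial>(lborel \<Otimes>\<^sub>M N)) = 0"
  shows "AE x in lborel. (\<integral>y. F (x, y) \<partial>N) = 0"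
proof -
  interpret N: sigma_finite_measure N by fact
  interpret P: pair_sigma_finite lborel N ..
  let ?P = "lborel \<Otimes>\<^sub>M N"
  have Fi: "integrable ?P F"
    using int[of 0] by (simp add: integrable_norm_iff)
  have pow: "integrable ?P (\<lambda>p. of_real (fst p) ^ n * F p)" for n
  proof (rule Bochner_Integration.integrable_bound[OF integrable_mult_right[of "fact n", OF int[of 1]]])
    show "AE p in ?P. norm (of_real (fst p) ^ n * F p) \<le> norm (fact n * (exp (1 * \<bar>fst p\<bar>) * norm (F p)))"
    proof (rule AE_I2)
      fix p :: "real \<times> 'b"
      have "\<bar>fst p\<bar> ^ n / fact n \<le> exp \<bar>fst p\<bar>"
        using sum_le_suminf[OF summable_exp_generic[of "\<bar>fst p\<bar>"], of "{n}"]
        by (simp add: exp_def divide_inverse mult.commute)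
      then have "\<bar>fst p\<bar> ^ n * norm (F p) \<le> (fact n * exp \<bar>fst p\<bar>) * norm (F p)"
        by (intro mult_right_mono) (auto simp: field_simps)
      then show "norm (of_real (fst p) ^ n * F p) \<le> norm (fact n * (exp (1 * \<bar>fst p\<bar>) * norm (F p)))"
        by (simp add: norm_mult norm_power mult.assoc)
    qed
  qed measurable
  show ?thesis
  proof (rule fourier_zero)
    show "integrable lborel (\<lambda>x. \<integral>y. F (x, y) \<partial>N)"
      by (rule P.integrable_fst'[OF Fi])
    fix t :: real
    let ?e = "\<lambda>p. iexp (t * fst p) * F p"
    have ei: "integrable ?P ?e"
      by (rule Bochner_Integration.integrable_bound[OF Fi]) (auto simp: norm_mult)
    have "(\<lambda>n. \<integral>p. (\<Sum>k<n. (\<i> * of_real (t * fst p)) ^ k /\<^sub>R fact k) * F p \<partial>?P) \<longlonglongrightarrow> integral\<^sup>L ?P ?e"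
    proof (rule integral_dominated_convergence[OF _ _ int[of "\<bar>t\<bar>"]])
      show "AE p in ?P. (\<lambda>n. (\<Sum>k<n. (\<i> * of_real (t * fst p)) ^ k /\<^sub>R fact k) * F p) \<longlonglongrightarrow> ?e p"
        by (intro AE_I2 tendsto_mult tendsto_const exp_converges[unfolded sums_def])
      show "AE p in ?P. norm ((\<Sum>k<n. (\<i> * of_real (t * fst p)) ^ k /\<^sub>R fact k) * F p) \<le> exp (\<bar>t\<bar> * \<bar>fst p\<bar>) * norm (F p)" for n
      proof (rule AE_I2)
        fix p :: "real \<times> 'b"
        have "norm (\<Sum>k<n. (\<i> * of_real (t * fst p)) ^ k /\<^sub>R fact k) \<le> (\<Sum>k<n. norm ((\<i> * complex_of_real (t * fst p)) ^ k /\<^sub>R fact k))"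
          by (rule norm_sum)
        also have "\<dots> = (\<Sum>k<n. (\<bar>t\<bar> * \<bar>fst p\<bar>) ^ k /\<^sub>R fact k)"
          by (simp add: norm_mult norm_power abs_mult)
        also have "\<dots> \<le> exp (\<bar>t\<bar> * \<bar>fst p\<bar>)"
          unfolding exp_def by (rule sum_le_suminf) (use summable_exp_generic[of "\<bar>t\<bar> * \<bar>fst p\<bar>"] in auto)
        finally show "norm ((\<Sum>k<n. (\<i> * of_real (t * fst p)) ^ k /\<^sub>R fact k) * F p) \<le> exp (\<bar>t\<bar> * \<bar>fst p\<bar>) * norm (F p)"
          by (simp add: norm_mult mult_right_mono)
      qed
    qed measurable
    moreover have "(\<integral>p. (\<Sum>k<n. (\<i> * of_real (t * fst p)) ^ k /\<^sub>R fact k) * F p \<partial>?P) = 0" for n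
    proof -
      have "(\<integral>p. (\<Sum>k<n. (\<i> * of_real (t * fst p)) ^ k /\<^sub>R fact k) * F p \<partial>?P)
          = (\<integral>p. (\<Sum>k<n. ((\<i> * t) ^ k / fact k) * (of_real (fst p) ^ k * F p)) \<partial>?P)"
        by (intro Bochner_Integration.integral_cong refl)
          (simp add: sum_distrib_left power_mult_distrib scaleR_conv_of_real divide_inverse mult_ac)
      also have "\<dots> = (\<Sum>k<n. \<integral>p. ((\<i> * t) ^ k / fact k) * (of_real (fst p) ^ k * F p) \<partial>?P)"
        by (intro Bochner_Integration.integral_sum integrable_mult_right pow)
      also have "\<dots> = 0" using zero by simp
      finally show ?thesis .
    qed
    ultimately have "integral\<^sup>L ?P ?e = 0"
      by (simp add: LIMSEQ_const_iff)
    moreover have "integral\<^sup>L ?P ?e = (\<integral>x. \<integral>y. ?e (x, y) \<partial>N \<partial>lborel)"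
      by (rule P.integral_fst'[OF ei, symmetric])
    ultimately show "(\<integral>x. iexp (t * x) * (\<integral>y. F (x, y) \<partial>N) \<partial>lborel) = 0" by simp
  qed
qed

section \<open>Hilbert space geometry\<close>

text \<open>The vector is the difference between \<open>x\<close> and its projection to
  \<open>R\<close>. Orthogonality refers to the real inner product; for the range of an operator it
  becomes complex orthogonality through invariance under i.\<close>

lemma closed_subspace_orthogonal:
  fixes R :: "'a::{real_inner, banach} set"
  assumes R: "subspace R" "closed R" and x: "x \<notin> R"
  obtains v where "v \<noteq> 0" "\<And>y. y \<in> R \<Longrightarrow> v \<bullet> y = 0"
proof -
  have R0: "0 \<in> R" using R by (simp add: subspace_0)
  define d where "d = Inf ((\<lambda>y. (norm (x - y))\<^sup>2) ` R)"
  have bdd: "bdd_below ((\<lambda>y. (norm (x - y))\<^sup>2) ` R)"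
    by (rule bdd_belowI2[of _ 0]) simp
  have d: "d \<le> (norm (x - y))\<^sup>2" if "y \<in> R" for y
    unfolding d_def using bdd that by (intro cInf_lower) auto
  have "\<exists>y\<in>R. (norm (x - y))\<^sup>2 < d + 1 / Suc n" for n
  proof -
    have "\<exists>z\<in>(\<lambda>y. (norm (x - y))\<^sup>2) ` R. z < d + 1 / Suc n"
      unfolding d_def by (rule cInf_lessD) (use R0 in auto)
    then show ?thesis by auto
  qed
  then obtain Y where Y: "\<And>n. Y n \<in> R" "\<And>n. (norm (x - Y n))\<^sup>2 < d + 1 / Suc n"
    by metis
  \<comment> \<open>Parallelogram law: the midpoint of \<open>Y m\<close> and \<open>Y n\<close>
    lies in \<open>R\<close>, so its squared distance from \<open>x\<close> is at least
    \<open>d\<close>, which leaves little room between the two points.\<close>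
  have par: "(norm (Y m - Y n))\<^sup>2 \<le> 2 * (1 / Suc m + 1 / Suc n)" for m n
  proof -
    have "(1/2) *\<^sub>R (Y m + Y n) \<in> R"
      using R Y by (intro subspace_scale subspace_add)
    then have "4 * d \<le> 4 * (norm (x - (1/2) *\<^sub>R (Y m + Y n)))\<^sup>2"
      using d by simp
    also have "\<dots> = (norm (2 *\<^sub>R (x - (1/2) *\<^sub>R (Y m + Y n))))\<^sup>2"
      by (simp add: power_mult_distrib)
    also have "2 *\<^sub>R (x - (1/2) *\<^sub>R (Y m + Y n)) = (x - Y m) + (x - Y n)"
      by (simp add: scaleR_diff_right scaleR_2)
    also have "(norm ((x - Y m) + (x - Y n)))\<^sup>2 = 2 * (norm (x - Y m))\<^sup>2 + 2 * (norm (x - Y n))\<^sup>2 - (norm (Y m - Y n))\<^sup>2"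
      by (simp add: power2_norm_eq_inner inner_simps inner_commute)
    finally show ?thesis using Y(2)[of m] Y(2)[of n] by (simp add: distrib_left)
  qed
  have "Cauchy Y"
  proof (rule metric_CauchyI)
    fix e :: real assume e: "e > 0"
    then have "e\<^sup>2 / 4 > 0" by simp
    then obtain N where N: "1 / real (Suc N) < e\<^sup>2 / 4"
      using nat_approx_posE by blast
    have "dist (Y m) (Y n) < e" if "m \<ge> N" "n \<ge> N" for m n
    proof -
      have "1 / real (Suc m) \<le> 1 / real (Suc N)" "1 / real (Suc n) \<le> 1 / real (Suc N)"
        using that by (auto intro!: divide_left_mono)
      then have "(norm (Y m - Y n))\<^sup>2 < e\<^sup>2"
        using par[of m n] N by simp
      then show ?thesis
        using e by (simp add: dist_norm power2_less_imp_less)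
    qed
    then show "\<exists>N. \<forall>m\<ge>N. \<forall>n\<ge>N. dist (Y m) (Y n) < e" by blast
  qed
  then obtain p where p: "Y \<longlonglongrightarrow> p"
    using Cauchy_convergent convergent_def by blast
  have pR: "p \<in> R"
    using R(2) Y(1) p closed_sequentially by blast
  have pd: "(norm (x - p))\<^sup>2 \<le> d"
  proof (rule LIMSEQ_le)
    show "(\<lambda>n. (norm (x - Y n))\<^sup>2) \<longlonglongrightarrow> (norm (x - p))\<^sup>2"
      by (intro tendsto_intros p)
    show "(\<lambda>n. d + 1 / Suc n) \<longlonglongrightarrow> d"
      using tendsto_add[OF tendsto_const LIMSEQ_inverse_real_of_nat, of d] by (simp add: inverse_eq_divide)
    show "\<exists>N. \<forall>n\<ge>N. (norm (x - Y n))\<^sup>2 \<le> d + 1 / Suc n"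
      using Y(2) less_imp_le by blast
  qed
  have orth: "(x - p) \<bullet> y = 0" if y: "y \<in> R" for y
  proof (rule ccontr)
    assume nz: "(x - p) \<bullet> y \<noteq> 0"
    then have yy: "y \<bullet> y > 0" by auto
    \<comment> \<open>The coefficient that minimises the distance from \<open>x\<close> along the
      line through \<open>p\<close> in direction \<open>y\<close>.\<close>
    define s where "s = ((x - p) \<bullet> y) / (y \<bullet> y)"
    have "p + s *\<^sub>R y \<in> R"
      using R pR y by (intro subspace_add subspace_scale)
    then have "(norm (x - p))\<^sup>2 \<le> (norm (x - (p + s *\<^sub>R y)))\<^sup>2"
      using d[of "p + s *\<^sub>R y"] pd by linarith
    also have "(norm (x - (p + s *\<^sub>R y)))\<^sup>2 = (norm ((x - p) - s *\<^sub>R y))\<^sup>2" by (simp add: diff_diff_eq)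
    also have "(norm ((x - p) - s *\<^sub>R y))\<^sup>2 = (norm (x - p))\<^sup>2 - 2 * s * ((x - p) \<bullet> y) + s\<^sup>2 * (y \<bullet> y)"
      unfolding power2_norm_eq_inner by (simp add: inner_diff_left inner_diff_right inner_commute power2_eq_square algebra_simps)
    also have "\<dots> = (norm (x - p))\<^sup>2 - ((x - p) \<bullet> y)\<^sup>2 / (y \<bullet> y)"
      using yy by (simp add: s_def power2_eq_square field_simps)
    finally have "((x - p) \<bullet> y)\<^sup>2 / (y \<bullet> y) \<le> 0" by simp
    then show False using nz yy by (simp add: divide_le_0_iff)
  qed
  show ?thesis
    using that[of "x - p"] orth x pR by auto
qed

text \<open>A uniform boundedness argument inside the Hilbert space \<open>R\<close>:
  \<open>v\<close> is a signed series of normalised humps with weights 3^-k, the signs preventing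
  earlier terms from cancelling the current one. In the application, \<open>P h\<close> says that
  the operator maps h into the unit ball.\<close>

lemma gliding_hump:
  fixes R :: "'a::{real_inner, banach} set"
  assumes R: "subspace R" "closed R"
    and unb: "\<And>C::real. \<exists>h\<in>R. P h \<and> norm h \<ge> C"
  obtains v where "v \<in> R" "\<And>C. \<exists>h. P h \<and> \<bar>v \<bullet> h\<bar> \<ge> C"
proof -
  \<comment> \<open>The growth 4^k outpaces the weights 3^-k introduced below; what survives is of
    order (4/3)^k.\<close>
  have "\<exists>h\<in>R. P h \<and> norm h \<ge> 4 ^ k" for k :: nat
    using unb by blast
  then obtain h where h: "\<And>k. h k \<in> R" "\<And>k. P (h k)" "\<And>k. norm (h k) \<ge> 4 ^ k"
    by metis
  have hpos: "norm (h k) > 0" for k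
    using h(3)[of k] by (meson less_le_trans zero_less_numeral zero_less_power)
  define g where "g k = ((1/3) ^ k / norm (h k)) *\<^sub>R h k" for k
  \<comment> \<open>The sign of the new term agrees with that of \<open>w \<bullet> h k\<close>, so
    the two contributions to the product with \<open>h k\<close> add up in modulus.\<close>
  define w where "w = rec_nat 0 (\<lambda>k w. if w \<bullet> h k \<ge> 0 then w + g k else w - g k)"
  have w0: "w 0 = 0" and wS: "w (Suc k) = (if w k \<bullet> h k \<ge> 0 then w k + g k else w k - g k)" for k
    by (simp_all add: w_def)
  have gh: "g k \<bullet> h k = (1/3) ^ k * norm (h k)" for k
    using hpos[of k] by (simp add: g_def dot_square_norm power2_eq_square)
  have gn: "norm (g k) = (1/3) ^ k" for k
    using hpos[of k] by (simp add: g_def)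
  have gR: "g k \<in> R" for k
    unfolding g_def using R h by (intro subspace_scale)
  have wR: "w k \<in> R" for k
    by (induction k) (use R gR in \<open>auto simp: w0 wS subspace_0 intro: subspace_add subspace_diff\<close>)
  have big: "\<bar>w (Suc k) \<bullet> h k\<bar> \<ge> (1/3) ^ k * norm (h k)" for k
    using gh[of k] by (auto simp: wS inner_simps)
  have step: "norm (w (Suc k) - w k) = (1/3) ^ k" for k
    by (auto simp: wS gn)
  define D where "D k = w (Suc k) - w k" for k
  have sD: "summable (\<lambda>k. norm (D k))"
    unfolding D_def step by (rule summable_geometric) simp
  have wsum: "w n = (\<Sum>k<n. D k)" for n
    by (simp add: D_def sum_lessThan_telescope w0)
  have "summable D" by (rule summable_norm_cancel[OF sD])
  then have lim: "w \<longlonglongrightarrow> suminf D"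
    using summable_LIMSEQ[of D] by (simp flip: wsum)
  have tail: "norm (suminf D - w (Suc k)) \<le> (1/3) ^ k / 2" for k
  proof -
    \<comment> \<open>The right-hand side is the exact geometric sum of the weights with indices k +
      1 to k + n. Its limit 3^-k / 2 is half of the weight that \<open>big\<close>
      guarantees.\<close>
    have "norm (w (n + Suc k) - w (Suc k)) \<le> (1/3) ^ k / 2 - (1/3) ^ (n + k) / 2" for n
    proof (induction n)
      case (Suc n)
      have "norm (w (Suc n + Suc k) - w (Suc k)) \<le> norm (w (Suc (n + Suc k)) - w (n + Suc k)) + norm (w (n + Suc k) - w (Suc k))"
        using norm_triangle_ineq[of "w (Suc (n + Suc k)) - w (n + Suc k)" "w (n + Suc k) - w (Suc k)"] by simp
      also have "\<dots> \<le> (1/3) ^ (n + Suc k) + ((1/3) ^ k / 2 - (1/3) ^ (n + k) / 2)"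
        using Suc step[of "n + Suc k"] by simp
      also have "\<dots> = (1/3) ^ k / 2 - (1/3) ^ (Suc n + k) / 2" by simp
      finally show ?case .
    qed simp
    then have "norm (w (n + Suc k) - w (Suc k)) \<le> (1/3) ^ k / 2" for n
      by (rule order_trans) simp
    moreover have "(\<lambda>n. norm (w (n + Suc k) - w (Suc k))) \<longlonglongrightarrow> norm (suminf D - w (Suc k))"
      by (intro tendsto_intros LIMSEQ_ignore_initial_segment lim)
    ultimately show ?thesis
      by (intro LIMSEQ_le_const2[of "\<lambda>n. norm (w (n + Suc k) - w (Suc k))"]) auto
  qed
  show ?thesis
  proof (rule that)
    show "suminf D \<in> R"
      using R(2) wR lim closed_sequentially by blast
    fix C :: real
    have "\<bar>suminf D \<bullet> h k\<bar> \<ge> (4/3) ^ k / 2" for k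
    proof -
      have "\<bar>(suminf D - w (Suc k)) \<bullet> h k\<bar> \<le> (1/3) ^ k / 2 * norm (h k)"
        by (rule order_trans[OF Cauchy_Schwarz_ineq2]) (intro mult_right_mono tail norm_ge_zero)
      then have "\<bar>suminf D \<bullet> h k\<bar> \<ge> (1/3) ^ k / 2 * norm (h k)"
        using big[of k] abs_triangle_ineq4[of "suminf D \<bullet> h k" "w (Suc k) \<bullet> h k"]
          abs_triangle_ineq2_sym[of "w (Suc k) \<bullet> h k" "suminf D \<bullet> h k"]
        by (simp add: inner_diff_left)
      also have "(1/3) ^ k / 2 * norm (h k) \<ge> (1/3) ^ k / 2 * 4 ^ k"
        by (intro mult_left_mono h) simp
      finally show ?thesis by (simp add: power_divide)
    qed
    moreover obtain k where "(4/3) ^ k > 2 * C"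
      using real_arch_pow[of "4/3" "2 * C"] by auto
    ultimately have "C \<le> \<bar>suminf D \<bullet> h k\<bar>"
      by (smt (verit) field_sum_of_halves)
    then show "\<exists>h. P h \<and> \<bar>suminf D \<bullet> h\<bar> \<ge> C" using h(2) by blast
  qed
qed

section \<open>Functions orthogonal to both half-line transforms\<close>

lemma integrable_inverse_square_plus_square:
  fixes r :: real
  assumes r: "r > 0"
  shows "integrable lborel (\<lambda>x::real. 1 / (r\<^sup>2 + x\<^sup>2))"
proof -
  define k where "k = min 1 (r\<^sup>2)"
  have k: "k > 0" "k \<le> 1" "k \<le> r\<^sup>2" using r by (auto simp: k_def)
  have "1 / (r\<^sup>2 + x\<^sup>2) \<le> (1 / k) * (1 / (1 + x\<^sup>2))" for x
  proof -
    have "k * (1 + x\<^sup>2) \<le> r\<^sup>2 + x\<^sup>2"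
      using k mult_right_mono[OF k(2), of "x\<^sup>2"] by (simp add: distrib_left)
    moreover have "0 < r\<^sup>2 + x\<^sup>2" "0 < 1 + x\<^sup>2"
      using r by (auto intro: add_pos_nonneg)
    ultimately show ?thesis
      using k frac_le[of 1 1 "k * (1 + x\<^sup>2)" "r\<^sup>2 + x\<^sup>2"] by simp
  qed
  then show ?thesis
    by (intro Bochner_Integration.integrable_bound[OF integrable_mult_right[OF integrable_one_over_1_plus_square, of "1 / k"]])
      (use k in \<open>auto intro!: AE_I2 order_trans[OF _ abs_ge_self]\<close>)
qed

text \<open>The function \<open>g m = \<integral>V x exp (\<i> m x) / (r\<^sup>2 + x\<^sup>2) dx\<close> is continuously differentiable and satisfies
  \<open>g' = - r g\<close> for \<open>m \<ge> 0\<close> and \<open>g' = r g\<close> for \<open>m \<le> 0\<close>. Comparing the two at \<open>0\<close> forces \<open>g 0 = 0\<close>, hence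
  \<open>g = 0\<close>.\<close>

lemma half_line_transform_zero:
  fixes V :: "real \<Rightarrow> complex"
  assumes V[measurable]: "V \<in> borel_measurable lborel"
    and V2: "integrable lborel (\<lambda>x. (cmod (V x))\<^sup>2)"
    and r: "r > 0"
    and pos: "\<And>m. m \<ge> 0 \<Longrightarrow> (\<integral>x. V x * iexp (m * x) / (of_real r - \<i> * of_real x) \<partial>lborel) = 0"
    and neg: "\<And>m. m \<ge> 0 \<Longrightarrow> (\<integral>x. V x * iexp (- m * x) / (of_real r + \<i> * of_real x) \<partial>lborel) = 0"
  shows "AE x in lborel. V x = 0"
proof -
  define q where "q x = r\<^sup>2 + x\<^sup>2" for x :: real
  have q0: "q x > 0" for x using r by (auto simp: q_def intro: add_pos_nonneg)
  have [measurable]: "q \<in> borel_measurable borel" unfolding q_def by measurable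
  have qi: "integrable lborel (\<lambda>x. 1 / q x)"
    unfolding q_def by (rule integrable_inverse_square_plus_square[OF r])
  have qc: "of_real (q x) = (of_real r - \<i> * of_real x) * (of_real r + \<i> * of_real x)" for x
    by (simp add: q_def algebra_simps power2_eq_square)
  have w: "integrable lborel (\<lambda>x. (1 + 1 / r) * ((cmod (V x))\<^sup>2 + 1 / q x))"
    using V2 qi by (intro integrable_mult_right Bochner_Integration.integrable_add)
  \<comment> \<open>The inequality between arithmetic and geometric mean replaces a product of two
    square-integrable functions by an integrable majorant.\<close>
  have sq: "cmod (V x) / sqrt (q x) \<le> (cmod (V x))\<^sup>2 + 1 / q x" for x
  proof -
    have "2 * (cmod (V x) * (1 / sqrt (q x))) \<le> (cmod (V x))\<^sup>2 + (1 / sqrt (q x))\<^sup>2"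
      using sum_squares_bound[of "cmod (V x)" "1 / sqrt (q x)"] by simp
    moreover have "(1 / sqrt (q x))\<^sup>2 = 1 / q x"
      using q0[of x] by (simp add: power_divide)
    moreover have "0 \<le> cmod (V x) * (1 / sqrt (q x))"
      using q0[of x] by simp
    ultimately show ?thesis by simp
  qed
  have b1: "\<bar>x\<bar> * cmod (V x) / q x \<le> (1 + 1 / r) * ((cmod (V x))\<^sup>2 + 1 / q x)"
    and b0: "cmod (V x) / q x \<le> (1 + 1 / r) * ((cmod (V x))\<^sup>2 + 1 / q x)" for x
  proof -
    have s: "sqrt (q x) > 0" "sqrt (q x) * sqrt (q x) = q x" using q0[of x] by auto
    have nn: "0 \<le> (cmod (V x))\<^sup>2 + 1 / q x" using q0[of x] by (simp add: less_imp_le)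
    have le: "\<bar>x\<bar> \<le> sqrt (q x)" "r \<le> sqrt (q x)"
      using r by (auto simp: q_def intro!: real_le_rsqrt)
    have "\<bar>x\<bar> * cmod (V x) / q x = (\<bar>x\<bar> / sqrt (q x)) * (cmod (V x) / sqrt (q x))"
      using s by (simp add: field_simps)
    also have "\<dots> \<le> 1 * ((cmod (V x))\<^sup>2 + 1 / q x)"
      using s le sq[of x] by (intro mult_mono) auto
    also have "\<dots> \<le> (1 + 1 / r) * ((cmod (V x))\<^sup>2 + 1 / q x)"
      using r nn by (intro mult_right_mono) auto
    finally show "\<bar>x\<bar> * cmod (V x) / q x \<le> (1 + 1 / r) * ((cmod (V x))\<^sup>2 + 1 / q x)" .
    have "cmod (V x) / q x = (1 / sqrt (q x)) * (cmod (V x) / sqrt (q x))"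
      using s by (simp add: field_simps)
    also have "\<dots> \<le> (1 / r) * ((cmod (V x))\<^sup>2 + 1 / q x)"
      using s le r sq[of x] by (intro mult_mono) (auto intro!: divide_left_mono)
    also have "\<dots> \<le> (1 + 1 / r) * ((cmod (V x))\<^sup>2 + 1 / q x)"
      using r nn by (intro mult_right_mono) auto
    finally show "cmod (V x) / q x \<le> (1 + 1 / r) * ((cmod (V x))\<^sup>2 + 1 / q x)" .
  qed
  let ?f = "\<lambda>m x. iexp (m * x) * (V x / of_real (q x))"
  let ?f' = "\<lambda>m x. \<i> * of_real x * iexp (m * x) * (V x / of_real (q x))"
  have fi: "integrable lborel (?f m)" for m
    by (rule Bochner_Integration.integrable_bound[OF w])
      (use q0 r in \<open>auto intro!: AE_I2 order_trans[OF _ abs_ge_self] b0 simp: norm_mult norm_divide less_imp_le\<close>)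
  have fi': "integrable lborel (?f' m)" for m
    by (rule Bochner_Integration.integrable_bound[OF w])
      (use q0 r b1 in \<open>auto intro!: AE_I2 order_trans[OF _ abs_ge_self] simp: norm_mult norm_divide less_imp_le\<close>)
  define g where "g m = integral\<^sup>L lborel (?f m)" for m
  define g' where "g' m = integral\<^sup>L lborel (?f' m)" for m
  have der: "(g has_vector_derivative g' m) (at m)" for m
    unfolding g_def g'_def
  proof (rule has_vector_derivative_lebesgue_integral[where a = "m - 1" and b = "m + 1", OF _ fi _ w])
    fix t x
    have "((\<lambda>z. exp (\<i> * (z * of_real x)) * (V x / of_real (q x))) has_field_derivative ?f' t x) (at (of_real t))"
      using q0[of x] by (auto intro!: derivative_eq_intros)
    from has_vector_derivative_real_field[OF this]
    show "((\<lambda>t. ?f t x) has_vector_derivative ?f' t x) (at t)" by simp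
    show "norm (?f' t x) \<le> (1 + 1 / r) * ((cmod (V x))\<^sup>2 + 1 / q x)"
      using b1[of x] q0[of x] by (simp add: norm_mult norm_divide)
  qed (use fi' in auto)
  \<comment> \<open>By the factorisation \<open>qc\<close>, (r + i x) / q x equals 1 / (r - i x), so
    r g + g' is exactly the integral that \<open>pos\<close> annihilates. The other sign below leads
    to \<open>neg\<close> in the same way.\<close>
  have gp: "g' m = - of_real r * g m" if "m \<ge> 0" for m
  proof -
    have "of_real r * g m + g' m = (\<integral>x. of_real r * ?f m x + ?f' m x \<partial>lborel)"
      unfolding g_def g'_def integral_mult_right_zero[symmetric]
      by (rule Bochner_Integration.integral_add[symmetric, OF integrable_mult_right[OF fi] fi'])
    also have "\<dots> = (\<integral>x. V x * iexp (m * x) / (of_real r - \<i> * of_real x) \<partial>lborel)"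
    proof (rule Bochner_Integration.integral_cong[OF refl])
      fix x
      have nz: "complex_of_real r + \<i> * of_real x \<noteq> 0" "complex_of_real r - \<i> * of_real x \<noteq> 0"
        using r by (auto simp: complex_eq_iff)
      have "of_real r * ?f m x + ?f' m x = (of_real r + \<i> * of_real x) * (iexp (m * x) * V x) / of_real (q x)"
        by (simp add: algebra_simps add_divide_distrib)
      also have "\<dots> = V x * iexp (m * x) / (of_real r - \<i> * of_real x)"
        unfolding qc using nz by (simp add: mult.commute)
      finally show "of_real r * ?f m x + ?f' m x = V x * iexp (m * x) / (of_real r - \<i> * of_real x)" .
    qed
    also have "\<dots> = 0" by (rule pos[OF that])
    finally show ?thesis by (simp add: add_eq_0_iff)
  qed
  have gn: "g' m = of_real r * g m" if "m \<le> 0" for m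
  proof -
    have "of_real r * g m - g' m = (\<integral>x. of_real r * ?f m x - ?f' m x \<partial>lborel)"
      unfolding g_def g'_def integral_mult_right_zero[symmetric]
      by (rule Bochner_Integration.integral_diff[symmetric, OF integrable_mult_right[OF fi] fi'])
    also have "\<dots> = (\<integral>x. V x * iexp (- (- m) * x) / (of_real r + \<i> * of_real x) \<partial>lborel)"
    proof (rule Bochner_Integration.integral_cong[OF refl])
      fix x
      have nz: "complex_of_real r + \<i> * of_real x \<noteq> 0" "complex_of_real r - \<i> * of_real x \<noteq> 0"
        using r by (auto simp: complex_eq_iff)
      have "of_real r * ?f m x - ?f' m x = (of_real r - \<i> * of_real x) * (iexp (m * x) * V x) / of_real (q x)"
        by (simp add: algebra_simps diff_divide_distrib)
      also have "\<dots> = V x * iexp (- (- m) * x) / (of_real r + \<i> * of_real x)"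
        unfolding qc using nz by (simp add: mult.commute)
      finally show "of_real r * ?f m x - ?f' m x = V x * iexp (- (- m) * x) / (of_real r + \<i> * of_real x)" .
    qed
    also have "\<dots> = 0" by (rule neg) (use that in simp)
    finally show ?thesis by simp
  qed
  have g0: "g 0 = 0" using gp[of 0] gn[of 0] r by simp
  have zero: "g m = 0" for m
  proof -
    \<comment> \<open>On an interval containing 0 where g' = c g, the function exp (- c m) g m is
      constant, and \<open>g0\<close> makes the constant zero.\<close>
    have *: "g m = 0" if S: "convex S" "0 \<in> S" "m \<in> S" and c: "\<And>m. m \<in> S \<Longrightarrow> g' m = of_real c * g m" for S c
    proof -
      have d0: "((\<lambda>m. exp (- c * m) *\<^sub>R g m) has_vector_derivative 0) (at m within S)" if m: "m \<in> S" for m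
      proof -
        have "((\<lambda>m. exp (- c * m) *\<^sub>R g m) has_vector_derivative
            exp (- c * m) *\<^sub>R g' m + (- c * exp (- c * m)) *\<^sub>R g m) (at m)"
          by (rule has_vector_derivative_scaleR[OF _ der])
            (auto intro!: derivative_eq_intros)
        moreover have "exp (- c * m) *\<^sub>R g' m + (- c * exp (- c * m)) *\<^sub>R g m = 0"
          by (simp add: c[OF m] scaleR_conv_of_real)
        ultimately show ?thesis
          by (simp add: has_vector_derivative_at_within)
      qed
      obtain k where k: "\<And>m. m \<in> S \<Longrightarrow> exp (- c * m) *\<^sub>R g m = k"
        using has_vector_derivative_zero_constant[OF S(1) d0] by blast
      then show ?thesis using k[OF S(3)] k[OF S(2)] g0 by simp
    qed
    show ?thesis
    proof (cases "m \<ge> 0")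
      case True
      then show ?thesis by (intro *[of "{0..}" "- r"]) (auto simp: gp)
    next
      case False
      then show ?thesis by (intro *[of "{..0}" "r"]) (auto simp: gn)
    qed
  qed
  have "AE x in lborel. V x / of_real (q x) = 0"
    by (rule fourier_zero) (use fi[of 0] zero in \<open>simp_all add: g_def\<close>)
  then show ?thesis
    by eventually_elim (metis divide_eq_0_iff of_real_eq_0_iff q0 less_irrefl)
qed

section \<open>A family of test functions invariant under the sub-Laplacian\<close>

text \<open>Decay is uniform on each half-plane Re z \<ge> d with d > 0 and says nothing near the
  imaginary axis. This form survives differentiation, at the cost of a smaller d, and shifts to the
  right. The values of \<open>zeta\<close> lie in Re z \<ge> 1, which leaves room for small shifts
  to the left as well.\<close>

definition rapid :: "(complex \<Rightarrow> complex) \<Rightarrow> bool" where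
  "rapid G \<longleftrightarrow> G holomorphic_on {z. Re z > 0} \<and>
     (\<forall>d>0. \<forall>k::nat. \<exists>C. \<forall>z. d \<le> Re z \<longrightarrow> norm z ^ k * norm (G z) \<le> C)"

lemma rapidD:
  assumes "rapid G" "d > 0"
  obtains C where "C \<ge> 0" "\<And>z. d \<le> Re z \<Longrightarrow> norm z ^ k * norm (G z) \<le> C"
proof -
  obtain C where C: "\<And>z. d \<le> Re z \<Longrightarrow> norm z ^ k * norm (G z) \<le> C"
    using assms unfolding rapid_def by blast
  have "0 \<le> norm (of_real d :: complex) ^ k * norm (G (of_real d))" by simp
  also have "\<dots> \<le> C" by (rule C) simp
  finally show ?thesis using that C by blast
qed

lemma rapid_holomorphic: "rapid G \<Longrightarrow> G holomorphic_on {z. Re z > 0}"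
  by (simp add: rapid_def)

lemma rapid_has_field_derivative:
  assumes "rapid G" "Re z > 0"
  shows "(G has_field_derivative deriv G z) (at z)"
  using holomorphic_derivI[OF rapid_holomorphic[OF assms(1)] open_halfspace_Re_gt] assms(2) by simp

text \<open>Cauchy's inequality on the circle of radius d / 2 about z: its points w satisfy Re w
  \<ge> d / 2, and there |z| \<le> 2 |w| converts decay at w into decay at z.\<close>

lemma rapid_deriv:
  assumes G: "rapid G"
  shows "rapid (deriv G)"
  unfolding rapid_def
proof (intro conjI allI impI)
  show "deriv G holomorphic_on {z. Re z > 0}"
    by (rule holomorphic_deriv[OF rapid_holomorphic[OF G] open_halfspace_Re_gt])
  fix d :: real and k :: nat
  assume d: "d > 0"
  obtain C where C: "C \<ge> 0" "\<And>z. d / 2 \<le> Re z \<Longrightarrow> norm z ^ k * norm (G z) \<le> C"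
    using rapidD[OF G, of "d / 2" k] d by auto
  have "norm z ^ k * norm (deriv G z) \<le> 2 ^ k * C / (d / 2)" if z: "d \<le> Re z" for z
  proof -
    have zpos: "norm z > 0" using z d complex_Re_le_cmod[of z] by linarith
    have sub: "d / 2 \<le> Re w" if "w \<in> cball z (d / 2)" for w
    proof -
      have "\<bar>Re (z - w)\<bar> \<le> d / 2"
        using that abs_Re_le_cmod[of "z - w"] by (simp add: dist_norm)
      then show ?thesis using z unfolding minus_complex.sel by linarith
    qed
    then have sub': "cball z (d / 2) \<subseteq> {z. Re z > 0}" using d by fastforce
    have "norm ((deriv ^^ 1) G z) \<le> fact 1 * (2 ^ k * C / norm z ^ k) / (d / 2) ^ 1"
    proof (rule Cauchy_inequality)
      show "G holomorphic_on ball z (d / 2)" "continuous_on (cball z (d / 2)) G"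
        using holomorphic_on_subset[OF rapid_holomorphic[OF G] sub']
        by (auto intro: holomorphic_on_imp_continuous_on holomorphic_on_subset)
      fix w assume w: "norm (z - w) = d / 2"
      then have Rw: "d / 2 \<le> Re w" using sub by (simp add: dist_norm)
      then have "norm z \<le> 2 * norm w"
        using norm_triangle_ineq[of w "z - w"] w complex_Re_le_cmod[of w] by simp
      then have "norm z ^ k * norm (G w) \<le> (2 * norm w) ^ k * norm (G w)"
        by (intro mult_right_mono power_mono) auto
      also have "\<dots> \<le> 2 ^ k * C"
        using C(2)[OF Rw] by (simp add: power_mult_distrib mult.assoc)
      finally show "norm (G w) \<le> 2 ^ k * C / norm z ^ k"
        using zpos by (simp add: pos_le_divide_eq mult.commute)
    qed (use d in simp)
    then show ?thesis using zpos d by (simp add: field_simps)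
  qed
  then show "\<exists>C. \<forall>z. d \<le> Re z \<longrightarrow> norm z ^ k * norm (deriv G z) \<le> C" by blast
qed

lemma rapid_mult_bounded:
  assumes G: "rapid G" and H: "H holomorphic_on {z. Re z > 0}"
    and B: "\<And>d. d > 0 \<Longrightarrow> \<exists>B. \<forall>z. d \<le> Re z \<longrightarrow> norm (H z) \<le> B"
  shows "rapid (\<lambda>z. H z * G z)"
  unfolding rapid_def
proof (intro conjI allI impI)
  show "(\<lambda>z. H z * G z) holomorphic_on {z. Re z > 0}"
    by (intro holomorphic_intros H rapid_holomorphic G)
  fix d :: real and k :: nat
  assume d: "d > 0"
  obtain C where C: "C \<ge> 0" "\<And>z. d \<le> Re z \<Longrightarrow> norm z ^ k * norm (G z) \<le> C"
    using rapidD[OF G d, of k] by auto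
  obtain B where B: "\<And>z. d \<le> Re z \<Longrightarrow> norm (H z) \<le> B"
    using B[OF d] by blast
  have "norm z ^ k * norm (H z * G z) \<le> B * C" if "d \<le> Re z" for z
  proof -
    have "norm (H z) * (norm z ^ k * norm (G z)) \<le> B * C"
      using B[OF that] C that order_trans[OF norm_ge_zero B[OF that]] by (intro mult_mono) auto
    then show ?thesis by (simp add: norm_mult mult_ac)
  qed
  then show "\<exists>C. \<forall>z. d \<le> Re z \<longrightarrow> norm z ^ k * norm (H z * G z) \<le> C" by blast
qed

text \<open>Turns decay in z + t into decay in z at a cost polynomial in |t|. This is the origin of
  the polynomial growth of the shifted pairings.\<close>

lemma norm_le_shift:
  fixes z t :: complex
  assumes "Re z > 0" "d > 0" "d \<le> Re (z + t)"
  shows "norm z \<le> (1 + norm t / d) * norm (z + t)"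
proof -
  have "norm z \<le> norm (z + t) + norm t"
    using norm_triangle_ineq[of "z + t" "- t"] by simp
  moreover have "norm t \<le> norm t / d * norm (z + t)"
  proof -
    have "d \<le> norm (z + t)" using assms complex_Re_le_cmod[of "z + t"] by linarith
    then have "norm t / d * d \<le> norm t / d * norm (z + t)"
      using assms by (intro mult_left_mono) auto
    then show ?thesis using assms by simp
  qed
  ultimately show ?thesis by (simp add: distrib_right)
qed

lemma rapid_shift:
  assumes G: "rapid G" and t: "Re t \<ge> 0"
  shows "rapid (\<lambda>z. G (z + t))"
  unfolding rapid_def
proof (intro conjI allI impI)
  have "(G \<circ> (\<lambda>z. z + t)) holomorphic_on {z. Re z > 0}"
    by (rule holomorphic_on_compose_gen[OF _ rapid_holomorphic[OF G]])
      (use t in \<open>auto intro!: holomorphic_intros\<close>)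
  then show "(\<lambda>z. G (z + t)) holomorphic_on {z. Re z > 0}" by (simp add: comp_def)
  fix d :: real and k :: nat
  assume d: "d > 0"
  obtain C where C: "C \<ge> 0" "\<And>z. d \<le> Re z \<Longrightarrow> norm z ^ k * norm (G z) \<le> C"
    using rapidD[OF G d, of k] by auto
  have "norm z ^ k * norm (G (z + t)) \<le> (1 + norm t / d) ^ k * C" if z: "d \<le> Re z" for z
  proof -
    have "norm z ^ k * norm (G (z + t)) \<le> ((1 + norm t / d) * norm (z + t)) ^ k * norm (G (z + t))"
      using z d t by (intro mult_right_mono power_mono norm_le_shift) auto
    also have "\<dots> \<le> (1 + norm t / d) ^ k * C"
      using C(2)[of "z + t"] z t d by (simp add: power_mult_distrib mult.assoc mult_left_mono)
    finally show ?thesis .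
  qed
  then show "\<exists>C. \<forall>z. d \<le> Re z \<longrightarrow> norm z ^ k * norm (G (z + t)) \<le> C" by blast
qed

lemma Re_csqrt_ge:
  assumes "Re z \<ge> 0"
  shows "Re (csqrt z) \<ge> sqrt (norm z / 2)"
  using assms by simp

text \<open>A holomorphic damping factor has to decay in every direction of the half-plane,
  including vertically, where exp (- e z) has constant modulus. The principal root satisfies Re
  (csqrt z) \<ge> sqrt (|z| / 2) there, so its exponential beats every power.\<close>

lemma rapid_exp_csqrt:
  assumes e: "e > 0"
  shows "rapid (\<lambda>z. exp (- of_real e * csqrt z))"
  unfolding rapid_def
proof (intro conjI allI impI)
  show "(\<lambda>z. exp (- of_real e * csqrt z)) holomorphic_on {z. Re z > 0}"
    by (intro holomorphic_intros) (auto simp: complex_nonpos_Reals_iff)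
  fix d :: real and k :: nat
  assume d: "d > 0"
  \<comment> \<open>With s = sqrt (|z| / 2) the power |z|^k is 2^k s^(2 k), and (e s)^(2 k) \<le> (2
    k)! exp (e s) by a single term of the exponential series.\<close>
  have "norm z ^ k * norm (exp (- of_real e * csqrt z)) \<le> 2 ^ k * fact (2 * k) / e ^ (2 * k)" if z: "d \<le> Re z" for z
  proof -
    define s where "s = sqrt (norm z / 2)"
    have s: "s \<ge> 0" "norm z = 2 * s\<^sup>2" by (simp_all add: s_def)
    have "norm (exp (- of_real e * csqrt z)) \<le> exp (- (e * s))"
      using Re_csqrt_ge[of z] z d e by (simp add: s_def)
    then have "norm z ^ k * norm (exp (- of_real e * csqrt z)) \<le> norm z ^ k * exp (- (e * s))"
      by (intro mult_left_mono) auto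
    also have "\<dots> = 2 ^ k / e ^ (2 * k) * ((e * s) ^ (2 * k) / exp (e * s))"
      using e by (simp add: s power_mult_distrib exp_minus field_simps flip: power_mult)
    also have "(e * s) ^ (2 * k) / exp (e * s) \<le> fact (2 * k)"
    proof -
      have "sum (\<lambda>n. (e * s) ^ n /\<^sub>R fact n) {2 * k} \<le> exp (e * s)"
        unfolding exp_def using e s by (intro sum_le_suminf summable_exp_generic) auto
      then show ?thesis by (simp add: field_simps)
    qed
    finally show ?thesis using e by (simp add: mult_left_mono divide_right_mono)
  qed
  then show "\<exists>C. \<forall>z. d \<le> Re z \<longrightarrow> norm z ^ k * norm (exp (- of_real e * csqrt z)) \<le> C" by blast
qed

section \<open>The test functions, their derivatives and their decay\<close>

definition zcoord :: "heis \<Rightarrow> complex" where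
  "zcoord x = of_real (fst x) + \<i> * of_real (fst (snd x))"

text \<open>Up to the affine change \<open>\<zeta> = 1 - \<i> w\<close> this is the CR function \<open>w = \<tau> + \<i> \<bar>z\<bar>\<^sup>2\<close>, on which
  \<open>X w = \<i> Y w\<close>.\<close>

definition zeta :: "heis \<Rightarrow> complex" where
  "zeta x = of_real (1 + (fst x)\<^sup>2 + (fst (snd x))\<^sup>2) - \<i> * of_real (snd (snd x))"

definition zmon :: "nat \<Rightarrow> nat \<Rightarrow> (complex \<Rightarrow> complex) \<Rightarrow> heis \<Rightarrow> complex" where
  "zmon j l G x = zcoord x ^ j * cnj (zcoord x) ^ l * G (zeta x)"

lemma Re_zeta: "Re (zeta x) = 1 + (fst x)\<^sup>2 + (fst (snd x))\<^sup>2" and Im_zeta: "Im (zeta x) = - snd (snd x)"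
  by (simp_all add: zeta_def)

lemma Re_zeta_ge: "Re (zeta x) \<ge> 1" by (simp add: Re_zeta)

text \<open>The three coefficients are again combinations of test functions built from
  \<open>G\<close> and \<open>deriv G\<close>. The exponents j - 1 and l - 1 come with the factors j
  and l, so a truncated subtraction contributes nothing.\<close>

lemma zmon_has_derivative:
  assumes G: "rapid G"
  shows "(zmon j l G has_derivative (\<lambda>h.
      of_real (fst h) * (of_nat j * zmon (j - 1) l G x + of_nat l * zmon j (l - 1) G x
        + zmon (j + 1) l (deriv G) x + zmon j (l + 1) (deriv G) x)
    + of_real (fst (snd h)) * (\<i> * (of_nat j * zmon (j - 1) l G x - of_nat l * zmon j (l - 1) G x
        - zmon (j + 1) l (deriv G) x + zmon j (l + 1) (deriv G) x))
    + of_real (snd (snd h)) * (- \<i> * zmon j l (deriv G) x))) (at x)"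
proof -
  have "Re (zeta x) > 0" using Re_zeta_ge[of x] by linarith
  note dG = rapid_has_field_derivative[OF G this]
  \<comment> \<open>The differential of \<open>zeta\<close>, with 2 y1 written as z + cnj z and 2 y2
    as i (cnj z - z).\<close>
  let ?D = "\<lambda>h. of_real (fst h) * (zcoord x + cnj (zcoord x)) + of_real (fst (snd h)) * (\<i> * (cnj (zcoord x) - zcoord x)) - \<i> * of_real (snd (snd h))"
  have dz: "(zeta has_derivative ?D) (at x)"
    unfolding zeta_def by (auto intro!: derivative_eq_intros simp: fun_eq_iff zcoord_def algebra_simps)
  have dGz: "((\<lambda>x. G (zeta x)) has_derivative (\<lambda>h. deriv G (zeta x) * ?D h)) (at x)"
    using has_derivative_compose[OF dz dG[unfolded has_field_derivative_def]] by simp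
  have dh: "(zcoord has_derivative zcoord) (at x)"
    unfolding zcoord_def by (auto intro!: derivative_eq_intros)
  have dhc: "((\<lambda>x. cnj (zcoord x)) has_derivative (\<lambda>h. cnj (zcoord h))) (at x)"
    by (rule bounded_linear.has_derivative[OF bounded_linear_cnj dh])
  show ?thesis
    unfolding zmon_def
  proof (rule has_derivative_eq_rhs[OF has_derivative_mult[OF has_derivative_mult[OF has_derivative_power[OF dh] has_derivative_power[OF dhc]] dGz]], rule ext)
    fix h
    show "zcoord x ^ j * cnj (zcoord x) ^ l * (deriv G (zeta x) * ?D h) + (zcoord x ^ j * (of_nat l * cnj (zcoord h) * cnj (zcoord x) ^ (l - 1))
        + of_nat j * zcoord h * zcoord x ^ (j - 1) * cnj (zcoord x) ^ l) * G (zeta x)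
      = of_real (fst h) * (of_nat j * (zcoord x ^ (j - 1) * cnj (zcoord x) ^ l * G (zeta x)) + of_nat l * (zcoord x ^ j * cnj (zcoord x) ^ (l - 1) * G (zeta x))
        + zcoord x ^ (j + 1) * cnj (zcoord x) ^ l * deriv G (zeta x) + zcoord x ^ j * cnj (zcoord x) ^ (l + 1) * deriv G (zeta x))
    + of_real (fst (snd h)) * (\<i> * (of_nat j * (zcoord x ^ (j - 1) * cnj (zcoord x) ^ l * G (zeta x)) - of_nat l * (zcoord x ^ j * cnj (zcoord x) ^ (l - 1) * G (zeta x))
        - zcoord x ^ (j + 1) * cnj (zcoord x) ^ l * deriv G (zeta x) + zcoord x ^ j * cnj (zcoord x) ^ (l + 1) * deriv G (zeta x)))
    + of_real (snd (snd h)) * (- \<i> * (zcoord x ^ j * cnj (zcoord x) ^ l * deriv G (zeta x)))"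
      by (simp add: zcoord_def[of h] algebra_simps)
  qed
qed

text \<open>The complex span of the test functions. The inductive form gives stability under
  derivatives and rapid decay by rule induction, hence the Schwartz property.\<close>

inductive zmon_comb :: "(heis \<Rightarrow> complex) \<Rightarrow> bool" where
  zmon_comb_zmon: "rapid G \<Longrightarrow> zmon_comb (zmon j l G)"
| zmon_comb_cmult: "zmon_comb f \<Longrightarrow> zmon_comb (\<lambda>x. c * f x)"
| zmon_comb_add: "zmon_comb f \<Longrightarrow> zmon_comb g \<Longrightarrow> zmon_comb (\<lambda>x. f x + g x)"

lemma zmon_comb_diff: "zmon_comb f \<Longrightarrow> zmon_comb g \<Longrightarrow> zmon_comb (\<lambda>x. f x - g x)"
  using zmon_comb_add[of f, OF _ zmon_comb_cmult[of g "-1"]] by simp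

lemma zmon_comb_has_derivative:
  assumes "zmon_comb f"
  shows "\<exists>D1 D2 D3. zmon_comb D1 \<and> zmon_comb D2 \<and> zmon_comb D3 \<and> (\<forall>x. (f has_derivative (\<lambda>h.
      of_real (fst h) * D1 x + of_real (fst (snd h)) * D2 x + of_real (snd (snd h)) * D3 x)) (at x))"
  using assms
proof induction
  case (zmon_comb_zmon G j l)
  have *: "zmon_comb (zmon j l G)" "zmon_comb (zmon j l (deriv G))" for j l
    using zmon_comb_zmon by (auto intro: zmon_comb.zmon_comb_zmon rapid_deriv)
  show ?case
    by (rule exI, rule exI, rule exI, intro conjI allI)
      (rule_tac[4] zmon_has_derivative[OF zmon_comb_zmon], (intro zmon_comb_add zmon_comb_diff zmon_comb_cmult *)+)
next
  case (zmon_comb_cmult f c)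
  then obtain D1 D2 D3 where D: "zmon_comb D1" "zmon_comb D2" "zmon_comb D3" "\<And>x. (f has_derivative (\<lambda>h.
      of_real (fst h) * D1 x + of_real (fst (snd h)) * D2 x + of_real (snd (snd h)) * D3 x)) (at x)"
    by blast
  have "((\<lambda>x. c * f x) has_derivative (\<lambda>h.
      of_real (fst h) * (c * D1 x) + of_real (fst (snd h)) * (c * D2 x) + of_real (snd (snd h)) * (c * D3 x))) (at x)" for x
    by (rule has_derivative_eq_rhs[OF has_derivative_mult_right[OF D(4)]]) (simp add: fun_eq_iff algebra_simps)
  then show ?case using D by (blast intro: zmon_comb.zmon_comb_cmult)
next
  case (zmon_comb_add f g)
  then obtain D1 D2 D3 E1 E2 E3 where D: "zmon_comb D1" "zmon_comb D2" "zmon_comb D3" "\<And>x. (f has_derivative (\<lambda>h.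
      of_real (fst h) * D1 x + of_real (fst (snd h)) * D2 x + of_real (snd (snd h)) * D3 x)) (at x)"
    and E: "zmon_comb E1" "zmon_comb E2" "zmon_comb E3" "\<And>x. (g has_derivative (\<lambda>h.
      of_real (fst h) * E1 x + of_real (fst (snd h)) * E2 x + of_real (snd (snd h)) * E3 x)) (at x)"
    by blast
  have "((\<lambda>x. f x + g x) has_derivative (\<lambda>h.
      of_real (fst h) * (D1 x + E1 x) + of_real (fst (snd h)) * (D2 x + E2 x) + of_real (snd (snd h)) * (D3 x + E3 x))) (at x)" for x
    by (rule has_derivative_eq_rhs[OF has_derivative_add[OF D(4) E(4)]]) (simp add: fun_eq_iff algebra_simps)
  then show ?case using D E by (blast intro: zmon_comb.zmon_comb_add)
qed

lemma dir_deriv_eq: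
  "(f has_derivative f') (at x) \<Longrightarrow> dir_deriv e f x = f' e"
  unfolding dir_deriv_def by (metis frechet_derivative_at)

lemma zmon_comb_differentiable: "zmon_comb f \<Longrightarrow> f differentiable (at x)"
  using zmon_comb_has_derivative unfolding differentiable_def by blast

lemma heis_Basis: "(Basis :: heis set) = {(1, 0, 0), (0, 1, 0), (0, 0, 1)}"
  by (auto simp: Basis_prod_def zero_prod_def)

lemma zmon_comb_dir_deriv:
  assumes "zmon_comb f" "e \<in> Basis"
  shows "zmon_comb (dir_deriv e f)"
proof -
  obtain D1 D2 D3 where D: "zmon_comb D1" "zmon_comb D2" "zmon_comb D3" "\<And>x. (f has_derivative (\<lambda>h.
      of_real (fst h) * D1 x + of_real (fst (snd h)) * D2 x + of_real (snd (snd h)) * D3 x)) (at x)"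
    using zmon_comb_has_derivative[OF assms(1)] by blast
  have "dir_deriv (1, 0, 0) f = D1" "dir_deriv (0, 1, 0) f = D2" "dir_deriv (0, 0, 1) f = D3"
    using dir_deriv_eq[OF D(4)] by (auto simp: fun_eq_iff)
  then show ?thesis using assms(2) D by (auto simp: heis_Basis)
qed

text \<open>Re zeta controls |z|^2 and Im zeta is - tau, so powers of |zeta| serve as weights
  measuring decay on the whole group.\<close>

lemma norm_zcoord_le: "norm (zcoord x) \<le> norm (zeta x)"
  and norm_le_zeta: "norm x \<le> 3 * norm (zeta x)"
proof -
  obtain a b c where x: "x = (a, b, c)" by (cases x)
  have le: "t \<le> 1 + t\<^sup>2" for t :: real
  proof -
    have "2 * t \<le> t\<^sup>2 + 1" using sum_squares_bound[of t 1] by simp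
    then show ?thesis using zero_le_power2[of t] by linarith
  qed
  have R: "1 + a\<^sup>2 + b\<^sup>2 \<le> norm (zeta x)" using complex_Re_le_cmod[of "zeta x"] by (simp add: Re_zeta x)
  have "\<bar>c\<bar> \<le> norm (zeta x)" using abs_Im_le_cmod[of "zeta x"] by (simp add: Im_zeta x)
  moreover have "\<bar>a\<bar> \<le> norm (zeta x)" "\<bar>b\<bar> \<le> norm (zeta x)"
    using le[of "\<bar>a\<bar>"] le[of "\<bar>b\<bar>"] R zero_le_power2[of a] zero_le_power2[of b] unfolding power2_abs by linarith+
  moreover have "norm x \<le> \<bar>a\<bar> + (\<bar>b\<bar> + \<bar>c\<bar>)"
    using norm_Pair_le[of a "(b, c)"] norm_Pair_le[of b c] by (simp add: x)
  ultimately show "norm x \<le> 3 * norm (zeta x)" by linarith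
  have "norm (zcoord x) = sqrt (a\<^sup>2 + b\<^sup>2)" by (simp add: zcoord_def x cmod_def)
  also have "\<dots> \<le> 1 + a\<^sup>2 + b\<^sup>2"
    using le[of "sqrt (a\<^sup>2 + b\<^sup>2)"] by simp
  finally show "norm (zcoord x) \<le> norm (zeta x)" using R by simp
qed

lemma zmon_comb_decay:
  assumes "zmon_comb f"
  shows "\<exists>C. \<forall>x. norm (zeta x) ^ k * norm (f x) \<le> C"
  using assms
proof induction
  case (zmon_comb_zmon G j l)
  obtain C where C: "\<And>z. 1 \<le> Re z \<Longrightarrow> norm z ^ (k + j + l) * norm (G z) \<le> C"
    using rapidD[OF zmon_comb_zmon, of 1 "k + j + l"] by auto
  have "norm (zeta x) ^ k * norm (zmon j l G x) \<le> C" for x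
  proof -
    have "norm (zeta x) ^ k * norm (zmon j l G x) = norm (zeta x) ^ k * (norm (zcoord x) ^ j * norm (zcoord x) ^ l * norm (G (zeta x)))"
      by (simp add: zmon_def norm_mult norm_power)
    also have "\<dots> \<le> norm (zeta x) ^ k * (norm (zeta x) ^ j * norm (zeta x) ^ l * norm (G (zeta x)))"
      by (intro mult_left_mono mult_right_mono mult_mono power_mono norm_zcoord_le) auto
    also have "\<dots> \<le> C" using C[OF Re_zeta_ge[of x]] by (simp add: power_add mult_ac)
    finally show ?thesis .
  qed
  then show ?case by blast
next
  case (zmon_comb_cmult f c)
  then obtain C where C: "\<And>x. norm (zeta x) ^ k * norm (f x) \<le> C" by blast
  then have "norm (zeta x) ^ k * norm (c * f x) \<le> norm c * C" for x
    using mult_left_mono[OF C[of x], of "norm c"] by (simp add: norm_mult mult_ac)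
  then show ?case by blast
next
  case (zmon_comb_add f g)
  then obtain C D where C: "\<And>x. norm (zeta x) ^ k * norm (f x) \<le> C" "\<And>x. norm (zeta x) ^ k * norm (g x) \<le> D" by blast
  have "norm (zeta x) ^ k * norm (f x + g x) \<le> C + D" for x
  proof -
    have "norm (zeta x) ^ k * norm (f x + g x) \<le> norm (zeta x) ^ k * (norm (f x) + norm (g x))"
      by (intro mult_left_mono norm_triangle_ineq) auto
    then show ?thesis using C[of x] by (simp add: distrib_left)
  qed
  then show ?case by blast
qed

lemma zmon_comb_schwartz:
  assumes "zmon_comb f"
  shows "schwartz f"
  unfolding schwartz_def
proof (intro allI impI conjI)
  fix es :: "heis list"
  assume "set es \<subseteq> Basis"
  then have *: "zmon_comb (foldr dir_deriv es f)"
    by (induction es) (auto simp: assms intro: zmon_comb_dir_deriv)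
  then show "foldr dir_deriv es f differentiable (at x)" for x
    by (rule zmon_comb_differentiable)
  fix k :: nat
  obtain C where C: "\<And>x. norm (zeta x) ^ k * norm (foldr dir_deriv es f x) \<le> C"
    using zmon_comb_decay[OF *] by blast
  have "norm (norm x ^ k *\<^sub>R foldr dir_deriv es f x) \<le> 3 ^ k * C" for x
  proof -
    have "norm (norm x ^ k *\<^sub>R foldr dir_deriv es f x) = norm x ^ k * norm (foldr dir_deriv es f x)"
      by simp
    also have "\<dots> \<le> (3 * norm (zeta x)) ^ k * norm (foldr dir_deriv es f x)"
      by (intro mult_right_mono power_mono norm_le_zeta) auto
    also have "\<dots> \<le> 3 ^ k * C" using C[of x] by (simp add: power_mult_distrib mult.assoc)
    finally show ?thesis .
  qed
  then show "bounded (range (\<lambda>x. norm x ^ k *\<^sub>R foldr dir_deriv es f x))"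
    by (auto intro!: boundedI)
qed

section \<open>Action of the vector fields and the sub-Laplacian on the test functions\<close>

lemma vf_X_eq:
  "vf_X f x = dir_deriv (1, 0, 0) f x - 2 * of_real (fst (snd x)) * dir_deriv (0, 0, 1) f x"
  and vf_Y_eq:
  "vf_Y f x = dir_deriv (0, 1, 0) f x + 2 * of_real (fst x) * dir_deriv (0, 0, 1) f x"
  by (cases x; simp add: vf_X_def vf_Y_def)+

lemma dir_deriv_add:
  "f differentiable (at x) \<Longrightarrow> g differentiable (at x) \<Longrightarrow> dir_deriv e (\<lambda>x. f x + g x) x = dir_deriv e f x + dir_deriv e g x"
  unfolding dir_deriv_def by (simp add: frechet_derivative_works frechet_derivative_at[symmetric, OF has_derivative_add])

lemma dir_deriv_cmult:
  fixes f :: "'a::real_normed_vector \<Rightarrow> complex"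
  shows "f differentiable (at x) \<Longrightarrow> dir_deriv e (\<lambda>x. c * f x) x = c * dir_deriv e f x"
  unfolding dir_deriv_def by (simp add: frechet_derivative_works frechet_derivative_at[symmetric, OF has_derivative_mult_right])

lemma
  assumes "zmon_comb f" "zmon_comb g"
  shows vf_X_lin: "vf_X (\<lambda>x. a * f x + b * g x) = (\<lambda>x. a * vf_X f x + b * vf_X g x)"
    and vf_Y_lin: "vf_Y (\<lambda>x. a * f x + b * g x) = (\<lambda>x. a * vf_Y f x + b * vf_Y g x)"
  by (simp_all add: fun_eq_iff vf_X_eq vf_Y_eq dir_deriv_add dir_deriv_cmult zmon_comb_differentiable zmon_comb_cmult assms algebra_simps)

text \<open>X zeta = 2 z and Y zeta = - 2 i z: the tau-derivative cancels the part of the Euclidean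
  gradient that contains cnj z.\<close>

lemma
  assumes "rapid G"
  shows vf_X_zmon: "vf_X (zmon j l G) = (\<lambda>x. of_nat j * zmon (j - 1) l G x + (of_nat l * zmon j (l - 1) G x + 2 * zmon (j + 1) l (deriv G) x))"
    and vf_Y_zmon: "vf_Y (zmon j l G) = (\<lambda>x. \<i> * of_nat j * zmon (j - 1) l G x + (- \<i> * of_nat l * zmon j (l - 1) G x + (- 2 * \<i>) * zmon (j + 1) l (deriv G) x))"
  by (simp_all add: fun_eq_iff vf_X_eq vf_Y_eq dir_deriv_eq[OF zmon_has_derivative[OF assms]])
    (simp_all add: zmon_def zcoord_def algebra_simps)

text \<open>Since (X zeta)^2 + (Y zeta)^2 = 4 z^2 - 4 z^2 = 0, no second derivative of
  \<open>G\<close> survives. In 4 (2 j + 1), the 4 is X (2 z) + Y (- 2 i z) and 8 j comes from the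
  cross terms with z^j; the cross terms with powers of cnj z cancel. The last term is minus the
  planar Laplacian of the monomial.\<close>

lemma sublaplacian_zmon:
  assumes "rapid G"
  shows "sublaplacian (zmon j l G) = (\<lambda>x. - 4 * of_nat (2 * j + 1) * zmon j l (deriv G) x - 4 * of_nat (j * l) * zmon (j - 1) (l - 1) G x)"
proof -
  have *: "zmon_comb (zmon j l G)" "zmon_comb (zmon j l (deriv G))" for j l
    using assms by (auto intro: zmon_comb.zmon_comb_zmon rapid_deriv)
  have X: "vf_X (\<lambda>x. a * zmon j1 l1 G x + (b * zmon j2 l2 G x + c * zmon j3 l3 (deriv G) x))
      = (\<lambda>x. a * vf_X (zmon j1 l1 G) x + (b * vf_X (zmon j2 l2 G) x + c * vf_X (zmon j3 l3 (deriv G)) x))"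
    and Y: "vf_Y (\<lambda>x. a * zmon j1 l1 G x + (b * zmon j2 l2 G x + c * zmon j3 l3 (deriv G) x))
      = (\<lambda>x. a * vf_Y (zmon j1 l1 G) x + (b * vf_Y (zmon j2 l2 G) x + c * vf_Y (zmon j3 l3 (deriv G)) x))"
    for a b c j1 l1 j2 l2 j3 l3
  proof -
    have f: "zmon_comb (\<lambda>x. b * zmon j2 l2 G x + c * zmon j3 l3 (deriv G) x)"
      by (intro zmon_comb_add zmon_comb_cmult *)
    show "vf_X (\<lambda>x. a * zmon j1 l1 G x + (b * zmon j2 l2 G x + c * zmon j3 l3 (deriv G) x))
      = (\<lambda>x. a * vf_X (zmon j1 l1 G) x + (b * vf_X (zmon j2 l2 G) x + c * vf_X (zmon j3 l3 (deriv G)) x))"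
      using vf_X_lin[where a=a and b=1 and f="zmon j1 l1 G", OF *(1) f] by (simp add: vf_X_lin[OF *(1) *(2)])
    show "vf_Y (\<lambda>x. a * zmon j1 l1 G x + (b * zmon j2 l2 G x + c * zmon j3 l3 (deriv G) x))
      = (\<lambda>x. a * vf_Y (zmon j1 l1 G) x + (b * vf_Y (zmon j2 l2 G) x + c * vf_Y (zmon j3 l3 (deriv G)) x))"
      using vf_Y_lin[where a=a and b=1 and f="zmon j1 l1 G", OF *(1) f] by (simp add: vf_Y_lin[OF *(1) *(2)])
  qed
  show ?thesis
    unfolding sublaplacian_def vf_X_zmon[OF assms] vf_Y_zmon[OF assms] X Y
      vf_X_zmon[OF rapid_deriv[OF assms]] vf_Y_zmon[OF rapid_deriv[OF assms]]
    \<comment> \<open>Splitting both exponents at 0 resolves the truncated subtractions.\<close>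
    by (rule ext, cases j; cases l) (simp_all add: zmon_def algebra_simps)
qed

section \<open>Vanishing of the pairings\<close>

lemma integrable_product_mult:
  fixes f :: "'a \<Rightarrow> real" and g :: "'b \<Rightarrow> real"
  assumes "sigma_finite_measure M" "sigma_finite_measure N" "integrable M f" "integrable N g"
  shows "integrable (M \<Otimes>\<^sub>M N) (\<lambda>x. f (fst x) * g (snd x))"
proof -
  interpret pair_sigma_finite M N using assms by (simp add: pair_sigma_finite_def)
  have [measurable]: "f \<in> borel_measurable M" "g \<in> borel_measurable N" using assms by auto
  show ?thesis
    by (rule Fubini_integrable) (use assms in \<open>auto simp: abs_mult\<close>)
qed

text \<open>A common integrable majorant. Being at most 1, it also majorises its own square, so a
  bound by a multiple of it gives integrability and square integrability together.\<close>

definition weight :: "heis \<Rightarrow> real" where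
  "weight x = 1 / (1 + (fst x)\<^sup>2) * (1 / (1 + (fst (snd x))\<^sup>2) * (1 / (1 + (snd (snd x))\<^sup>2)))"

lemma integrable_weight: "integrable lborel weight"
proof -
  have "integrable (lborel \<Otimes>\<^sub>M (lborel \<Otimes>\<^sub>M lborel)) weight"
    using integrable_product_mult[OF lborel.sigma_finite_measure_axioms _ integrable_one_over_1_plus_square
        integrable_product_mult[OF lborel.sigma_finite_measure_axioms lborel.sigma_finite_measure_axioms
          integrable_one_over_1_plus_square integrable_one_over_1_plus_square]]
    by (simp add: weight_def[abs_def] lborel_prod lborel.sigma_finite_measure_axioms)
  then show ?thesis by (simp add: lborel_prod)
qed

lemma weight_pos: "weight x > 0" and weight_le_1: "weight x \<le> 1"
proof -
  have *: "0 < 1 / (1 + t\<^sup>2)" "1 / (1 + t\<^sup>2) \<le> 1" for t :: real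
    by (auto simp: add_pos_nonneg divide_le_eq)
  show "weight x > 0" unfolding weight_def by (intro mult_pos_pos *)
  have "weight x \<le> 1 * (1 * 1)" unfolding weight_def by (intro mult_mono *) (auto intro!: mult_nonneg_nonneg)
  then show "weight x \<le> 1" by simp
qed

text \<open>Origin of the exponent 4: two factors |zeta| absorb (1 + y1^2) (1 + y2^2) through Re
  zeta, the other two absorb 1 + tau^2.\<close>

lemma weight_zeta: "1 \<le> weight x * norm (zeta x) ^ 4"
proof -
  obtain a b c where x: "x = (a, b, c)" by (cases x)
  have R: "1 + a\<^sup>2 + b\<^sup>2 \<le> norm (zeta x)" using complex_Re_le_cmod[of "zeta x"] by (simp add: Re_zeta x)
  have "(1 + a\<^sup>2) * (1 + b\<^sup>2) \<le> norm (zeta x) * norm (zeta x)"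
    by (intro mult_mono order_trans[OF _ R]) auto
  moreover have "1 + c\<^sup>2 \<le> norm (zeta x) * norm (zeta x)"
  proof -
    have "1 \<le> (1 + a\<^sup>2 + b\<^sup>2)\<^sup>2"
      by (rule one_le_power) simp
    then have "1 + c\<^sup>2 \<le> (Re (zeta x))\<^sup>2 + (Im (zeta x))\<^sup>2"
      by (simp add: Re_zeta Im_zeta x)
    then show ?thesis by (simp add: cmod_power2 flip: power2_eq_square)
  qed
  ultimately have "((1 + a\<^sup>2) * (1 + b\<^sup>2)) * (1 + c\<^sup>2) \<le> (norm (zeta x) * norm (zeta x)) * (norm (zeta x) * norm (zeta x))"
    by (rule mult_mono) auto
  then have "((1 + a\<^sup>2) * (1 + b\<^sup>2)) * (1 + c\<^sup>2) \<le> norm (zeta x) ^ 4"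
    by (simp add: power4_eq_xxxx mult.assoc)
  moreover have "0 < ((1 + a\<^sup>2) * (1 + b\<^sup>2)) * (1 + c\<^sup>2)"
    by (intro mult_pos_pos) (auto intro: add_pos_nonneg)
  ultimately show ?thesis by (simp add: weight_def x le_divide_eq mult.assoc)
qed

lemma le_weight:
  assumes "norm (zeta x) ^ 4 * a \<le> C" "0 \<le> a"
  shows "a \<le> C * weight x"
proof -
  have "1 * a \<le> (weight x * norm (zeta x) ^ 4) * a"
    by (intro mult_right_mono weight_zeta assms)
  also have "\<dots> = weight x * (norm (zeta x) ^ 4 * a)" by simp
  also have "\<dots> \<le> weight x * C" using weight_pos[of x] assms by (intro mult_left_mono) auto
  finally show ?thesis by (simp add: mult.commute)
qed

lemma square_integrable_weight_bound:
  assumes "f \<in> borel_measurable lborel" "\<And>x. norm (f x) \<le> C * weight x"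
  shows "square_integrable f"
  unfolding square_integrable_def
proof
  show "integrable lborel (\<lambda>x. (cmod (f x))\<^sup>2)"
  proof (rule Bochner_Integration.integrable_bound[OF integrable_mult_right[OF integrable_weight, of "C\<^sup>2"]])
    show "AE x in lborel. norm ((cmod (f x))\<^sup>2) \<le> norm (C\<^sup>2 * weight x)"
    proof (rule AE_I2)
      fix x
      have "(cmod (f x))\<^sup>2 \<le> (C * weight x)\<^sup>2" by (intro power_mono assms) auto
      also have "\<dots> \<le> C\<^sup>2 * weight x"
        using weight_pos[of x] weight_le_1[of x] by (simp add: power_mult_distrib mult_left_mono power2_eq_square[of "weight x"] mult_left_le)
      finally show "norm ((cmod (f x))\<^sup>2) \<le> norm (C\<^sup>2 * weight x)" using weight_pos[of x] by simp
    qed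
  qed (use assms in measurable)
qed (rule assms)

lemma zmon_comb_measurable: "zmon_comb f \<Longrightarrow> f \<in> borel_measurable borel"
  by (intro borel_measurable_continuous_onI continuous_at_imp_continuous_on ballI
      differentiable_imp_continuous_within zmon_comb_differentiable)

lemma zmon_comb_le_weight: "zmon_comb f \<Longrightarrow> \<exists>C. \<forall>x. norm (f x) \<le> C * weight x"
  using zmon_comb_decay[of f 4] le_weight by (meson norm_ge_zero)

lemma zmon_comb_square_integrable: "zmon_comb f \<Longrightarrow> square_integrable f"
  using square_integrable_weight_bound[of f] zmon_comb_le_weight[of f] zmon_comb_measurable[of f] by auto

lemma square_integrable_times:
  assumes f: "square_integrable f" and g: "square_integrable g"
  shows "integrable lborel (\<lambda>x. f x * g x)"
proof (rule Bochner_Integration.integrable_bound)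
  show "integrable lborel (\<lambda>x. (cmod (f x))\<^sup>2 + (cmod (g x))\<^sup>2)"
    using f g by (auto simp: square_integrable_def)
  show "(\<lambda>x. f x * g x) \<in> borel_measurable lborel"
    using f g by (auto simp: square_integrable_def)
  show "AE x in lborel. norm (f x * g x) \<le> norm ((cmod (f x))\<^sup>2 + (cmod (g x))\<^sup>2)"
  proof (rule AE_I2)
    fix x
    have "0 \<le> cmod (f x) * cmod (g x)" by simp
    moreover have "2 * (cmod (f x) * cmod (g x)) \<le> (cmod (f x))\<^sup>2 + (cmod (g x))\<^sup>2"
      using sum_squares_bound[of "cmod (f x)" "cmod (g x)"] by simp
    ultimately have "cmod (f x) * cmod (g x) \<le> (cmod (f x))\<^sup>2 + (cmod (g x))\<^sup>2" by linarith
    then show "norm (f x * g x) \<le> norm ((cmod (f x))\<^sup>2 + (cmod (g x))\<^sup>2)"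
      by (simp add: norm_mult)
  qed
qed

lemma square_integrable_times_weight:
  assumes U: "square_integrable U" and f: "f \<in> borel_measurable borel" "\<And>x. norm (f x) \<le> C * weight x"
  shows "integrable lborel (\<lambda>x. U x * f x)"
  by (rule square_integrable_times[OF U square_integrable_weight_bound[OF _ f(2)]]) (use f in simp)

lemma square_integrable_norm_weight:
  assumes U: "square_integrable U"
  shows "integrable lborel (\<lambda>x. norm (U x) * weight x)"
proof -
  have [measurable]: "weight \<in> borel_measurable borel" using integrable_weight by auto
  have "integrable lborel (\<lambda>x. norm (U x * of_real (weight x)))"
    by (rule integrable_norm, rule square_integrable_times_weight[OF U, where C = 1])
      (use weight_pos in \<open>auto simp: less_imp_le\<close>)
  then show ?thesis using weight_pos by (simp add: norm_mult less_imp_le)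
qed

text \<open>The exponent j + l + 4 pays for the monomial and for the weight. Since Re zeta \<ge> 1,
  shifts with Re t \<ge> - 1 / 2 keep the argument in Re \<ge> 1 / 2, so that a neighbourhood of t =
  0 is covered.\<close>

lemma zmon_shift_bound:
  assumes G: "rapid G"
  shows "\<exists>C\<ge>0. \<forall>t x. - 1 / 2 \<le> Re t \<longrightarrow> norm (zmon j l (\<lambda>z. G (z + t)) x) \<le> C * (1 + 2 * norm t) ^ (j + l + 4) * weight x"
proof -
  let ?n = "j + l + 4"
  obtain C where C: "C \<ge> 0" "\<And>z. 1 / 2 \<le> Re z \<Longrightarrow> norm z ^ ?n * norm (G z) \<le> C"
    using rapidD[OF G, of "1 / 2" ?n] by auto
  have "norm (zmon j l (\<lambda>z. G (z + t)) x) \<le> C * (1 + 2 * norm t) ^ ?n * weight x" if t: "- 1 / 2 \<le> Re t" for t x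
  proof (rule le_weight)
    have "norm (zeta x) ^ 4 * norm (zmon j l (\<lambda>z. G (z + t)) x)
      = norm (zeta x) ^ 4 * (norm (zcoord x) ^ j * norm (zcoord x) ^ l * norm (G (zeta x + t)))"
      by (simp add: zmon_def norm_mult norm_power)
    also have "\<dots> \<le> norm (zeta x) ^ 4 * (norm (zeta x) ^ j * norm (zeta x) ^ l * norm (G (zeta x + t)))"
      by (intro mult_left_mono mult_right_mono mult_mono power_mono norm_zcoord_le) auto
    also have "\<dots> = norm (zeta x) ^ ?n * norm (G (zeta x + t))"
      by (simp add: power_add mult_ac)
    also have "\<dots> \<le> ((1 + norm t / (1 / 2)) * norm (zeta x + t)) ^ ?n * norm (G (zeta x + t))"
      using t Re_zeta_ge[of x] by (intro mult_right_mono power_mono norm_le_shift) auto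
    also have "\<dots> = (1 + 2 * norm t) ^ ?n * (norm (zeta x + t) ^ ?n * norm (G (zeta x + t)))"
      by (simp only: power_mult_distrib) (simp add: mult_ac)
    also have "\<dots> \<le> (1 + 2 * norm t) ^ ?n * C"
      using t Re_zeta_ge[of x] by (intro mult_left_mono C) auto
    finally show "norm (zeta x) ^ 4 * norm (zmon j l (\<lambda>z. G (z + t)) x) \<le> C * (1 + 2 * norm t) ^ ?n"
      by (simp add: mult.commute)
  qed simp
  then show ?thesis using C(1) by blast
qed

lemma zmon_shift_measurable:
  assumes G: "rapid G" and t: "- 1 / 2 \<le> Re t"
  shows "zmon j l (\<lambda>z. G (z + t)) \<in> borel_measurable borel"
proof -
  have "continuous_on UNIV (\<lambda>x. zeta x + t)"
    unfolding zeta_def by (intro continuous_intros)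
  then have "continuous_on UNIV (\<lambda>x. G (zeta x + t))"
  proof (rule continuous_on_compose2[OF holomorphic_on_imp_continuous_on[OF rapid_holomorphic[OF G]]])
    show "range (\<lambda>x. zeta x + t) \<subseteq> {z. 0 < Re z}"
    proof clarsimp
      fix a b c show "0 < Re (zeta (a, b, c)) + Re t" using Re_zeta_ge[of "(a, b, c)"] t by linarith
    qed
  qed
  then have "continuous_on UNIV (zmon j l (\<lambda>z. G (z + t)))"
    unfolding zmon_def zcoord_def by (intro continuous_intros)
  then show ?thesis by (rule borel_measurable_continuous_onI)
qed

section \<open>The differential equation in the shift parameter\<close>

lemma Re_csqrt_pos:
  assumes "z \<notin> \<real>\<^sub>\<le>\<^sub>0" shows "Re (csqrt z) > 0"
proof (rule ccontr)
  assume "\<not> Re (csqrt z) > 0"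
  then have "Re (csqrt z) = 0" using Re_csqrt[of z] by linarith
  moreover obtain w where w: "w = csqrt z" by blast
  ultimately have "z = - of_real ((Im w)\<^sup>2)"
    using power2_csqrt[of z] unfolding w[symmetric] by (auto simp: complex_eq_iff power2_eq_square)
  then have "z \<in> \<real>\<^sub>\<le>\<^sub>0" by (metis nonpos_Reals_of_real_iff neg_le_0_iff_le of_real_minus zero_le_power2)
  then show False using assms by simp
qed

lemma poly_exp_decay:
  fixes a c :: real
  assumes a: "a > 0" and c: "c \<ge> 0"
  shows "((\<lambda>s. exp (- a * s) * (1 + c * s) ^ n) \<longlongrightarrow> 0) at_top"
proof (rule Lim_null_comparison)
  have "((\<lambda>s. s ^ n / exp s) \<longlongrightarrow> (0::real)) at_top"
    by (rule tendsto_power_div_exp_0)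
  moreover have "filterlim (\<lambda>s. a * s) at_top at_top"
    by (rule filterlim_tendsto_pos_mult_at_top[OF tendsto_const a filterlim_ident])
  ultimately have "((\<lambda>s. (a * s) ^ n / exp (a * s)) \<longlongrightarrow> 0) at_top"
    by (rule filterlim_compose)
  from tendsto_mult_left[OF this, of "((1 + c) / a) ^ n"]
  show "((\<lambda>s. ((1 + c) / a) ^ n * ((a * s) ^ n / exp (a * s))) \<longlongrightarrow> 0) at_top" by simp
  show "\<forall>\<^sub>F s in at_top. norm (exp (- a * s) * (1 + c * s) ^ n) \<le> ((1 + c) / a) ^ n * ((a * s) ^ n / exp (a * s))"
    using eventually_ge_at_top[of 1]
  proof eventually_elim
    case (elim s)
    have "(1 + c * s) ^ n \<le> ((1 + c) * s) ^ n"
      using elim c by (intro power_mono) (auto simp: distrib_right)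
    also have "\<dots> = ((1 + c) / a) ^ n * (a * s) ^ n"
      using a by (simp flip: power_mult_distrib)
    finally show ?case using elim c by (simp add: exp_minus field_simps)
  qed
qed

text \<open>The relation \<open>ode\<close> is assumed for all rapid functions because it is applied
  to every translate of \<open>G\<close> along the ray in direction \<theta>; these translates are
  again rapid since Re \<theta> > 0.\<close>

lemma pairing_zmon_ode:
  assumes U: "square_integrable U" and G: "rapid G"
    and ode: "\<And>G. rapid G \<Longrightarrow> (\<integral>x. U x * zmon j l (deriv G) x \<partial>lborel) = \<kappa> * (\<integral>x. U x * zmon j l G x \<partial>lborel)"
    and kappa: "\<kappa> \<notin> \<real>\<^sub>\<le>\<^sub>0"
  shows "(\<integral>x. U x * zmon j l G x \<partial>lborel) = 0"
proof -
  \<comment> \<open>Two positivity conditions have to hold at once: Re \<theta> > 0 for admissible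
    shifts, and Re (\<theta> \<kappa>) > 0 for exponential growth. With \<theta> = 1 / w and w the
    principal root, \<theta> \<kappa> is w, and halving the argument of \<kappa> achieves
    both.\<close>
  define w where "w = csqrt \<kappa>"
  have w: "Re w > 0" "w\<^sup>2 = \<kappa>" "w \<noteq> 0" using Re_csqrt_pos[OF kappa] by (auto simp: w_def)
  define \<theta> where "\<theta> = 1 / w"
  have th: "Re \<theta> > 0" using w by (simp add: \<theta>_def Re_divide sum_power2_gt_zero_iff)
  have kth: "\<theta> * \<kappa> = w" using w by (simp add: \<theta>_def power2_eq_square flip: w(2))
  \<comment> \<open>Shifts down to s = - a leave the argument of \<open>G\<close> in Re \<ge> 1 / 2,
    so \<open>H\<close> has a two-sided derivative even at s = 0.\<close>
  define a where "a = 1 / (2 * Re \<theta>)"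
  have a: "a > 0" using th by (simp add: a_def)
  have Re: "- 1 / 2 \<le> Re (of_real s * \<theta>)" if "s \<ge> - a" for s
    using mult_right_mono[OF that, of "Re \<theta>"] th by (simp add: a_def)
  let ?G = "\<lambda>s z. G (z + of_real s * \<theta>)"
  let ?G' = "\<lambda>s z. deriv G (z + of_real s * \<theta>)"
  define H where "H s = (\<integral>x. U x * zmon j l (?G s) x \<partial>lborel)" for s
  obtain C where C: "C \<ge> 0" "\<And>t x. - 1 / 2 \<le> Re t \<Longrightarrow> norm (zmon j l (\<lambda>z. G (z + t)) x) \<le> C * (1 + 2 * norm t) ^ (j + l + 4) * weight x"
    using zmon_shift_bound[OF G] by metis
  obtain C' where C': "C' \<ge> 0" "\<And>t x. - 1 / 2 \<le> Re t \<Longrightarrow> norm (zmon j l (\<lambda>z. deriv G (z + t)) x) \<le> C' * (1 + 2 * norm t) ^ (j + l + 4) * weight x"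
    using zmon_shift_bound[OF rapid_deriv[OF G]] by metis
  have [measurable]: "U \<in> borel_measurable lborel" using U by (simp add: square_integrable_def)
  have int: "integrable lborel (\<lambda>x. U x * zmon j l (?G s) x)" if "s \<ge> - a" for s
    by (rule square_integrable_times_weight[OF U zmon_shift_measurable[OF G Re[OF that]] C(2)[OF Re[OF that]]])
  have int': "integrable lborel (\<lambda>x. U x * zmon j l (?G' s) x)" if "s \<ge> - a" for s
    by (rule square_integrable_times_weight[OF U zmon_shift_measurable[OF rapid_deriv[OF G] Re[OF that]] C'(2)[OF Re[OF that]]])
  have der: "(H has_vector_derivative w * H s) (at s)" if s: "s \<ge> 0" for s
  proof -
    let ?K = "norm \<theta> * (C' * (1 + 2 * ((s + a) * norm \<theta>)) ^ (j + l + 4))"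
    have "((\<lambda>s. \<integral>x. U x * zmon j l (?G s) x \<partial>lborel) has_vector_derivative (\<integral>x. U x * (\<theta> * zmon j l (?G' s) x) \<partial>lborel)) (at s)"
    proof (rule has_vector_derivative_lebesgue_integral[where a = "s - a" and b = "s + a" and w = "\<lambda>x. ?K * (norm (U x) * weight x)"])
      show "integrable lborel (\<lambda>x. ?K * (norm (U x) * weight x))"
        by (intro integrable_mult_right square_integrable_norm_weight U)
      show "(\<lambda>x. U x * (\<theta> * zmon j l (?G' s) x)) \<in> borel_measurable lborel"
        using int'[of s] s a by (simp add: mult.left_commute)
    next
      fix t x assume "t \<in> {s - a<..<s + a}"
      then have t: "t \<ge> - a" "\<bar>t\<bar> \<le> s + a" using s by auto
      have "Re (zeta x + of_real t * \<theta>) > 0" using Re[OF t(1)] Re_zeta_ge[of x] by simp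
      then have "(G has_field_derivative deriv G (zeta x + of_real t * \<theta>)) (at (zeta x + of_real t * \<theta>))"
        by (rule rapid_has_field_derivative[OF G])
      then have "((\<lambda>c. G (zeta x + c * \<theta>)) has_field_derivative deriv G (zeta x + of_real t * \<theta>) * \<theta>) (at (of_real t))"
        by (rule DERIV_chain2) (auto intro!: derivative_eq_intros)
      then have "((\<lambda>c. U x * (zcoord x ^ j * cnj (zcoord x) ^ l * G (zeta x + c * \<theta>))) has_field_derivative
          U x * (zcoord x ^ j * cnj (zcoord x) ^ l * (deriv G (zeta x + of_real t * \<theta>) * \<theta>))) (at (of_real t))"
        by (intro DERIV_cmult)
      from has_vector_derivative_real_field[OF this]
      show "((\<lambda>t. U x * zmon j l (?G t) x) has_vector_derivative U x * (\<theta> * zmon j l (?G' t) x)) (at t)"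
        by (simp add: zmon_def mult_ac)
      have "norm (zmon j l (?G' t) x) \<le> C' * (1 + 2 * norm (of_real t * \<theta>)) ^ (j + l + 4) * weight x"
        by (rule C'(2)[OF Re[OF t(1)]])
      also have "\<dots> \<le> C' * (1 + 2 * ((s + a) * norm \<theta>)) ^ (j + l + 4) * weight x"
        using t C'(1) weight_pos[of x] by (intro mult_right_mono mult_left_mono power_mono) (auto simp: norm_mult intro!: mult_right_mono)
      finally have "norm \<theta> * norm (U x) * norm (zmon j l (?G' t) x) \<le> norm \<theta> * norm (U x) * (C' * (1 + 2 * ((s + a) * norm \<theta>)) ^ (j + l + 4) * weight x)"
        by (intro mult_left_mono) auto
      then show "norm (U x * (\<theta> * zmon j l (?G' t) x)) \<le> ?K * (norm (U x) * weight x)"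
        by (simp add: norm_mult mult_ac)
    qed (use a s int in auto)
    also have "(\<integral>x. U x * (\<theta> * zmon j l (?G' s) x) \<partial>lborel) = \<theta> * (\<integral>x. U x * zmon j l (?G' s) x \<partial>lborel)"
      by (simp add: mult.left_commute)
    also have "(\<integral>x. U x * zmon j l (?G' s) x \<partial>lborel) = (\<integral>x. U x * zmon j l (deriv (?G s)) x \<partial>lborel)"
    proof (rule Bochner_Integration.integral_cong[OF refl])
      fix x
      have "Re (zeta x + of_real s * \<theta>) > 0" using Re[of s] a s Re_zeta_ge[of x] by simp
      then have "(?G s has_field_derivative deriv G (zeta x + of_real s * \<theta>)) (at (zeta x))"
        by (rule DERIV_shift[THEN iffD1, OF rapid_has_field_derivative[OF G]])
      then show "U x * zmon j l (?G' s) x = U x * zmon j l (deriv (?G s)) x"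
        by (simp add: zmon_def DERIV_imp_deriv)
    qed
    \<comment> \<open>This is \<open>ode\<close> for the translated function, whose derivative is
      the translate of \<open>deriv G\<close>.\<close>
    also have "\<dots> = \<kappa> * H s"
      unfolding H_def by (rule ode, rule rapid_shift[OF G]) (use s th in simp)
    finally show ?thesis by (simp add: H_def[abs_def] kth flip: mult.assoc)
  qed
  have d0: "((\<lambda>s. exp (- w * of_real s) * H s) has_vector_derivative 0) (at s within {0..})" if s: "s \<in> {0..}" for s
  proof -
    have "((\<lambda>c. exp (- w * c)) has_field_derivative - w * exp (- w * of_real s)) (at (of_real s))"
      by (auto intro!: derivative_eq_intros)
    from has_vector_derivative_mult[OF has_vector_derivative_real_field[OF this] der[of s]]
    have "((\<lambda>s. exp (- w * of_real s) * H s) has_vector_derivative 0) (at s)"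
      using s by (simp add: algebra_simps)
    then show ?thesis by (rule has_vector_derivative_at_within)
  qed
  obtain k where k: "\<And>s. s \<in> {0..} \<Longrightarrow> exp (- w * of_real s) * H s = k"
    using has_vector_derivative_zero_constant[OF convex_real_interval(1) d0] by blast
  define K where "K = C * (\<integral>x. norm (U x) * weight x \<partial>lborel)"
  have Hb: "norm (H s) \<le> K * (1 + 2 * norm \<theta> * s) ^ (j + l + 4)" if s: "s \<ge> 0" for s
  proof -
    have sa: "s \<ge> - a" using s a by simp
    have "norm (H s) \<le> (\<integral>x. norm (U x * zmon j l (?G s) x) \<partial>lborel)"
      unfolding H_def by (rule integral_norm_bound)
    also have "\<dots> \<le> (\<integral>x. (C * (1 + 2 * norm \<theta> * s) ^ (j + l + 4)) * (norm (U x) * weight x) \<partial>lborel)"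
    proof (rule integral_mono)
      show "integrable lborel (\<lambda>x. norm (U x * zmon j l (?G s) x))" using int[OF sa] by simp
      show "integrable lborel (\<lambda>x. (C * (1 + 2 * norm \<theta> * s) ^ (j + l + 4)) * (norm (U x) * weight x))"
        by (intro integrable_mult_right square_integrable_norm_weight U)
      fix x
      have "norm (U x) * norm (zmon j l (?G s) x) \<le> norm (U x) * (C * (1 + 2 * norm (of_real s * \<theta>)) ^ (j + l + 4) * weight x)"
        by (intro mult_left_mono C(2)[OF Re[OF sa]]) auto
      then show "norm (U x * zmon j l (?G s) x) \<le> (C * (1 + 2 * norm \<theta> * s) ^ (j + l + 4)) * (norm (U x) * weight x)"
        using s by (simp add: norm_mult mult_ac)
    qed
    also have "\<dots> = (C * (1 + 2 * norm \<theta> * s) ^ (j + l + 4)) * (\<integral>x. norm (U x) * weight x \<partial>lborel)"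
      by (rule integral_mult_right_zero)
    finally show ?thesis by (simp only: K_def mult_ac)
  qed
  \<comment> \<open>\<open>k\<close> is the constant value of exp (- w s) H s; the polynomial bound
    on \<open>H\<close> lets it be estimated by quantities that tend to 0 at infinity.\<close>
  have "norm k \<le> 0"
  proof (rule tendsto_lowerbound)
    show "((\<lambda>s. K * (exp (- Re w * s) * (1 + 2 * norm \<theta> * s) ^ (j + l + 4))) \<longlongrightarrow> 0) at_top"
      by (rule tendsto_mult_right_zero, rule poly_exp_decay) (use w in auto)
    show "\<forall>\<^sub>F s in at_top. norm k \<le> K * (exp (- Re w * s) * (1 + 2 * norm \<theta> * s) ^ (j + l + 4))"
      using eventually_ge_at_top[of 0]
    proof eventually_elim
      case (elim s)
      have "norm k = exp (- Re w * s) * norm (H s)"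
        using k[of s] elim by (auto simp: norm_mult)
      also have "\<dots> \<le> exp (- Re w * s) * (K * (1 + 2 * norm \<theta> * s) ^ (j + l + 4))"
        by (intro mult_left_mono Hb elim) auto
      finally show ?case by (simp add: mult_ac)
    qed
  qed simp
  then show ?thesis using k[of 0] by (simp add: H_def)
qed

text \<open>The lower-order term of the sub-Laplacian carries the factor j, so it is absent at j = 0
  and is disposed of by induction afterwards, with \<open>l\<close> and \<open>G\<close> arbitrary.
  The constant - z / (4 (2 j + 1)) avoids the nonpositive reals exactly because z avoids the
  nonnegative ones.\<close>

lemma pairing_zmon_zero:
  assumes U: "square_integrable U" and z: "z \<notin> complex_of_real ` {0..}"
    and orth: "\<And>j l G. rapid G \<Longrightarrow> (\<integral>x. U x * (sublaplacian (zmon j l G) x - z * zmon j l G x) \<partial>lborel) = 0"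
    and G: "rapid G"
  shows "(\<integral>x. U x * zmon j l G x \<partial>lborel) = 0"
  using G
proof (induction j arbitrary: l G)
  have int: "integrable lborel (\<lambda>x. U x * zmon j l G x)" if "rapid G" for j l G
    using that by (intro square_integrable_times U zmon_comb_square_integrable zmon_comb_zmon)
  \<comment> \<open>The factor j in \<open>prev\<close> makes that premise trivial for j = 0, where
    j - 1 is truncated.\<close>
  have rel: "(\<integral>x. U x * zmon j l (deriv G) x \<partial>lborel) = (- z / of_nat (4 * (2 * j + 1))) * (\<integral>x. U x * zmon j l G x \<partial>lborel)"
    if G: "rapid G" and prev: "of_nat j * (\<integral>x. U x * zmon (j - 1) (l - 1) G x \<partial>lborel) = 0" for j l G
  proof -
    let ?N = "of_nat (4 * (2 * j + 1)) :: complex"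
    have "0 = (\<integral>x. - ?N * (U x * zmon j l (deriv G) x) - (4 * of_nat (j * l)) * (U x * zmon (j - 1) (l - 1) G x) - z * (U x * zmon j l G x) \<partial>lborel)"
      unfolding orth[OF G, of j l, symmetric] sublaplacian_zmon[OF G]
      by (rule Bochner_Integration.integral_cong[OF refl]) (simp add: algebra_simps)
    also have "\<dots> = - ?N * (\<integral>x. U x * zmon j l (deriv G) x \<partial>lborel) - (4 * of_nat (j * l)) * (\<integral>x. U x * zmon (j - 1) (l - 1) G x \<partial>lborel)
        - z * (\<integral>x. U x * zmon j l G x \<partial>lborel)"
      by (subst Bochner_Integration.integral_diff, intro Bochner_Integration.integrable_diff integrable_mult_right int G rapid_deriv,
          intro integrable_mult_right int G, subst Bochner_Integration.integral_diff,
          intro integrable_mult_right int G rapid_deriv, intro integrable_mult_right int G)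
        (simp only: integral_mult_right_zero)
    also have "(4 * of_nat (j * l)) * (\<integral>x. U x * zmon (j - 1) (l - 1) G x \<partial>lborel) = 4 * of_nat l * (of_nat j * (\<integral>x. U x * zmon (j - 1) (l - 1) G x \<partial>lborel))"
      by simp
    also have "\<dots> = 0" using prev by simp
    finally have "?N * (\<integral>x. U x * zmon j l (deriv G) x \<partial>lborel) = - z * (\<integral>x. U x * zmon j l G x \<partial>lborel)"
      by algebra
    moreover have "?N \<noteq> 0" unfolding of_nat_eq_0_iff by simp
    moreover have "A = (- z / N) * B" if "N * A = - z * B" "N \<noteq> 0" for N A B :: complex
      using that by (simp add: field_simps)
    ultimately show ?thesis by blast
  qed
  have kap: "- z / of_nat (4 * (2 * j + 1)) \<notin> \<real>\<^sub>\<le>\<^sub>0" for j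
  proof
    assume "- z / of_nat (4 * (2 * j + 1)) \<in> \<real>\<^sub>\<le>\<^sub>0"
    then obtain r where r: "- z / of_nat (4 * (2 * j + 1)) = of_real r" "r \<le> 0"
      by (auto simp: nonpos_Reals_def)
    have N0: "(of_nat (4 * (2 * j + 1)) :: complex) \<noteq> 0" unfolding of_nat_eq_0_iff by simp
    have "z = of_real (- r * of_nat (4 * (2 * j + 1)))"
      using r(1) N0 by (simp only: divide_eq_eq if_False of_real_mult of_real_minus of_real_of_nat_eq)
        (simp add: minus_equation_iff[of z])
    moreover have "- r * of_nat (4 * (2 * j + 1)) \<ge> 0" using r(2) by (intro mult_nonneg_nonneg) auto
    ultimately show False using z by blast
  qed
  {
    case 0
    show ?case
      by (rule pairing_zmon_ode[OF U 0 _ kap[of 0]]) (rule rel, simp_all)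
  next
    case (Suc j)
    show ?case
      by (rule pairing_zmon_ode[OF U Suc.prems _ kap[of "Suc j"]]) (rule rel, simp_all add: Suc.IH)
  }
qed

section \<open>Totality of the test functions\<close>

text \<open>The factor 1 / z keeps the limit e \<rightarrow> 0 integrable along tau against a
  square-integrable function; the exponential makes the function rapid.\<close>

definition damp :: "real \<Rightarrow> complex \<Rightarrow> complex" where
  "damp e z = 1 / z * exp (- of_real e * csqrt z)"

text \<open>Evaluated at \<open>zeta\<close>, the exponential with parameter m is a Gaussian in (y1,
  y2) times the character exp (i m tau): the Gaussian supplies exponential moments, the character a
  frequency.\<close>

definition wave :: "real \<Rightarrow> real \<Rightarrow> complex \<Rightarrow> complex" where
  "wave m e z = exp (- of_real m * z) * damp e z"

lemma rapid_damp:
  assumes "e > 0" shows "rapid (damp e)"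
  unfolding damp_def
proof (rule rapid_mult_bounded[OF rapid_exp_csqrt[OF assms]])
  show "(\<lambda>z. 1 / z) holomorphic_on {z. 0 < Re z}"
    by (intro holomorphic_intros) auto
  fix d :: real assume d: "d > 0"
  have "norm (1 / z) \<le> 1 / d" if "d \<le> Re z" for z :: complex
    using that d complex_Re_le_cmod[of z] by (auto simp: norm_divide intro!: divide_left_mono mult_pos_pos)
  then show "\<exists>B. \<forall>z. d \<le> Re z \<longrightarrow> norm (1 / z :: complex) \<le> B" by blast
qed

lemma rapid_wave:
  assumes "m \<ge> 0" "e > 0" shows "rapid (wave m e)"
  unfolding wave_def
proof (rule rapid_mult_bounded[OF rapid_damp[OF assms(2)]])
  show "(\<lambda>z. exp (- of_real m * z)) holomorphic_on {z. 0 < Re z}"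
    by (intro holomorphic_intros)
  fix d :: real assume "d > 0"
  then have "norm (exp (- of_real m * z)) \<le> 1" if "d \<le> Re z" for z
    using that assms by simp
  then show "\<exists>B. \<forall>z. d \<le> Re z \<longrightarrow> norm (exp (- of_real m * z)) \<le> B" by blast
qed

text \<open>y1 = (z + cnj z) / 2 and y2 = - i (z - cnj z) / 2, so each real coordinate factor raises
  \<open>j\<close> or \<open>l\<close> by one. Membership in \<open>zmon_comb\<close> is carried
  through the inductions to keep everything integrable.\<close>

lemma pairing_coordinates_zero:
  assumes U: "square_integrable U" and G: "rapid G"
    and zero: "\<And>j l. (\<integral>x. U x * zmon j l G x \<partial>lborel) = 0"
  shows "(\<integral>x. U x * (of_real (fst x) ^ a * (of_real (fst (snd x)) ^ b * G (zeta x))) \<partial>lborel) = 0"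
proof -
  let ?P = "\<lambda>a b j l x. of_real (fst x) ^ a * (of_real (fst (snd x)) ^ b * zmon j l G x)"
  have base: "zmon_comb (?P 0 b j l) \<and> (\<integral>x. U x * ?P 0 b j l x \<partial>lborel) = 0" for b j l
  proof (induction b arbitrary: j l)
    case 0
    show ?case using zero zmon_comb_zmon[OF G] by simp
  next
    case (Suc b)
    have eqx: "?P 0 (Suc b) j l x = (- \<i> / 2) * ?P 0 b (Suc j) l x + (\<i> / 2) * ?P 0 b j (Suc l) x" for x
      by (simp add: zmon_def zcoord_def algebra_simps)
    have eq: "?P 0 (Suc b) j l = (\<lambda>x. (- \<i> / 2) * ?P 0 b (Suc j) l x + (\<i> / 2) * ?P 0 b j (Suc l) x)"
      by (rule ext) (rule eqx)
    have int: "integrable lborel (\<lambda>x. U x * ?P 0 b j l x)" for j l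
      using Suc[of j l] by (intro square_integrable_times[OF U] zmon_comb_square_integrable) simp
    have "(\<integral>x. U x * ?P 0 (Suc b) j l x \<partial>lborel) = (\<integral>x. (- \<i> / 2) * (U x * ?P 0 b (Suc j) l x) + (\<i> / 2) * (U x * ?P 0 b j (Suc l) x) \<partial>lborel)"
      by (rule Bochner_Integration.integral_cong[OF refl]) (simp only: eqx, simp only: algebra_simps)
    also have "\<dots> = 0"
      by (subst Bochner_Integration.integral_add[OF integrable_mult_right[OF int] integrable_mult_right[OF int]])
        (simp only: integral_mult_right_zero Suc, simp)
    finally have "(\<integral>x. U x * ?P 0 (Suc b) j l x \<partial>lborel) = 0" .
    moreover have "zmon_comb (?P 0 (Suc b) j l)"
      unfolding eq by (rule zmon_comb_add; rule zmon_comb_cmult; rule Suc[THEN conjunct1])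
    ultimately show ?case by (rule conjI[rotated])
  qed
  have "zmon_comb (?P a b j l) \<and> (\<integral>x. U x * ?P a b j l x \<partial>lborel) = 0" for j l
  proof (induction a arbitrary: j l)
    case 0
    show ?case by (rule base)
  next
    case (Suc a)
    have eqx: "?P (Suc a) b j l x = (1 / 2) * ?P a b (Suc j) l x + (1 / 2) * ?P a b j (Suc l) x" for x
      by (simp add: zmon_def zcoord_def algebra_simps)
    have eq: "?P (Suc a) b j l = (\<lambda>x. (1 / 2) * ?P a b (Suc j) l x + (1 / 2) * ?P a b j (Suc l) x)"
      by (rule ext) (rule eqx)
    have int: "integrable lborel (\<lambda>x. U x * ?P a b j l x)" for j l
      using Suc[of j l] by (intro square_integrable_times[OF U] zmon_comb_square_integrable) simp
    have "(\<integral>x. U x * ?P (Suc a) b j l x \<partial>lborel) = (\<integral>x. (1 / 2) * (U x * ?P a b (Suc j) l x) + (1 / 2) * (U x * ?P a b j (Suc l) x) \<partial>lborel)"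
      by (rule Bochner_Integration.integral_cong[OF refl]) (simp only: eqx, simp only: algebra_simps)
    also have "\<dots> = 0"
      by (subst Bochner_Integration.integral_add[OF integrable_mult_right[OF int] integrable_mult_right[OF int]])
        (simp only: integral_mult_right_zero Suc, simp)
    finally have "(\<integral>x. U x * ?P (Suc a) b j l x \<partial>lborel) = 0" .
    moreover have "zmon_comb (?P (Suc a) b j l)"
      unfolding eq by (rule zmon_comb_add; rule zmon_comb_cmult; rule Suc[THEN conjunct1])
    ultimately show ?case by (rule conjI[rotated])
  qed
  from this[of 0 0] show ?thesis by (simp add: zmon_def)
qed

lemma exp_linear_le_gaussian:
  fixes c m t :: real
  assumes "m > 0" shows "exp (c * \<bar>t\<bar>) \<le> exp (c\<^sup>2 / (4 * m)) * exp (m * t\<^sup>2)"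
proof -
  have "0 \<le> (2 * m * \<bar>t\<bar> - c)\<^sup>2 / (4 * m)" using assms by simp
  also have "\<dots> = m * t\<^sup>2 - c * \<bar>t\<bar> + c\<^sup>2 / (4 * m)"
    using assms by (simp add: power2_eq_square field_simps flip: abs_mult)
  finally show ?thesis by (simp flip: exp_add)
qed

lemma pow_le_exp: "\<bar>t\<bar> ^ b \<le> fact b * exp \<bar>t :: real\<bar>"
proof -
  have "sum (\<lambda>n. \<bar>t\<bar> ^ n /\<^sub>R fact n) {b} \<le> exp \<bar>t\<bar>"
    unfolding exp_def by (intro sum_le_suminf summable_exp_generic) auto
  then show ?thesis by (simp add: field_simps)
qed

text \<open>Moment determinacy is used twice, in y1 and then in y2 on almost every slice. The
  condition m > 0 provides the Gaussian and thereby the exponential moments.\<close>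

lemma pairing_slices_zero:
  assumes U: "square_integrable U" and m: "m > 0" and e: "e > 0"
    and zero: "\<And>j l. (\<integral>x. U x * zmon j l (wave m e) x \<partial>lborel) = 0"
  shows "AE y1 in lborel. AE y2 in lborel. (\<integral>t. U (y1, y2, t) * wave m e (zeta (y1, y2, t)) \<partial>lborel) = 0"
proof -
  define F where "F x = U x * wave m e (zeta x)" for x
  have [measurable]: "U \<in> borel_measurable borel" using U by (simp add: square_integrable_def)
  have rw: "rapid (wave m e)" by (rule rapid_wave) (use m e in auto)
  have "(\<lambda>x. wave m e (zeta x)) \<in> borel_measurable borel"
    using zmon_comb_measurable[OF zmon_comb_zmon[OF rw, of 0 0]] by (simp add: zmon_def[abs_def])
  then have F_m[measurable]: "F \<in> borel_measurable borel" unfolding F_def by measurable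
  have [measurable]: "(\<lambda>x::heis. exp (c * \<bar>fst x\<bar>)) \<in> borel_measurable borel"
      "(\<lambda>x::heis. exp (c * \<bar>fst (snd x)\<bar>)) \<in> borel_measurable borel"
      "(\<lambda>x::heis. complex_of_real (fst (snd x)) ^ b) \<in> borel_measurable borel"
      "(\<lambda>x::real \<times> real. exp (c * \<bar>fst x\<bar>)) \<in> borel_measurable borel" for c b
    by (intro borel_measurable_continuous_onI continuous_intros)+
    obtain C where C: "\<And>x. norm (damp e (zeta x)) \<le> C * weight x"
    using zmon_comb_le_weight[OF zmon_comb_zmon[OF rapid_damp[OF e], of 0 0]] by (auto simp: zmon_def)
  have bound: "exp (c * \<bar>fst x\<bar>) * (exp (c * \<bar>fst (snd x)\<bar>) * norm (F x)) \<le> (exp (c\<^sup>2 / (4 * m)))\<^sup>2 * C * (norm (U x) * weight x)" for c x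
  proof -
    let ?a = "fst x" and ?b = "fst (snd x)" and ?E = "exp (c\<^sup>2 / (4 * m))"
    have "norm (F x) = norm (U x) * (exp (- m * (1 + ?a\<^sup>2 + ?b\<^sup>2)) * norm (damp e (zeta x)))"
      by (simp add: F_def wave_def norm_mult Re_zeta)
    also have "\<dots> \<le> norm (U x) * (exp (- m * (?a\<^sup>2 + ?b\<^sup>2)) * (C * weight x))"
      using m by (intro mult_left_mono mult_mono C) auto
    finally have 1: "norm (F x) \<le> norm (U x) * (exp (- m * (?a\<^sup>2 + ?b\<^sup>2)) * (C * weight x))" .
    have "exp (c * \<bar>?a\<bar>) * exp (c * \<bar>?b\<bar>) \<le> (?E * exp (m * ?a\<^sup>2)) * (?E * exp (m * ?b\<^sup>2))"
      by (intro mult_mono exp_linear_le_gaussian m) auto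
    then have "exp (c * \<bar>?a\<bar>) * exp (c * \<bar>?b\<bar>) * norm (F x) \<le> (?E * exp (m * ?a\<^sup>2)) * (?E * exp (m * ?b\<^sup>2)) * (norm (U x) * (exp (- m * (?a\<^sup>2 + ?b\<^sup>2)) * (C * weight x)))"
      using 1 by (rule mult_mono) auto
    also have "\<dots> = ?E\<^sup>2 * C * (norm (U x) * weight x) * (exp (m * ?a\<^sup>2) * exp (m * ?b\<^sup>2) * exp (- m * (?a\<^sup>2 + ?b\<^sup>2)))"
      by (simp add: power2_eq_square mult_ac)
    also have "exp (m * ?a\<^sup>2) * exp (m * ?b\<^sup>2) * exp (- m * (?a\<^sup>2 + ?b\<^sup>2)) = 1"
      by (simp add: algebra_simps flip: exp_add)
    finally show ?thesis by (simp add: mult.assoc)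
  qed
  have Fint: "integrable lborel (\<lambda>x. exp (c * \<bar>fst x\<bar>) * (exp (c * \<bar>fst (snd x)\<bar>) * norm (F x)))" for c
  proof (rule Bochner_Integration.integrable_bound[OF integrable_mult_right[OF square_integrable_norm_weight[OF U], of "(exp (c\<^sup>2 / (4 * m)))\<^sup>2 * C"]])
    show "AE x in lborel. norm (exp (c * \<bar>fst x\<bar>) * (exp (c * \<bar>fst (snd x)\<bar>) * norm (F x))) \<le> norm ((exp (c\<^sup>2 / (4 * m)))\<^sup>2 * C * (norm (U x) * weight x))"
      using bound[of c] by (auto intro!: AE_I2 order_trans[OF _ abs_ge_self])
  qed measurable
  \<comment> \<open>Moments in y1 are taken with y2^b kept in the integrand. Over all b, and outside
    a countable union of null sets, this yields all moments in y2 on almost every slice.\<close>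
  have "AE y1 in lborel. (\<integral>p. of_real (fst p) ^ b * F (y1, p) \<partial>lborel) = 0" for b
  proof (rule moments_zero[of lborel "\<lambda>x. of_real (fst (snd x)) ^ b * F x", unfolded lborel_prod, simplified snd_conv fst_conv])
    show "sigma_finite_measure (lborel :: (real \<times> real) measure)" by (rule lborel.sigma_finite_measure_axioms)
    show "(\<lambda>x. of_real (fst (snd x)) ^ b * F x) \<in> borel_measurable lborel" by measurable
    show "(\<integral>p. of_real (fst p) ^ n * (of_real (fst (snd p)) ^ b * F p) \<partial>lborel) = 0" for n
      using pairing_coordinates_zero[OF U rw zero, of n b] by (simp add: F_def mult_ac)
    fix c :: real
    \<comment> \<open>At least c for the exponential in y1, and at least 1 because y2^b is absorbed
      by exp |y2|.\<close>
    define d where "d = max c 1"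
    show "integrable lborel (\<lambda>p. exp (c * \<bar>fst p\<bar>) * norm (of_real (fst (snd p)) ^ b * F p))"
    proof (rule Bochner_Integration.integrable_bound[OF integrable_mult_right[OF Fint[of d], of "fact b"]])
      show "AE p in lborel. norm (exp (c * \<bar>fst p\<bar>) * norm (of_real (fst (snd p)) ^ b * F p)) \<le> norm (fact b * (exp (d * \<bar>fst p\<bar>) * (exp (d * \<bar>fst (snd p)\<bar>) * norm (F p))))"
      proof (rule AE_I2)
        fix p
        have "exp (c * \<bar>fst p\<bar>) * (\<bar>fst (snd p)\<bar> ^ b * norm (F p)) \<le> exp (d * \<bar>fst p\<bar>) * ((fact b * exp (d * \<bar>fst (snd p)\<bar>)) * norm (F p))"
          using mult_right_mono[of 1 d "\<bar>fst (snd p)\<bar>"]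
          by (intro mult_mono order_trans[OF pow_le_exp]) (auto simp: d_def intro!: mult_right_mono)
        then show "norm (exp (c * \<bar>fst p\<bar>) * norm (of_real (fst (snd p)) ^ b * F p)) \<le> norm (fact b * (exp (d * \<bar>fst p\<bar>) * (exp (d * \<bar>fst (snd p)\<bar>) * norm (F p))))"
          by (simp add: norm_mult norm_power mult_ac)
      qed
    qed measurable
  qed
  then have A: "AE y1 in lborel. \<forall>b. (\<integral>p. of_real (fst p) ^ b * F (y1, p) \<partial>lborel) = 0"
    by (simp add: AE_all_countable)
  \<comment> \<open>Integer rates dominate every real rate and keep the exceptional null sets
    countable in number.\<close>
  have "AE y1 in lborel. integrable lborel (\<lambda>p. exp (real n * \<bar>y1\<bar>) * (exp (real n * \<bar>fst p\<bar>) * norm (F (y1, p))))" for n :: nat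
    using lborel_pair.AE_integrable_fst'[of "\<lambda>x. exp (real n * \<bar>fst x\<bar>) * (exp (real n * \<bar>fst (snd x)\<bar>) * norm (F x))", unfolded lborel_prod, OF Fint] by simp
  then have B: "AE y1 in lborel. \<forall>n::nat. integrable lborel (\<lambda>p. exp (real n * \<bar>y1\<bar>) * (exp (real n * \<bar>fst p\<bar>) * norm (F (y1, p))))"
    by (simp add: AE_all_countable)
  from A B have "AE y1 in lborel. AE y2 in lborel. (\<integral>t. F (y1, y2, t) \<partial>lborel) = 0"
  proof eventually_elim
    case (elim y1)
    have [measurable]: "(\<lambda>p. F (y1, p)) \<in> borel_measurable borel" by measurable
    show ?case
    proof (rule moments_zero[of lborel "\<lambda>p. F (y1, p)", unfolded lborel_prod])
      show "sigma_finite_measure (lborel :: real measure)" by (rule lborel.sigma_finite_measure_axioms)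
      fix c :: real
      obtain n :: nat where n: "c \<le> real n" using real_arch_simple by blast
      have i: "integrable lborel (\<lambda>p. exp (real n * \<bar>fst p\<bar>) * norm (F (y1, p)))"
        using elim(2)[rule_format, of n] by simp
      show "integrable lborel (\<lambda>p. exp (c * \<bar>fst p\<bar>) * norm (F (y1, p)))"
        by (rule Bochner_Integration.integrable_bound[OF i])
          (use n in \<open>auto intro!: AE_I2 mult_right_mono simp: abs_mult\<close>)
    qed (use elim(1) in auto)
  qed
  then show ?thesis by (simp add: F_def)
qed

text \<open>Slice identities hold almost everywhere for each parameter, so only countably many are
  used at once: rational frequencies and dampings 1 / Suc n. Dominated convergence first removes the
  damping and then reaches every real m \<ge> 0, including m = 0, for which there is no
  Gaussian.\<close>

lemma half_line_transform_limit:
  fixes V :: "real \<Rightarrow> complex"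
  assumes V[measurable]: "V \<in> borel_measurable lborel"
    and V2: "integrable lborel (\<lambda>x. (cmod (V x))\<^sup>2)"
    and r: "r > 0"
    and zero: "\<And>q n. q \<in> \<rat> \<Longrightarrow> q > 0 \<Longrightarrow> (\<integral>t. V t * wave q (1 / Suc n) (of_real r - \<i> * of_real t) \<partial>lborel) = 0"
    and m: "m \<ge> 0"
  shows "(\<integral>t. V t * iexp (m * t) / (of_real r - \<i> * of_real t) \<partial>lborel) = 0"
proof -
  let ?z = "\<lambda>t::real. complex_of_real r - \<i> * of_real t"
  have nz: "norm (?z t) > 0" for t using r by (auto simp: complex_eq_iff)
  have n2: "(norm (?z t))\<^sup>2 = r\<^sup>2 + t\<^sup>2" for t by (simp add: cmod_power2)
  have w: "integrable lborel (\<lambda>t. (cmod (V t))\<^sup>2 + 1 / (r\<^sup>2 + t\<^sup>2))"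
    by (intro Bochner_Integration.integrable_add V2 integrable_inverse_square_plus_square r)
  have bound: "norm (V t) / norm (?z t) \<le> (cmod (V t))\<^sup>2 + 1 / (r\<^sup>2 + t\<^sup>2)" for t
  proof -
    have "2 * (norm (V t) * (1 / norm (?z t))) \<le> (norm (V t))\<^sup>2 + (1 / norm (?z t))\<^sup>2"
      using sum_squares_bound[of "norm (V t)" "1 / norm (?z t)"] by (simp only: mult.assoc)
    moreover have "(1 / norm (?z t))\<^sup>2 = 1 / (r\<^sup>2 + t\<^sup>2)" by (simp add: power_divide n2)
    moreover have "0 \<le> norm (V t) * (1 / norm (?z t))" by simp
    ultimately have "norm (V t) * (1 / norm (?z t)) \<le> (cmod (V t))\<^sup>2 + 1 / (r\<^sup>2 + t\<^sup>2)" by linarith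
    then show ?thesis by simp
  qed
  have zm[measurable]: "?z \<in> borel_measurable borel"
    by (intro borel_measurable_continuous_onI continuous_intros)
  have bm: "(\<lambda>t. V t * iexp (c * t) / ?z t) \<in> borel_measurable lborel" for c
    by measurable
  have q0: "(\<integral>t. V t * iexp (q * t) / ?z t \<partial>lborel) = 0" if q: "q \<in> \<rat>" "q > 0" for q
  proof -
    \<comment> \<open>The real part of the argument is r throughout, so the exponential contributes
      the constant factor exp (- q r), which is divided out at the end.\<close>
    have "(\<lambda>n. \<integral>t. V t * wave q (1 / Suc n) (?z t) \<partial>lborel) \<longlonglongrightarrow> (\<integral>t. of_real (exp (- q * r)) * (V t * iexp (q * t) / ?z t) \<partial>lborel)"
    proof (rule integral_dominated_convergence[OF _ _ w])
      show "(\<lambda>t. of_real (exp (- q * r)) * (V t * iexp (q * t) / ?z t)) \<in> borel_measurable lborel"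
        using bm by measurable
      show "(\<lambda>t. V t * wave q (1 / Suc n) (?z t)) \<in> borel_measurable lborel" for n
      proof -
        have "continuous_on UNIV (\<lambda>t. wave q (1 / Suc n) (?z t))"
          by (rule continuous_on_compose2[OF holomorphic_on_imp_continuous_on[OF rapid_holomorphic[OF rapid_wave]]])
            (use q r in \<open>auto intro!: continuous_intros\<close>)
        then have "(\<lambda>t. wave q (1 / Suc n) (?z t)) \<in> borel_measurable borel"
          by (rule borel_measurable_continuous_onI)
        then show ?thesis by measurable
      qed
      have eq: "V t * wave q e (?z t) = of_real (exp (- q * r)) * (V t * iexp (q * t) / ?z t) * exp (- of_real e * csqrt (?z t))" for t e
      proof -
        have "exp (- of_real q * ?z t) = of_real (exp (- q * r)) * iexp (q * t)"
          by (simp add: algebra_simps flip: exp_of_real exp_add)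
        then show ?thesis by (simp add: wave_def damp_def)
      qed
      show "AE t in lborel. (\<lambda>n. V t * wave q (1 / Suc n) (?z t)) \<longlonglongrightarrow> of_real (exp (- q * r)) * (V t * iexp (q * t) / ?z t)"
      proof (rule AE_I2)
        fix t
        have "(\<lambda>n. exp (- of_real (inverse (Suc n)) * csqrt (?z t))) \<longlonglongrightarrow> exp (- of_real 0 * csqrt (?z t))"
          by (intro tendsto_intros LIMSEQ_inverse_real_of_nat)
        from tendsto_mult_left[OF this, of "of_real (exp (- q * r)) * (V t * iexp (q * t) / ?z t)"]
        show "(\<lambda>n. V t * wave q (1 / Suc n) (?z t)) \<longlonglongrightarrow> of_real (exp (- q * r)) * (V t * iexp (q * t) / ?z t)"
          unfolding eq by (simp only: inverse_eq_divide of_real_0 minus_zero mult_zero_left exp_zero mult_1_right)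
      qed
      show "AE t in lborel. norm (V t * wave q (1 / Suc n) (?z t)) \<le> (cmod (V t))\<^sup>2 + 1 / (r\<^sup>2 + t\<^sup>2)" for n
      proof (rule AE_I2)
        fix t
        have "norm (V t * wave q (1 / Suc n) (?z t)) = (norm (V t) / norm (?z t)) * (exp (- q * r) * exp (- (1 / Suc n) * Re (csqrt (?z t))))"
          unfolding eq norm_mult norm_divide norm_exp_eq_Re by simp
        also have "\<dots> \<le> (norm (V t) / norm (?z t)) * (1 * 1)"
          by (intro mult_left_mono mult_mono) (use q r Re_csqrt[of "?z t"] in \<open>auto simp del: csqrt.sel\<close>)
        also have "\<dots> \<le> (cmod (V t))\<^sup>2 + 1 / (r\<^sup>2 + t\<^sup>2)" using bound[of t] by simp
        finally show "norm (V t * wave q (1 / Suc n) (?z t)) \<le> (cmod (V t))\<^sup>2 + 1 / (r\<^sup>2 + t\<^sup>2)" .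
      qed
    qed
    then have "(\<integral>t. of_real (exp (- q * r)) * (V t * iexp (q * t) / ?z t) \<partial>lborel) = 0"
      unfolding zero[OF q] by (simp only: LIMSEQ_const_iff)
    then show ?thesis unfolding integral_mult_right_zero by simp
  qed
  \<comment> \<open>Approximation from above keeps the frequencies positive even when m = 0.\<close>
  have "\<exists>q\<in>\<rat>. m < q \<and> q < m + 1 / Suc i" for i
    by (rule Rats_dense_in_real) simp
  then obtain Q where Q: "\<And>i. Q i \<in> \<rat>" "\<And>i. m < Q i" "\<And>i. Q i < m + 1 / Suc i" by metis
  have Qm: "Q \<longlonglongrightarrow> m"
  proof (rule real_tendsto_sandwich[where f = "\<lambda>i. m" and h = "\<lambda>i. m + 1 / Suc i"])
    show "(\<lambda>i. m + 1 / Suc i) \<longlonglongrightarrow> m"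
      using tendsto_add[OF tendsto_const LIMSEQ_inverse_real_of_nat, of m] by (simp add: inverse_eq_divide)
    show "(\<lambda>i. m) \<longlonglongrightarrow> m" by simp
    show "\<forall>\<^sub>F i in sequentially. m \<le> Q i" "\<forall>\<^sub>F i in sequentially. Q i \<le> m + 1 / Suc i"
      by (auto intro!: always_eventually less_imp_le Q simp del: of_nat_Suc)
  qed
  have "(\<lambda>i. \<integral>t. V t * iexp (Q i * t) / ?z t \<partial>lborel) \<longlonglongrightarrow> (\<integral>t. V t * iexp (m * t) / ?z t \<partial>lborel)"
  proof (rule integral_dominated_convergence[OF bm bm w])
    show "AE t in lborel. (\<lambda>i. V t * iexp (Q i * t) / ?z t) \<longlonglongrightarrow> V t * iexp (m * t) / ?z t"
      by (rule AE_I2) (intro tendsto_intros Qm, use nz in auto)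
    show "AE t in lborel. norm (V t * iexp (Q i * t) / ?z t) \<le> (cmod (V t))\<^sup>2 + 1 / (r\<^sup>2 + t\<^sup>2)" for i
      using bound by (intro AE_I2) (simp add: norm_mult norm_divide)
  qed
  then show ?thesis
    using q0 Q(1) order_le_less_trans[OF m Q(2)] by (simp only: LIMSEQ_const_iff)
qed

lemma square_integrable_cnj:
  "square_integrable U \<Longrightarrow> square_integrable (\<lambda>x. cnj (U x))"
  unfolding square_integrable_def
  by (auto intro: measurable_compose[OF _ borel_measurable_continuous_onI[OF continuous_on_cnj[OF continuous_on_id]]])

lemma square_integrable_slices:
  assumes U: "square_integrable U"
  shows "AE y1 in lborel. AE y2 in lborel. integrable lborel (\<lambda>t. (cmod (U (y1, y2, t)))\<^sup>2)"
proof -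
  have "integrable (lborel \<Otimes>\<^sub>M lborel) (\<lambda>x. (cmod (U x))\<^sup>2)"
    using U by (simp add: square_integrable_def lborel_prod)
  then have "AE y1 in lborel. integrable (lborel \<Otimes>\<^sub>M lborel) (\<lambda>p. (cmod (U (y1, p)))\<^sup>2)"
    unfolding lborel_prod by (intro lborel_pair.AE_integrable_fst'[unfolded lborel_prod])
  then show ?thesis
    by eventually_elim (rule lborel_pair.AE_integrable_fst')
qed

text \<open>The waves carry frequencies m \<ge> 0 and the kernel 1 / (r - i t). Conjugating the
  second family of pairings yields frequencies - m and the kernel 1 / (r + i t); together these are
  the two inputs of the half-line argument on each slice.\<close>

lemma zmon_pairing_total:
  assumes U: "square_integrable U"
    and z1: "\<And>j l G. rapid G \<Longrightarrow> (\<integral>x. U x * zmon j l G x \<partial>lborel) = 0"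
    and z2: "\<And>j l G. rapid G \<Longrightarrow> (\<integral>x. cnj (U x) * zmon j l G x \<partial>lborel) = 0"
  shows "AE x in lborel. U x = 0"
proof -
  have [measurable]: "U \<in> borel_measurable borel" using U by (simp add: square_integrable_def)
  have slices: "AE y1 in lborel. AE y2 in lborel. \<forall>q\<in>{q\<in>\<rat>. q > 0}. \<forall>n::nat. (\<integral>t. W (y1, y2, t) * wave q (1 / Suc n) (zeta (y1, y2, t)) \<partial>lborel) = 0"
    if W: "square_integrable W" "\<forall>j l G. rapid G \<longrightarrow> (\<integral>x. W x * zmon j l G x \<partial>lborel) = 0" for W
  proof -
    have c: "countable {q\<in>\<rat>. q > (0::real)}" by (rule countable_subset[OF _ countable_rat]) auto
    have "AE y1 in lborel. \<forall>q\<in>{q\<in>\<rat>. q > 0}. \<forall>n::nat. AE y2 in lborel. (\<integral>t. W (y1, y2, t) * wave q (1 / Suc n) (zeta (y1, y2, t)) \<partial>lborel) = 0"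
      unfolding AE_ball_countable[OF c] AE_all_countable
      by (intro ballI allI pairing_slices_zero W(1) W(2)[rule_format] rapid_wave) auto
    then show ?thesis
      by eventually_elim (simp only: AE_ball_countable[OF c] AE_all_countable)
  qed
  have zs: "\<forall>j l G. rapid G \<longrightarrow> (\<integral>x. U x * zmon j l G x \<partial>lborel) = 0"
    "\<forall>j l G. rapid G \<longrightarrow> (\<integral>x. cnj (U x) * zmon j l G x \<partial>lborel) = 0"
    using z1 z2 by auto
  have "AE y1 in lborel. AE y2 in lborel. AE t in lborel. U (y1, y2, t) = 0"
    using slices[OF U zs(1)] slices[OF square_integrable_cnj[OF U] zs(2)] square_integrable_slices[OF U]
  proof eventually_elim
    case (elim y1)
    from elim show ?case
    proof eventually_elim
      case (elim y2)
      let ?V = "\<lambda>t. U (y1, y2, t)"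
      define r where "r = 1 + y1\<^sup>2 + y2\<^sup>2"
      have r: "r > 0" by (simp add: r_def add_pos_nonneg)
      have z: "zeta (y1, y2, t) = of_real r - \<i> * of_real t" for t by (simp add: zeta_def r_def)
      have Vm: "?V \<in> borel_measurable lborel" "(\<lambda>t. cnj (?V t)) \<in> borel_measurable lborel"
        by (auto intro: measurable_compose[OF _ borel_measurable_continuous_onI[OF continuous_on_cnj[OF continuous_on_id]]])
      show ?case
      proof (rule half_line_transform_zero[OF Vm(1) elim(3) r])
        fix m :: real assume m: "m \<ge> 0"
        show "(\<integral>t. ?V t * iexp (m * t) / (of_real r - \<i> * of_real t) \<partial>lborel) = 0"
          by (rule half_line_transform_limit[OF Vm(1) elim(3) r _ m]) (use elim(1) in \<open>auto simp: z\<close>)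
        have "(\<integral>t. cnj (?V t) * iexp (m * t) / (of_real r - \<i> * of_real t) \<partial>lborel) = 0"
          by (rule half_line_transform_limit[OF Vm(2) _ r _ m]) (use elim(2,3) in \<open>auto simp: z\<close>)
        moreover have "(\<integral>t. ?V t * iexp (- m * t) / (of_real r + \<i> * of_real t) \<partial>lborel)
            = (\<integral>t. cnj (cnj (?V t) * iexp (m * t) / (of_real r - \<i> * of_real t)) \<partial>lborel)"
          by (rule Bochner_Integration.integral_cong[OF refl]) (simp add: exp_cnj)
        ultimately show "(\<integral>t. ?V t * iexp (- m * t) / (of_real r + \<i> * of_real t) \<partial>lborel) = 0"
          by (simp only: Bochner_Integration.integral_cnj complex_cnj_zero)
      qed
    qed
  qed
  then have ae: "AE y1 in lborel. AE p in lborel \<Otimes>\<^sub>M lborel. U (y1, p) = 0"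
  proof eventually_elim
    case (elim y1)
    have "{p \<in> space borel. U (y1, p) = 0} \<in> sets borel" by measurable
    then show ?case by (intro lborel_pair.AE_pair_measure[OF _ elim]) (unfold lborel_prod, simp)
  qed
  have "{x \<in> space borel. U x = 0} \<in> sets borel" by measurable
  then show ?thesis
    using lborel_pair.AE_pair_measure[OF _ ae[unfolded lborel_prod], unfolded lborel_prod] by simp
qed

section \<open>Integration by parts\<close>

text \<open>Records size only, in a form stable under multiplication by the linear coefficients of X
  and Y; differentiability is tracked separately.\<close>

definition rapidly_decreasing :: "('a::real_normed_vector \<Rightarrow> 'b::real_normed_vector) \<Rightarrow> bool" where
  "rapidly_decreasing f \<longleftrightarrow> f \<in> borel_measurable borel \<and> (\<forall>k::nat. \<exists>C. \<forall>x. (1 + norm x) ^ k * norm (f x) \<le> C)"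

lemma rapidly_decreasing_le:
  assumes f: "rapidly_decreasing f" and g: "g \<in> borel_measurable borel"
    and le: "\<And>x. norm (g x) \<le> K * (1 + norm x) ^ n * norm (f x)" and K: "K \<ge> 0"
  shows "rapidly_decreasing g"
  unfolding rapidly_decreasing_def
proof (intro conjI allI g)
  fix k
  obtain C where C: "\<And>x. (1 + norm x) ^ (k + n) * norm (f x) \<le> C"
    using f unfolding rapidly_decreasing_def by blast
  have "(1 + norm x) ^ k * norm (g x) \<le> K * C" for x
  proof -
    have "(1 + norm x) ^ k * norm (g x) \<le> (1 + norm x) ^ k * (K * (1 + norm x) ^ n * norm (f x))"
      by (intro mult_left_mono le) auto
    also have "\<dots> = K * ((1 + norm x) ^ (k + n) * norm (f x))" by (simp add: power_add mult_ac)
    also have "\<dots> \<le> K * C" by (intro mult_left_mono C K)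
    finally show ?thesis .
  qed
  then show "\<exists>C. \<forall>x. (1 + norm x) ^ k * norm (g x) \<le> C" by blast
qed

lemma rapidly_decreasing_add:
  fixes f g :: "'a::real_normed_vector \<Rightarrow> 'b::{real_normed_vector, second_countable_topology}"
  assumes f: "rapidly_decreasing f" and g: "rapidly_decreasing g"
  shows "rapidly_decreasing (\<lambda>x. f x + g x)"
  unfolding rapidly_decreasing_def
proof (intro conjI allI)
  show "(\<lambda>x. f x + g x) \<in> borel_measurable borel" using f g by (auto simp: rapidly_decreasing_def)
  fix k
  obtain C D where C: "\<And>x. (1 + norm x) ^ k * norm (f x) \<le> C" "\<And>x. (1 + norm x) ^ k * norm (g x) \<le> D"
    using f g unfolding rapidly_decreasing_def by metis
  have "(1 + norm x) ^ k * norm (f x + g x) \<le> C + D" for x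
  proof -
    have "(1 + norm x) ^ k * norm (f x + g x) \<le> (1 + norm x) ^ k * (norm (f x) + norm (g x))"
      by (intro mult_left_mono norm_triangle_ineq) auto
    then show ?thesis using C[of x] by (simp add: distrib_left)
  qed
  then show "\<exists>C. \<forall>x. (1 + norm x) ^ k * norm (f x + g x) \<le> C" by blast
qed

lemma rapidly_decreasing_inner:
  fixes f g :: "'a::real_normed_vector \<Rightarrow> complex"
  assumes f: "rapidly_decreasing f" and g: "rapidly_decreasing g"
  shows "rapidly_decreasing (\<lambda>x. f x \<bullet> g x)"
proof -
  obtain C where C: "\<And>x. norm (g x) \<le> C"
    using g[unfolded rapidly_decreasing_def, THEN conjunct2, rule_format, of 0] by auto
  show ?thesis
  proof (rule rapidly_decreasing_le[OF f, of _ C 0])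
    show "(\<lambda>x. f x \<bullet> g x) \<in> borel_measurable borel" using f g by (auto simp: rapidly_decreasing_def)
    show "C \<ge> 0" using order_trans[OF norm_ge_zero C] .
    fix x
    have "\<bar>f x \<bullet> g x\<bar> \<le> norm (f x) * norm (g x)" by (rule Cauchy_Schwarz_ineq2)
    also have "\<dots> \<le> norm (f x) * C" by (intro mult_left_mono C) auto
    finally show "norm (f x \<bullet> g x) \<le> C * (1 + norm x) ^ 0 * norm (f x)" by (simp add: mult.commute)
  qed
qed

lemma rapidly_decreasing_linear_mult:
  fixes f :: "'a::real_normed_vector \<Rightarrow> 'b::{real_normed_vector, second_countable_topology}"
  assumes f: "rapidly_decreasing f" and p: "bounded_linear p"
  shows "rapidly_decreasing (\<lambda>x. p x *\<^sub>R f x)"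
proof -
  interpret p: bounded_linear p by fact
  obtain K where K: "K > 0" "\<And>x. norm (p x) \<le> norm x * K" using p.pos_bounded by blast
  show ?thesis
  proof (rule rapidly_decreasing_le[OF f, of _ K 1])
    have "p \<in> borel_measurable borel" by (rule borel_measurable_continuous_onI[OF p.continuous_on[OF continuous_on_id]])
    then show "(\<lambda>x. p x *\<^sub>R f x) \<in> borel_measurable borel" using f by (auto simp: rapidly_decreasing_def)
    fix x
    have "norm (p x) \<le> K * (1 + norm x)" using K(2)[of x] K(1) by (simp add: algebra_simps)
    then show "norm (p x *\<^sub>R f x) \<le> K * (1 + norm x) ^ 1 * norm (f x)"
      by (simp add: mult_right_mono)
  qed (use K in auto)
qed

text \<open>The exponent 6 spends two powers of 1 + |x| on each of the three coordinates.\<close>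

lemma inverse_power_le_weight: "1 / (1 + norm x) ^ 6 \<le> weight x"
proof -
  obtain a b c where x: "x = (a, b, c)" by (cases x)
  have "\<bar>a\<bar> \<le> norm x" "norm (b, c) \<le> norm x" "\<bar>b\<bar> \<le> norm (b, c)" "\<bar>c\<bar> \<le> norm (b, c)"
    using norm_fst_le[of a "(b, c)"] norm_snd_le[of "(b, c)" a] norm_fst_le[of b c] norm_snd_le[of c b] by (auto simp: x)
  then have "\<bar>t\<bar> \<le> norm x" if "t \<in> {a, b, c}" for t using that by auto
  then have t: "1 + t\<^sup>2 \<le> (1 + norm x)\<^sup>2" if "t \<in> {a, b, c}" for t
    using power_mono[of "\<bar>t\<bar>" "norm x" 2] that by (force simp: power2_sum)
  have "(1 + a\<^sup>2) * ((1 + b\<^sup>2) * (1 + c\<^sup>2)) \<le> (1 + norm x)\<^sup>2 * ((1 + norm x)\<^sup>2 * (1 + norm x)\<^sup>2)"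
    by (intro mult_mono t) auto
  then have "(1 + a\<^sup>2) * ((1 + b\<^sup>2) * (1 + c\<^sup>2)) \<le> (1 + norm x) ^ 6"
    by (simp flip: power_add)
  moreover have "0 < (1 + a\<^sup>2) * ((1 + b\<^sup>2) * (1 + c\<^sup>2))"
    by (intro mult_pos_pos) (auto intro: add_pos_nonneg)
  ultimately show "1 / (1 + norm x) ^ 6 \<le> weight x"
    by (simp add: weight_def x frac_le)
qed

text \<open>A majorant uniform over bounded translations, as required for differentiating an
  integral in the translation parameter.\<close>

lemma rapidly_decreasing_translation:
  fixes f :: "heis \<Rightarrow> 'b::real_normed_vector"
  assumes f: "rapidly_decreasing f" and B: "B \<ge> 0"
  obtains C where "C \<ge> 0" "\<And>x v. norm v \<le> B \<Longrightarrow> norm (f (v + x)) \<le> C * weight x"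
proof -
  obtain C where C: "\<And>x. (1 + norm x) ^ 6 * norm (f x) \<le> C"
    using assms unfolding rapidly_decreasing_def by blast
  have C0: "C \<ge> 0" using order_trans[OF _ C[of 0]] by simp
  have "norm (f (v + x)) \<le> (1 + B) ^ 6 * C * weight x" if v: "norm v \<le> B" for v x
  proof -
    have pos: "(1 + norm x) ^ 6 > 0" by (intro zero_less_power) (simp add: add_pos_nonneg)
    have "norm x \<le> norm v + norm (v + x)"
      using norm_triangle_ineq4[of "v + x" v] by simp
    also have "\<dots> \<le> B + norm (v + x) + B * norm (v + x)" using v B by (simp add: add_increasing2)
    finally have "1 + norm x \<le> (1 + B) * (1 + norm (v + x))" by (simp add: algebra_simps)
    then have "(1 + norm x) ^ 6 * norm (f (v + x)) \<le> ((1 + B) * (1 + norm (v + x))) ^ 6 * norm (f (v + x))"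
      by (intro mult_right_mono power_mono) auto
    also have "\<dots> \<le> (1 + B) ^ 6 * C"
      using B C[of "v + x"] by (simp add: power_mult_distrib mult.assoc mult_left_mono)
    finally have "norm (f (v + x)) \<le> (1 + B) ^ 6 * C * (1 / (1 + norm x) ^ 6)"
      using pos by (simp add: pos_le_divide_eq mult.commute)
    also have "\<dots> \<le> (1 + B) ^ 6 * C * weight x"
      using B C0 by (intro mult_left_mono inverse_power_le_weight) auto
    finally show ?thesis .
  qed
  then show ?thesis using that[of "(1 + B) ^ 6 * C"] B C0 by auto
qed

lemma rapidly_decreasing_integrable:
  fixes f :: "heis \<Rightarrow> 'b::{banach, second_countable_topology}"
  assumes "rapidly_decreasing f"
  shows "integrable lborel f"
proof -
  obtain C where "\<And>x v. norm v \<le> 0 \<Longrightarrow> norm (f (v + x)) \<le> C * weight x" "C \<ge> 0"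
    using rapidly_decreasing_translation[OF assms order_refl] by metis
  from this(1)[of 0] this(2) have C: "C \<ge> 0" "\<And>x. norm (f x) \<le> C * weight x" by auto
  show ?thesis
    by (rule Bochner_Integration.integrable_bound[OF integrable_mult_right[OF integrable_weight, of C]])
      (use assms C weight_pos in \<open>auto simp: rapidly_decreasing_def abs_mult less_imp_le\<close>)
qed

lemma lborel_integral_translation:
  fixes f :: "'a::euclidean_space \<Rightarrow> 'b::{banach, second_countable_topology}"
  assumes "f \<in> borel_measurable borel"
  shows "(\<integral>x. f (v + x) \<partial>lborel) = (\<integral>x. f x \<partial>lborel)"
proof -
  have "(\<integral>x. f x \<partial>lborel) = (\<integral>x. f x \<partial>distr lborel borel ((+) v))" by (simp add: lborel_distr_plus)
  also have "\<dots> = (\<integral>x. f (v + x) \<partial>lborel)" by (rule integral_distr) (use assms in auto)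
  finally show ?thesis by simp
qed

text \<open>By translation invariance the integral of \<open>c (t e + x)\<close> over \<open>x\<close> does not depend on \<open>t\<close>;
  differentiate at \<open>t = 0\<close>.\<close>

lemma integral_derivative_zero:
  fixes c :: "heis \<Rightarrow> real"
  assumes c: "rapidly_decreasing c" and c': "rapidly_decreasing (\<lambda>x. c' x e)"
    and der: "\<And>x. (c has_derivative c' x) (at x)"
  shows "(\<integral>x. c' x e \<partial>lborel) = 0"
proof -
  obtain C where C: "\<And>x v. norm v \<le> norm e \<Longrightarrow> norm (c (v + x)) \<le> C * weight x" "C \<ge> 0"
    using rapidly_decreasing_translation[OF c norm_ge_zero] by metis
  obtain C' where C': "\<And>x v. norm v \<le> norm e \<Longrightarrow> norm (c' (v + x) e) \<le> C' * weight x" "C' \<ge> 0"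
    using rapidly_decreasing_translation[OF c' norm_ge_zero] by metis
  have small: "norm (t *\<^sub>R e) \<le> norm e" if "t \<in> {-1<..<1}" for t
    using that mult_right_mono[of "\<bar>t\<bar>" 1 "norm e"] by (simp add: abs_le_iff)
  have m: "c \<in> borel_measurable borel" "(\<lambda>x. c' x e) \<in> borel_measurable borel"
    using c c' by (auto simp: rapidly_decreasing_def)
  have "((\<lambda>t. \<integral>x. c (t *\<^sub>R e + x) \<partial>lborel) has_vector_derivative (\<integral>x. c' (0 *\<^sub>R e + x) e \<partial>lborel)) (at 0)"
  proof (rule has_vector_derivative_lebesgue_integral[where a = "-1" and b = 1 and w = "\<lambda>x. C' * weight x"])
    fix t :: real assume t: "t \<in> {-1<..<1}"
    show "integrable lborel (\<lambda>x. c (t *\<^sub>R e + x))"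
    proof (rule Bochner_Integration.integrable_bound[OF integrable_mult_right[OF integrable_weight, of C]])
      show "(\<lambda>x. c (t *\<^sub>R e + x)) \<in> borel_measurable lborel"
        using measurable_compose[OF _ m(1), of "\<lambda>x. t *\<^sub>R e + x" borel] by simp
      show "AE x in lborel. norm (c (t *\<^sub>R e + x)) \<le> norm (C * weight x)"
        using C(1)[OF small[OF t]] by (auto intro!: AE_I2 order_trans[OF _ abs_ge_self])
    qed
    fix x
    show "norm (c' (t *\<^sub>R e + x) e) \<le> C' * weight x" by (rule C'(1)[OF small[OF t]])
    have "((\<lambda>t. t *\<^sub>R e + x) has_vector_derivative e) (at t)"
      by (auto intro!: derivative_eq_intros)
    then have "((\<lambda>t. t *\<^sub>R e + x) has_derivative (\<lambda>h. h *\<^sub>R e)) (at t)" by (simp add: has_vector_derivative_def)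
    from has_derivative_compose[OF this der]
    show "((\<lambda>t. c (t *\<^sub>R e + x)) has_vector_derivative c' (t *\<^sub>R e + x) e) (at t)"
      unfolding has_vector_derivative_def
      by (simp add: linear_cmul[OF has_derivative_linear[OF der]])
  qed (use integrable_weight m(2) in auto)
  moreover have "(\<lambda>t. \<integral>x. c (t *\<^sub>R e + x) \<partial>lborel) = (\<lambda>t. \<integral>x. c x \<partial>lborel)"
    by (rule ext) (rule lborel_integral_translation[OF m(1)])
  ultimately have "((\<lambda>t::real. \<integral>x. c x \<partial>lborel) has_vector_derivative (\<integral>x. c' x e \<partial>lborel)) (at 0)"
    by simp
  from vector_derivative_unique_at[OF this has_vector_derivative_const] show ?thesis .
qed

text \<open>The regularity that one integration by parts consumes. X f and Y f belong to this class
  when f is Schwartz, so each derivative of a second-order term can be moved.\<close>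

definition rapid_C1 :: "(heis \<Rightarrow> complex) \<Rightarrow> bool" where
  "rapid_C1 f \<longleftrightarrow> (\<forall>x. f differentiable (at x)) \<and> rapidly_decreasing f \<and> (\<forall>e\<in>Basis. rapidly_decreasing (dir_deriv e f))"

text \<open>The derivative of p (a \<bullet> b) along e integrates to zero, and p e = 0 ensures that
  no term with a derivative of p remains.\<close>

lemma integral_dir_deriv_by_parts:
  assumes a: "rapid_C1 a" and b: "rapid_C1 b" and e: "e \<in> Basis" and p: "bounded_linear p" "p e = 0"
  shows "(\<integral>x. p x *\<^sub>R (dir_deriv e a x \<bullet> b x + a x \<bullet> dir_deriv e b x) \<partial>lborel) = 0"
    and "(\<integral>x. dir_deriv e a x \<bullet> b x + a x \<bullet> dir_deriv e b x \<partial>lborel) = 0"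
proof -
  let ?c = "\<lambda>x h. frechet_derivative a (at x) h \<bullet> b x + a x \<bullet> frechet_derivative b (at x) h"
  have da: "(a has_derivative frechet_derivative a (at x)) (at x)" and db: "(b has_derivative frechet_derivative b (at x)) (at x)" for x
    using a b by (auto simp: rapid_C1_def frechet_derivative_works simp del: split_paired_All)
  have d: "((\<lambda>x. a x \<bullet> b x) has_derivative ?c x) (at x)" for x
    by (rule has_derivative_eq_rhs[OF has_derivative_inner[OF da db]]) (simp add: fun_eq_iff add.commute)
  have r0: "rapidly_decreasing (\<lambda>x. a x \<bullet> b x)"
    using a b by (auto simp: rapid_C1_def intro: rapidly_decreasing_inner)
  have r: "rapidly_decreasing (\<lambda>x. dir_deriv e a x \<bullet> b x + a x \<bullet> dir_deriv e b x)"
    using a b e by (auto simp: rapid_C1_def intro!: rapidly_decreasing_inner rapidly_decreasing_add)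
  show "(\<integral>x. dir_deriv e a x \<bullet> b x + a x \<bullet> dir_deriv e b x \<partial>lborel) = 0"
    using integral_derivative_zero[OF r0 _ d, of e] r by (simp add: dir_deriv_def)
  have "(\<integral>x. p x *\<^sub>R ?c x e + p e *\<^sub>R (a x \<bullet> b x) \<partial>lborel) = 0"
  proof (rule integral_derivative_zero[of "\<lambda>x. p x *\<^sub>R (a x \<bullet> b x)" "\<lambda>x h. p x *\<^sub>R ?c x h + p h *\<^sub>R (a x \<bullet> b x)"])
    show "rapidly_decreasing (\<lambda>x. p x *\<^sub>R (a x \<bullet> b x))"
      by (rule rapidly_decreasing_linear_mult[OF r0 p(1)])
    show "rapidly_decreasing (\<lambda>x. p x *\<^sub>R ?c x e + p e *\<^sub>R (a x \<bullet> b x))"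
      using rapidly_decreasing_linear_mult[OF r p(1)] by (simp add: dir_deriv_def p)
    show "((\<lambda>x. p x *\<^sub>R (a x \<bullet> b x)) has_derivative (\<lambda>h. p x *\<^sub>R ?c x h + p h *\<^sub>R (a x \<bullet> b x))) (at x)" for x
      by (rule has_derivative_scaleR[OF bounded_linear_imp_has_derivative[OF p(1)] d])
  qed
  then show "(\<integral>x. p x *\<^sub>R (dir_deriv e a x \<bullet> b x + a x \<bullet> dir_deriv e b x) \<partial>lborel) = 0"
    by (simp add: dir_deriv_def p)
qed

text \<open>The common shape of X and Y, so that skew-symmetry, linearity and decay are proved once
  for both fields.\<close>

definition horizontal :: "heis \<Rightarrow> (heis \<Rightarrow> real) \<Rightarrow> (heis \<Rightarrow> complex) \<Rightarrow> heis \<Rightarrow> complex" where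
  "horizontal e p f x = dir_deriv e f x + p x *\<^sub>R dir_deriv (0, 0, 1) f x"

lemma vf_X_horizontal: "vf_X = horizontal (1, 0, 0) (\<lambda>x. - 2 * fst (snd x))"
  and vf_Y_horizontal: "vf_Y = horizontal (0, 1, 0) (\<lambda>x. 2 * fst x)"
  by (simp_all add: fun_eq_iff vf_X_eq vf_Y_eq horizontal_def scaleR_conv_of_real)

text \<open>The coefficient is independent of tau, so the field is divergence free and integration
  by parts leaves no zero-order term.\<close>

lemma horizontal_skew:
  assumes a: "rapid_C1 a" and b: "rapid_C1 b" and e: "e \<in> Basis" and p: "bounded_linear p" "p (0, 0, 1) = 0"
  shows "(\<integral>x. horizontal e p a x \<bullet> b x \<partial>lborel) = - (\<integral>x. a x \<bullet> horizontal e p b x \<partial>lborel)"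
proof -
  let ?t = "(0, 0, 1) :: heis"
  have t: "?t \<in> Basis" by (simp add: heis_Basis)
  have rd: "rapidly_decreasing (horizontal e p a)" "rapidly_decreasing (horizontal e p b)"
    unfolding horizontal_def using a b e t p
    by (auto simp: rapid_C1_def intro!: rapidly_decreasing_add rapidly_decreasing_linear_mult)
  have int: "integrable lborel (\<lambda>x. horizontal e p a x \<bullet> b x)" "integrable lborel (\<lambda>x. a x \<bullet> horizontal e p b x)"
    using rd a b by (auto simp: rapid_C1_def intro!: rapidly_decreasing_integrable rapidly_decreasing_inner)
  have int2: "integrable lborel (\<lambda>x. dir_deriv e a x \<bullet> b x + a x \<bullet> dir_deriv e b x)"
    "integrable lborel (\<lambda>x. p x *\<^sub>R (dir_deriv ?t a x \<bullet> b x + a x \<bullet> dir_deriv ?t b x))"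
    using a b e t p by (auto simp: rapid_C1_def simp del: real_scaleR_def intro!: rapidly_decreasing_integrable rapidly_decreasing_inner
      rapidly_decreasing_add rapidly_decreasing_linear_mult)
  have "(\<integral>x. horizontal e p a x \<bullet> b x \<partial>lborel) + (\<integral>x. a x \<bullet> horizontal e p b x \<partial>lborel)
      = (\<integral>x. (dir_deriv e a x \<bullet> b x + a x \<bullet> dir_deriv e b x) + p x *\<^sub>R (dir_deriv ?t a x \<bullet> b x + a x \<bullet> dir_deriv ?t b x) \<partial>lborel)"
    unfolding Bochner_Integration.integral_add[OF int, symmetric]
    by (rule Bochner_Integration.integral_cong[OF refl]) (simp add: horizontal_def inner_simps algebra_simps)
  also have "\<dots> = 0"
    unfolding Bochner_Integration.integral_add[OF int2]
    \<comment> \<open>The coefficient part uses the tau-direction, along which \<open>p\<close>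
      vanishes. For the direction \<open>e\<close> the second conclusion is instantiated with the
      zero functional, which satisfies the premises on the functional.\<close>
    using integral_dir_deriv_by_parts[OF a b e p(1)] integral_dir_deriv_by_parts(1)[OF a b t p] integral_dir_deriv_by_parts(2)[OF a b e bounded_linear_zero]
    by simp
  finally show ?thesis by simp
qed

section \<open>Schwartz functions and the Dirichlet form\<close>

lemma schwartz_dir_deriv: "schwartz f \<Longrightarrow> e \<in> Basis \<Longrightarrow> schwartz (dir_deriv e f)"
  unfolding schwartz_def
proof (intro allI impI)
  fix es :: "'a list"
  assume f: "\<forall>es. set es \<subseteq> Basis \<longrightarrow> (\<forall>x. foldr dir_deriv es f differentiable at x) \<and>
      (\<forall>k. bounded (range (\<lambda>x. norm x ^ k *\<^sub>R foldr dir_deriv es f x)))" and e: "e \<in> Basis" and es: "set es \<subseteq> Basis"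
  show "(\<forall>x. foldr dir_deriv es (dir_deriv e f) differentiable at x) \<and>
      (\<forall>k. bounded (range (\<lambda>x. norm x ^ k *\<^sub>R foldr dir_deriv es (dir_deriv e f) x)))"
    using f[rule_format, of "es @ [e]"] e es by simp
qed

lemma schwartz_differentiable: "schwartz f \<Longrightarrow> f differentiable (at x)"
  unfolding schwartz_def by (drule spec[of _ "[]"]) simp

lemma schwartz_rapidly_decreasing:
  assumes f: "schwartz f"
  shows "rapidly_decreasing f"
  unfolding rapidly_decreasing_def
proof (intro conjI allI)
  show "f \<in> borel_measurable borel"
    by (intro borel_measurable_continuous_onI continuous_at_imp_continuous_on ballI
        differentiable_imp_continuous_within schwartz_differentiable f)
  fix k :: nat
  have "bounded (range (\<lambda>x. norm x ^ n *\<^sub>R f x))" for n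
    using f unfolding schwartz_def by (metis empty_subsetI foldr_Nil id_apply list.set(1))
  then have "\<exists>C. \<forall>x. norm (norm x ^ n *\<^sub>R f x) \<le> C" for n
    unfolding bounded_iff by blast
  then have *: "\<exists>C. \<forall>x. norm x ^ n * norm (f x) \<le> C" for n by simp
  obtain C where C: "\<And>x. norm x ^ k * norm (f x) \<le> C" using *[of k] by blast
  obtain D where D: "\<And>x. norm (f x) \<le> D" using *[of 0] by auto
  have "(1 + norm x) ^ k * norm (f x) \<le> 2 ^ k * (D + C)" for x
  proof -
    have "(1 + norm x) ^ k \<le> 2 ^ k * (1 + norm x ^ k)"
    proof (cases "norm x \<le> 1")
      case True
      then have "(1 + norm x) ^ k \<le> 2 ^ k" by (intro power_mono) auto
      also have "\<dots> \<le> 2 ^ k * (1 + norm x ^ k)" by simp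
      finally show ?thesis .
    next
      case False
      then have "(1 + norm x) ^ k \<le> (2 * norm x) ^ k" by (intro power_mono) auto
      also have "\<dots> \<le> 2 ^ k * (1 + norm x ^ k)" by (simp add: power_mult_distrib)
      finally show ?thesis .
    qed
    then have "(1 + norm x) ^ k * norm (f x) \<le> 2 ^ k * (1 + norm x ^ k) * norm (f x)"
      by (intro mult_right_mono) auto
    also have "\<dots> = 2 ^ k * (norm (f x) + norm x ^ k * norm (f x))" by (simp add: algebra_simps)
    also have "\<dots> \<le> 2 ^ k * (D + C)" by (intro mult_left_mono add_mono C D) auto
    finally show ?thesis .
  qed
  then show "\<exists>C. \<forall>x. (1 + norm x) ^ k * norm (f x) \<le> C" by blast
qed

lemma schwartz_rapid_C1: "schwartz f \<Longrightarrow> rapid_C1 f"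
  unfolding rapid_C1_def using schwartz_differentiable schwartz_rapidly_decreasing schwartz_dir_deriv by blast

lemma horizontal_rapid_C1:
  assumes f: "schwartz f" and e: "e \<in> Basis" and p: "bounded_linear p"
  shows "rapid_C1 (horizontal e p f)"
proof -
  let ?t = "(0, 0, 1) :: heis"
  have t: "?t \<in> Basis" by (simp add: heis_Basis)
  note s = schwartz_dir_deriv[OF f e] schwartz_dir_deriv[OF f t]
  have d: "(dir_deriv e f has_derivative frechet_derivative (dir_deriv e f) (at x)) (at x)"
    "(dir_deriv ?t f has_derivative frechet_derivative (dir_deriv ?t f) (at x)) (at x)" for x
    using schwartz_differentiable[OF s(1)] schwartz_differentiable[OF s(2)] by (auto simp flip: frechet_derivative_works)
  have D: "(horizontal e p f has_derivative (\<lambda>h. frechet_derivative (dir_deriv e f) (at x) h +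
      (p x *\<^sub>R frechet_derivative (dir_deriv ?t f) (at x) h + p h *\<^sub>R dir_deriv ?t f x))) (at x)" for x
    unfolding horizontal_def
    by (rule has_derivative_add[OF d(1) has_derivative_scaleR[OF bounded_linear_imp_has_derivative[OF p] d(2)]])
  have D': "dir_deriv b (horizontal e p f) = (\<lambda>x. dir_deriv b (dir_deriv e f) x + (p x *\<^sub>R dir_deriv b (dir_deriv ?t f) x + p b *\<^sub>R dir_deriv ?t f x))" for b
    by (rule ext) (simp add: dir_deriv_eq[OF D], simp add: dir_deriv_def)
  note rd = schwartz_rapidly_decreasing[OF s(1)] schwartz_rapidly_decreasing[OF s(2)]
  have c: "rapidly_decreasing (\<lambda>x. p b *\<^sub>R dir_deriv ?t f x)" for b
    using rd(2)
    by (rule rapidly_decreasing_le[where K = "\<bar>p b\<bar>" and n = 0]) (use rd(2) in \<open>auto simp: rapidly_decreasing_def\<close>)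
  have "rapidly_decreasing (dir_deriv b (horizontal e p f))" if b: "b \<in> Basis" for b
    unfolding D' by (intro rapidly_decreasing_add rapidly_decreasing_linear_mult p c
      schwartz_rapidly_decreasing schwartz_dir_deriv f e t b)
  moreover have "rapidly_decreasing (horizontal e p f)"
    unfolding horizontal_def by (intro rapidly_decreasing_add rapidly_decreasing_linear_mult p rd)
  moreover have "horizontal e p f differentiable (at x)" for x
    using D[of x] by (rule differentiableI)
  ultimately show ?thesis
    unfolding rapid_C1_def by blast
qed

text \<open>Green's identity for the real part of the Hermitian product. The right-hand side is
  symmetric in \<open>f\<close> and \<open>g\<close> and nonnegative for f = g, which yields
  symmetry and positivity of the operator together.\<close>

lemma sublaplacian_dirichlet:
  assumes f: "schwartz f" and g: "schwartz g"
  shows "(\<integral>x. sublaplacian f x \<bullet> g x \<partial>lborel) = (\<integral>x. vf_X f x \<bullet> vf_X g x + vf_Y f x \<bullet> vf_Y g x \<partial>lborel)"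
proof -
  have e: "(1, 0, 0) \<in> (Basis :: heis set)" "(0, 1, 0) \<in> (Basis :: heis set)" by (simp_all add: heis_Basis)
  have p: "bounded_linear (\<lambda>x::heis. - 2 * fst (snd x))" "bounded_linear (\<lambda>x::heis. 2 * fst x)"
    by (rule bounded_linear_compose[OF bounded_linear_mult_right bounded_linear_compose[OF bounded_linear_fst bounded_linear_snd]],
        rule bounded_linear_compose[OF bounded_linear_mult_right bounded_linear_fst])
  have C1: "rapid_C1 (vf_X f)" "rapid_C1 (vf_X g)" "rapid_C1 (vf_Y f)" "rapid_C1 (vf_Y g)"
    unfolding vf_X_horizontal vf_Y_horizontal using f g e p by (auto intro: horizontal_rapid_C1)
  have rd: "rapidly_decreasing (vf_X a)" "rapidly_decreasing (vf_Y a)" if "rapid_C1 a" for a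
    unfolding vf_X_horizontal vf_Y_horizontal horizontal_def[abs_def]
    by (intro rapidly_decreasing_add rapidly_decreasing_linear_mult p,
        use that in \<open>simp_all add: rapid_C1_def heis_Basis\<close>)+
  have i: "integrable lborel (\<lambda>x. vf_X (vf_X f) x \<bullet> g x)" "integrable lborel (\<lambda>x. vf_Y (vf_Y f) x \<bullet> g x)"
    "integrable lborel (\<lambda>x. vf_X f x \<bullet> vf_X g x)" "integrable lborel (\<lambda>x. vf_Y f x \<bullet> vf_Y g x)"
    using rd C1 f g schwartz_rapid_C1 schwartz_rapidly_decreasing
    by (auto intro!: rapidly_decreasing_integrable rapidly_decreasing_inner)
  have "(\<integral>x. sublaplacian f x \<bullet> g x \<partial>lborel) = (\<integral>x. - (vf_X (vf_X f) x \<bullet> g x + vf_Y (vf_Y f) x \<bullet> g x) \<partial>lborel)"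
    by (simp add: sublaplacian_def inner_simps)
  also have "\<dots> = - (\<integral>x. vf_X (vf_X f) x \<bullet> g x \<partial>lborel) - (\<integral>x. vf_Y (vf_Y f) x \<bullet> g x \<partial>lborel)"
    using i by simp
  also have "\<dots> = (\<integral>x. vf_X f x \<bullet> vf_X g x \<partial>lborel) + (\<integral>x. vf_Y f x \<bullet> vf_Y g x \<partial>lborel)"
    using horizontal_skew[OF C1(1) schwartz_rapid_C1[OF g] e(1) p(1), folded vf_X_horizontal]
      horizontal_skew[OF C1(3) schwartz_rapid_C1[OF g] e(2) p(2), folded vf_Y_horizontal]
    by simp
  also have "\<dots> = (\<integral>x. vf_X f x \<bullet> vf_X g x + vf_Y f x \<bullet> vf_Y g x \<partial>lborel)"
    using i by simp
  finally show ?thesis .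
qed

section \<open>The operator and its closure\<close>

text \<open>Real-linear maps \<open>A\<close> and \<open>B\<close> in place of scalars cover sums,
  complex multiples and complex conjugation at one stroke.\<close>

lemma foldr_dir_deriv_linear:
  fixes f g :: "'a::euclidean_space \<Rightarrow> complex"
  assumes f: "schwartz f" and g: "schwartz g" and A: "bounded_linear A" and B: "bounded_linear B"
    and es: "set es \<subseteq> Basis"
  shows "foldr dir_deriv es (\<lambda>x. A (f x) + B (g x)) = (\<lambda>x. A (foldr dir_deriv es f x) + B (foldr dir_deriv es g x))"
    and "((\<lambda>x. A (foldr dir_deriv es f x) + B (foldr dir_deriv es g x)) has_derivative
      (\<lambda>h. A (frechet_derivative (foldr dir_deriv es f) (at x) h) + B (frechet_derivative (foldr dir_deriv es g) (at x) h))) (at x)"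
proof -
  have d: "((\<lambda>x. A (foldr dir_deriv es f x) + B (foldr dir_deriv es g x)) has_derivative
      (\<lambda>h. A (frechet_derivative (foldr dir_deriv es f) (at x) h) + B (frechet_derivative (foldr dir_deriv es g) (at x) h))) (at x)"
    if "set es \<subseteq> Basis" for es x
    using f g that unfolding schwartz_def
    by (intro has_derivative_add bounded_linear.has_derivative[OF A] bounded_linear.has_derivative[OF B])
      (simp_all flip: frechet_derivative_works)
  show "((\<lambda>x. A (foldr dir_deriv es f x) + B (foldr dir_deriv es g x)) has_derivative
      (\<lambda>h. A (frechet_derivative (foldr dir_deriv es f) (at x) h) + B (frechet_derivative (foldr dir_deriv es g) (at x) h))) (at x)"
    by (rule d[OF es])
  show "foldr dir_deriv es (\<lambda>x. A (f x) + B (g x)) = (\<lambda>x. A (foldr dir_deriv es f x) + B (foldr dir_deriv es g x))"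
    using es
  proof (induction es)
    case (Cons e es)
    then have "foldr dir_deriv (e # es) (\<lambda>x. A (f x) + B (g x)) = dir_deriv e (\<lambda>x. A (foldr dir_deriv es f x) + B (foldr dir_deriv es g x))"
      by simp
    also have "\<dots> = (\<lambda>x. A (foldr dir_deriv (e # es) f x) + B (foldr dir_deriv (e # es) g x))"
      using Cons.prems by (intro ext) (simp add: dir_deriv_eq[OF d[of es]], simp add: dir_deriv_def)
    finally show ?case .
  qed simp
qed

lemma schwartz_linear:
  fixes f g :: "'a::euclidean_space \<Rightarrow> complex"
  assumes f: "schwartz f" and g: "schwartz g" and A: "bounded_linear A" and B: "bounded_linear B"
  shows "schwartz (\<lambda>x. A (f x) + B (g x))"
  unfolding schwartz_def
proof (intro allI impI conjI)
  fix es :: "'a list" assume es: "set es \<subseteq> Basis"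
  note D = foldr_dir_deriv_linear[OF f g A B es]
  show "foldr dir_deriv es (\<lambda>x. A (f x) + B (g x)) differentiable (at x)" for x
    unfolding D(1) using D(2) by (rule differentiableI)
  fix k :: nat
  have "bounded (range (\<lambda>x. norm x ^ k *\<^sub>R foldr dir_deriv es f x))" "bounded (range (\<lambda>x. norm x ^ k *\<^sub>R foldr dir_deriv es g x))"
    using f g es unfolding schwartz_def by auto
  from bounded_plus_comp[OF bounded_linear_image[OF this(1) A, unfolded image_image] bounded_linear_image[OF this(2) B, unfolded image_image]]
  show "bounded (range (\<lambda>x. norm x ^ k *\<^sub>R foldr dir_deriv es (\<lambda>x. A (f x) + B (g x)) x))"
    unfolding D(1) by (simp add: linear_cmul[OF bounded_linear.linear[OF A]] linear_cmul[OF bounded_linear.linear[OF B]] scaleR_add_right)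
qed

lemma horizontal_linear:
  assumes f: "\<And>x. f differentiable (at x)" and g: "\<And>x. g differentiable (at x)" and A: "bounded_linear A" and B: "bounded_linear B"
  shows "horizontal e p (\<lambda>x. A (f x) + B (g x)) = (\<lambda>x. A (horizontal e p f x) + B (horizontal e p g x))"
proof
  fix x
  have "((\<lambda>x. A (f x) + B (g x)) has_derivative (\<lambda>h. A (frechet_derivative f (at x) h) + B (frechet_derivative g (at x) h))) (at x)"
    using f[of x] g[of x]
    by (intro has_derivative_add bounded_linear.has_derivative[OF A] bounded_linear.has_derivative[OF B])
      (simp_all flip: frechet_derivative_works)
  note d = dir_deriv_eq[OF this]
  show "horizontal e p (\<lambda>x. A (f x) + B (g x)) x = A (horizontal e p f x) + B (horizontal e p g x)"
    unfolding horizontal_def d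
    by (simp add: dir_deriv_def linear_add[OF bounded_linear.linear[OF A]] linear_add[OF bounded_linear.linear[OF B]]
      linear_cmul[OF bounded_linear.linear[OF A]] linear_cmul[OF bounded_linear.linear[OF B]] scaleR_add_right)
qed

lemma schwartz_vf_differentiable:
  assumes f: "schwartz f"
  shows "vf_X f differentiable (at x)" "vf_Y f differentiable (at x)"
proof -
  have "bounded_linear (\<lambda>x::heis. - 2 * fst (snd x))" "bounded_linear (\<lambda>x::heis. 2 * fst x)"
    by (rule bounded_linear_compose[OF bounded_linear_mult_right bounded_linear_compose[OF bounded_linear_fst bounded_linear_snd]],
        rule bounded_linear_compose[OF bounded_linear_mult_right bounded_linear_fst])
  then have "rapid_C1 (vf_X f)" "rapid_C1 (vf_Y f)"
    unfolding vf_X_horizontal vf_Y_horizontal using f by (auto intro!: horizontal_rapid_C1 simp: heis_Basis)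
  then show "vf_X f differentiable (at x)" "vf_Y f differentiable (at x)" by (auto simp: rapid_C1_def simp del: split_paired_All)
qed

lemma sublaplacian_linear:
  assumes f: "schwartz f" and g: "schwartz g" and A: "bounded_linear A" and B: "bounded_linear B"
  shows "sublaplacian (\<lambda>x. A (f x) + B (g x)) = (\<lambda>x. A (sublaplacian f x) + B (sublaplacian g x))"
proof -
  note s = schwartz_vf_differentiable[OF f] schwartz_vf_differentiable[OF g] schwartz_differentiable[OF f] schwartz_differentiable[OF g]
  have X: "vf_X (vf_X (\<lambda>x. A (f x) + B (g x))) = (\<lambda>x. A (vf_X (vf_X f) x) + B (vf_X (vf_X g) x))"
    using s unfolding vf_X_horizontal by (simp only: horizontal_linear[OF _ _ A B])
  have Y: "vf_Y (vf_Y (\<lambda>x. A (f x) + B (g x))) = (\<lambda>x. A (vf_Y (vf_Y f) x) + B (vf_Y (vf_Y g) x))"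
    using s unfolding vf_Y_horizontal by (simp only: horizontal_linear[OF _ _ A B])
  show ?thesis
    unfolding sublaplacian_def X Y
    by (simp add: fun_eq_iff linear_add[OF bounded_linear.linear[OF A]] linear_add[OF bounded_linear.linear[OF B]]
      linear_neg[OF bounded_linear.linear[OF A]] linear_neg[OF bounded_linear.linear[OF B]] linear_diff[OF bounded_linear.linear[OF A]] linear_diff[OF bounded_linear.linear[OF B]])
qed

section \<open>Operations on classes through representatives, and the real inner product\<close>

lemma L2_represents_add:
  assumes "L2_represents u f" "L2_represents v g"
  shows "L2_represents (u + v) (\<lambda>x. f x + g x)"
  using assms by (auto simp: L2_represents_def square_integrable_add plus_heis_L2.abs_eq l2_rel_def)

lemma L2_represents_scaleC:
  assumes "L2_represents u f"
  shows "L2_represents (c *\<^sub>C u) (\<lambda>x. c * f x)"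
  using assms by (auto simp: L2_represents_def square_integrable_mult scaleC_heis_L2.abs_eq l2_rel_def)

lemma L2_represents_inner:
  assumes "L2_represents u f" "L2_represents v g"
  shows "u \<bullet> v = (\<integral>x. f x \<bullet> g x \<partial>lborel)"
  using assms by (auto simp: L2_represents_def inner_heis_L2.abs_eq l2_rel_def)

lemma L2_represents_zero_iff:
  assumes "L2_represents u f"
  shows "u = 0 \<longleftrightarrow> (AE x in lborel. f x = 0)"
proof -
  have "u = 0 \<longleftrightarrow> abs_heis_L2 f = abs_heis_L2 (\<lambda>x. 0)"
    using assms by (simp add: L2_represents_def zero_heis_L2.abs_eq)
  also have "\<dots> \<longleftrightarrow> l2_rel f (\<lambda>x. 0)"
    using assms Quotient3_rel[OF Quotient3_heis_L2, of f "\<lambda>x. 0"]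
    by (auto simp: L2_represents_def l2_rel_def square_integrable_zero)
  finally show ?thesis using assms by (simp add: l2_rel_def L2_represents_def square_integrable_zero)
qed

lemma scaleC_complex: "z *\<^sub>C (u :: 'a::complex_vector) = Re z *\<^sub>R u + Im z *\<^sub>R (\<i> *\<^sub>C u)"
proof -
  have "z *\<^sub>C u = (of_real (Re z) + of_real (Im z) * \<i>) *\<^sub>C u" using complex_eq[of z] by (simp add: mult.commute)
  then show ?thesis by (simp only: scaleC_add_left scaleC_of_real flip: scaleC_scaleC)
qed

text \<open>Multiplication by i is skew for the real inner product; this is how Hermitian facts are
  recovered from real ones.\<close>

lemma inner_i_left: "(\<i> *\<^sub>C u) \<bullet> v = - (u \<bullet> (\<i> *\<^sub>C v))" for u v :: heis_L2
proof -
  obtain f g where fg: "L2_represents u f" "L2_represents v g" using L2_represents_ex by metis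
  have "(\<i> * f x) \<bullet> g x = - (f x \<bullet> (\<i> * g x))" for x by (simp add: inner_complex_def)
  then show ?thesis
    by (simp add: L2_represents_inner[OF L2_represents_scaleC[OF fg(1)] fg(2)] L2_represents_inner[OF fg(1) L2_represents_scaleC[OF fg(2)]])
qed

lemma bounded_linear_scaleC: "bounded_linear (\<lambda>u::'a::complex_normed_vector. c *\<^sub>C u)"
proof (rule bounded_linear_intro)
  fix u v :: 'a and r :: real
  show "c *\<^sub>C (u + v) = c *\<^sub>C u + c *\<^sub>C v" by (rule scaleC_add_right)
  show "c *\<^sub>C (r *\<^sub>R u) = r *\<^sub>R (c *\<^sub>C u)"
    by (simp only: mult.commute scaleC_scaleC flip: scaleC_of_real)
  show "norm (c *\<^sub>C u) \<le> norm u * cmod c" by (simp add: norm_scaleC)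
qed

definition complex_linear_op :: "'a::complex_vector operator \<Rightarrow> bool" where
  "complex_linear_op T \<longleftrightarrow> (0, 0) \<in> T \<and> (\<forall>u v u' v'. (u, v) \<in> T \<longrightarrow> (u', v') \<in> T \<longrightarrow> (u + u', v + v') \<in> T) \<and>
     (\<forall>c u v. (u, v) \<in> T \<longrightarrow> (c *\<^sub>C u, c *\<^sub>C v) \<in> T)"

text \<open>Formulated with the real inner product. For a complex linear operator, inserting i u for
  u gives the imaginary part as well, hence Hermitian symmetry.\<close>

definition positive_symmetric_op :: "heis_L2 operator \<Rightarrow> bool" where
  "positive_symmetric_op T \<longleftrightarrow> (\<forall>u v u' v'. (u, v) \<in> T \<longrightarrow> (u', v') \<in> T \<longrightarrow> v \<bullet> u' = u \<bullet> v') \<and> (\<forall>u v. (u, v) \<in> T \<longrightarrow> v \<bullet> u \<ge> 0)"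

lemma complex_linear_op_sublaplacian: "complex_linear_op sublaplacian_op"
  unfolding complex_linear_op_def
proof (intro conjI allI impI)
  have s0: "schwartz (\<lambda>x::heis. 0::complex)"
    using zmon_comb_schwartz[OF zmon_comb_cmult[OF zmon_comb_zmon[OF rapid_exp_csqrt[of 1], of 0 0], of 0]] by simp
  have "sublaplacian (\<lambda>x. 0) = (\<lambda>x. 0)"
    using sublaplacian_linear[OF s0 s0 bounded_linear_zero bounded_linear_zero] by simp
  moreover have "L2_represents 0 (\<lambda>x. 0)"
    by (simp add: L2_represents_def square_integrable_zero zero_heis_L2_def)
  ultimately show "(0, 0) \<in> sublaplacian_op" using s0 by (auto simp: sublaplacian_op_def)
next
  fix u v u' v' assume "(u, v) \<in> sublaplacian_op" "(u', v') \<in> sublaplacian_op"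
  then obtain f g where f: "schwartz f" "L2_represents u f" "L2_represents v (sublaplacian f)"
    and g: "schwartz g" "L2_represents u' g" "L2_represents v' (sublaplacian g)"
    by (auto simp: sublaplacian_op_def)
  show "(u + u', v + v') \<in> sublaplacian_op"
    unfolding sublaplacian_op_def
    using schwartz_linear[OF f(1) g(1) bounded_linear_ident bounded_linear_ident]
      sublaplacian_linear[OF f(1) g(1) bounded_linear_ident bounded_linear_ident]
      L2_represents_add[OF f(2) g(2)] L2_represents_add[OF f(3) g(3)] by force
next
  fix c u v assume "(u, v) \<in> sublaplacian_op"
  then obtain f where f: "schwartz f" "L2_represents u f" "L2_represents v (sublaplacian f)"
    by (auto simp: sublaplacian_op_def)
  show "(c *\<^sub>C u, c *\<^sub>C v) \<in> sublaplacian_op"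
    unfolding sublaplacian_op_def
    using schwartz_linear[OF f(1) f(1) bounded_linear_mult_right[of c] bounded_linear_zero]
      sublaplacian_linear[OF f(1) f(1) bounded_linear_mult_right[of c] bounded_linear_zero]
      L2_represents_scaleC[OF f(2)] L2_represents_scaleC[OF f(3)] by force
qed

lemma positive_symmetric_op_sublaplacian: "positive_symmetric_op sublaplacian_op"
  unfolding positive_symmetric_op_def
proof (intro conjI allI impI)
  fix u v u' v' assume "(u, v) \<in> sublaplacian_op" "(u', v') \<in> sublaplacian_op"
  then obtain f g where f: "schwartz f" "L2_represents u f" "L2_represents v (sublaplacian f)"
    and g: "schwartz g" "L2_represents u' g" "L2_represents v' (sublaplacian g)"
    by (auto simp: sublaplacian_op_def)
  have "u \<bullet> v' = v' \<bullet> u" by (rule inner_commute)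
  also have "\<dots> = v \<bullet> u'"
    unfolding L2_represents_inner[OF f(3) g(2)] L2_represents_inner[OF g(3) f(2)]
      sublaplacian_dirichlet[OF f(1) g(1)] sublaplacian_dirichlet[OF g(1) f(1)]
    by (simp add: inner_commute)
  finally show "v \<bullet> u' = u \<bullet> v'" by simp
next
  fix u v assume "(u, v) \<in> sublaplacian_op"
  then obtain f where f: "schwartz f" "L2_represents u f" "L2_represents v (sublaplacian f)"
    by (auto simp: sublaplacian_op_def)
  show "v \<bullet> u \<ge> 0"
    unfolding L2_represents_inner[OF f(3) f(2)] sublaplacian_dirichlet[OF f(1) f(1)]
    by (intro integral_nonneg_AE AE_I2) simp
qed

section \<open>Passage to the closure, and the range of the shifted operator\<close>

lemma closure_pairE:
  fixes T :: "('a::metric_space \<times> 'b::metric_space) set"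
  assumes "(u, v) \<in> closure T"
  obtains a b where "\<And>n. (a n, b n) \<in> T" "a \<longlonglongrightarrow> u" "b \<longlonglongrightarrow> v"
proof -
  obtain s where s: "\<And>n. s n \<in> T" "s \<longlonglongrightarrow> (u, v)"
    using assms closure_sequential by blast
  show ?thesis
    by (rule that[of "fst \<circ> s" "snd \<circ> s"]) (use s tendsto_fst[OF s(2)] tendsto_snd[OF s(2)] in \<open>simp_all add: comp_def\<close>)
qed

lemma closure_pairI:
  fixes T :: "('a::metric_space \<times> 'b::metric_space) set"
  assumes "\<And>n. (a n, b n) \<in> T" "a \<longlonglongrightarrow> u" "b \<longlonglongrightarrow> v"
  shows "(u, v) \<in> closure T"
  unfolding closure_sequential
  by (rule exI[of _ "\<lambda>n. (a n, b n)"]) (use assms in \<open>auto intro: tendsto_Pair\<close>)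

lemma complex_linear_op_closure:
  fixes T :: "'a::complex_normed_vector operator"
  assumes T: "complex_linear_op T"
  shows "complex_linear_op (closure T)"
  unfolding complex_linear_op_def
proof (intro conjI allI impI)
  show "(0, 0) \<in> closure T" using T closure_subset by (auto simp: complex_linear_op_def)
next
  fix u v u' v' assume "(u, v) \<in> closure T" "(u', v') \<in> closure T"
  then obtain a b a' b' where "\<And>n. (a n, b n) \<in> T" "a \<longlonglongrightarrow> u" "b \<longlonglongrightarrow> v"
    "\<And>n. (a' n, b' n) \<in> T" "a' \<longlonglongrightarrow> u'" "b' \<longlonglongrightarrow> v'"
    using closure_pairE by metis
  then show "(u + u', v + v') \<in> closure T"
    using T by (intro closure_pairI[of "\<lambda>n. a n + a' n" "\<lambda>n. b n + b' n"] tendsto_add) (auto simp: complex_linear_op_def)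
next
  fix c u v assume "(u, v) \<in> closure T"
  then obtain a b where "\<And>n. (a n, b n) \<in> T" "a \<longlonglongrightarrow> u" "b \<longlonglongrightarrow> v"
    using closure_pairE by metis
  then show "(c *\<^sub>C u, c *\<^sub>C v) \<in> closure T"
    using T by (intro closure_pairI[of "\<lambda>n. c *\<^sub>C a n" "\<lambda>n. c *\<^sub>C b n"] bounded_linear.tendsto[OF bounded_linear_scaleC])
      (auto simp: complex_linear_op_def)
qed

lemma positive_symmetric_op_closure:
  assumes T: "positive_symmetric_op T"
  shows "positive_symmetric_op (closure T)"
  unfolding positive_symmetric_op_def
proof (intro conjI allI impI)
  fix u v u' v' assume "(u, v) \<in> closure T" "(u', v') \<in> closure T"
  then obtain a b a' b' where s: "\<And>n. (a n, b n) \<in> T" "a \<longlonglongrightarrow> u" "b \<longlonglongrightarrow> v"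
    "\<And>n. (a' n, b' n) \<in> T" "a' \<longlonglongrightarrow> u'" "b' \<longlonglongrightarrow> v'"
    using closure_pairE by metis
  have "b n \<bullet> a' n = a n \<bullet> b' n" for n using T s by (auto simp: positive_symmetric_op_def)
  then show "v \<bullet> u' = u \<bullet> v'"
    using LIMSEQ_unique[OF tendsto_inner[OF s(3) s(5)]] tendsto_inner[OF s(2) s(6)] by simp
next
  fix u v assume "(u, v) \<in> closure T"
  then obtain a b where s: "\<And>n. (a n, b n) \<in> T" "a \<longlonglongrightarrow> u" "b \<longlonglongrightarrow> v"
    using closure_pairE by metis
  have "b n \<bullet> a n \<ge> 0" for n using T s by (auto simp: positive_symmetric_op_def)
  then show "v \<bullet> u \<ge> 0"
    using LIMSEQ_le_const[OF tendsto_inner[OF s(3) s(2)]] by blast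
qed

lemma Range_op_minus: "w \<in> Range (op_minus T z) \<longleftrightarrow> (\<exists>u v. (u, v) \<in> T \<and> w = v - z *\<^sub>C u)"
  by (auto simp: op_minus_def Range_iff)

lemma subspace_Range_op_minus:
  fixes T :: "'a::complex_vector operator"
  assumes T: "complex_linear_op T"
  shows "complex_vector.subspace (Range (op_minus T z))"
proof (rule complex_vector.subspaceI)
  show "0 \<in> Range (op_minus T z)"
    unfolding Range_op_minus using T by (intro exI[of _ 0]) (simp add: complex_linear_op_def)
next
  fix x y assume "x \<in> Range (op_minus T z)" "y \<in> Range (op_minus T z)"
  then obtain u v u' v' where "(u, v) \<in> T" "(u', v') \<in> T" "x = v - z *\<^sub>C u" "y = v' - z *\<^sub>C u'"
    unfolding Range_op_minus by blast
  then have "(u + u', v + v') \<in> T" "x + y = (v + v') - z *\<^sub>C (u + u')"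
    using T by (auto simp: complex_linear_op_def scaleC_add_right)
  then show "x + y \<in> Range (op_minus T z)" unfolding Range_op_minus by blast
next
  fix c x assume "x \<in> Range (op_minus T z)"
  then obtain u v where "(u, v) \<in> T" "x = v - z *\<^sub>C u"
    unfolding Range_op_minus by blast
  then have "(c *\<^sub>C u, c *\<^sub>C v) \<in> T" "c *\<^sub>C x = c *\<^sub>C v - z *\<^sub>C (c *\<^sub>C u)"
    using T by (auto simp: complex_linear_op_def complex_vector.scale_right_diff_distrib mult.commute)
  then show "c *\<^sub>C x \<in> Range (op_minus T z)" unfolding Range_op_minus by blast
qed

lemma complex_subspace_imp_subspace:
  fixes R :: "'a::complex_vector set"
  assumes "complex_vector.subspace R" shows "subspace R"
  using assms complex_vector.subspace_scale[OF assms, of _ "of_real _"]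
  by (auto simp: complex_vector.subspace_def subspace_def scaleC_of_real)

text \<open>Testing (T - z) u against u gives the constant - Re z, testing it against i u gives |Im
  z|; off the half-line at least one of them is positive.\<close>

lemma op_minus_lower_bound:
  assumes lin: "complex_linear_op T" and sym: "positive_symmetric_op T" and z: "z \<notin> complex_of_real ` {0..}"
  obtains c where "c > 0" "\<And>u v. (u, v) \<in> T \<Longrightarrow> c * norm u \<le> norm (v - z *\<^sub>C u)"
proof -
  have i0: "(\<i> *\<^sub>C u) \<bullet> u = 0" for u :: heis_L2
    using inner_i_left[of u u] by (simp add: inner_commute)
  have ni: "norm (\<i> *\<^sub>C u) = norm u" for u :: heis_L2 by (simp add: norm_scaleC)
  have re: "- Re z * norm u \<le> norm (v - z *\<^sub>C u)" if uv: "(u, v) \<in> T" for u v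
  proof (cases "u = 0")
    case False
    have "v \<bullet> u \<ge> 0" using sym uv by (auto simp: positive_symmetric_op_def)
    then have "- Re z * (norm u * norm u) \<le> (v - z *\<^sub>C u) \<bullet> u"
      by (simp add: scaleC_complex[of z] inner_simps i0 dot_square_norm power2_eq_square)
    also have "\<dots> \<le> norm (v - z *\<^sub>C u) * norm u" by (rule norm_cauchy_schwarz)
    finally show ?thesis
      using False mult_right_le_imp_le[of _ "norm u"] by (metis mult.assoc zero_less_norm_iff)
  qed simp
  have im: "\<bar>Im z\<bar> * norm u \<le> norm (v - z *\<^sub>C u)" if uv: "(u, v) \<in> T" for u v
  proof (cases "u = 0")
    case False
    \<comment> \<open>Symmetry for the pair u, i u expresses that the quadratic form of
      \<open>T\<close> is real, so only the term with Im z remains when testing against i u.\<close>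
    have "(\<i> *\<^sub>C u, \<i> *\<^sub>C v) \<in> T" using lin uv by (auto simp: complex_linear_op_def)
    then have "v \<bullet> (\<i> *\<^sub>C u) = u \<bullet> (\<i> *\<^sub>C v)" using sym uv by (auto simp: positive_symmetric_op_def)
    also have "\<dots> = - (v \<bullet> (\<i> *\<^sub>C u))" using inner_i_left[of u v] by (simp add: inner_commute)
    finally have "v \<bullet> (\<i> *\<^sub>C u) = 0" by simp
    then have "(v - z *\<^sub>C u) \<bullet> (\<i> *\<^sub>C u) = - Im z * (norm u * norm u)"
      using i0[of u] by (simp add: scaleC_complex[of z] inner_simps inner_commute[of u] ni dot_square_norm power2_eq_square)
    then have "\<bar>Im z\<bar> * (norm u * norm u) = \<bar>(v - z *\<^sub>C u) \<bullet> (\<i> *\<^sub>C u)\<bar>"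
      by (simp add: abs_mult)
    also have "\<dots> \<le> norm (v - z *\<^sub>C u) * norm u" using Cauchy_Schwarz_ineq2[of "v - z *\<^sub>C u" "\<i> *\<^sub>C u"] by (simp add: ni)
    finally show ?thesis
      using False mult_right_le_imp_le[of _ "norm u"] by (metis mult.assoc zero_less_norm_iff)
  qed simp
  show ?thesis
  proof (cases "Im z = 0")
    case True
    then have "z = of_real (Re z)" by (simp add: complex_eq_iff)
    then have "Re z < 0" using z by (metis atLeast_iff image_eqI not_le)
    then show ?thesis using that[of "- Re z"] re by simp
  next
    case False
    then show ?thesis using that[of "\<bar>Im z\<bar>"] im by simp
  qed
qed

text \<open>The lower bound makes the preimages of a convergent sequence Cauchy, and closedness of
  the graph identifies their limit as a preimage of the limit.\<close>

lemma closed_Range_op_minus: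
  fixes T :: "'a::complex_banach operator"
  assumes T: "closed T" "complex_linear_op T" and c: "c > 0" "\<And>u v. (u, v) \<in> T \<Longrightarrow> c * norm u \<le> norm (v - z *\<^sub>C u)"
  shows "closed (Range (op_minus T z))"
  unfolding closed_sequential_limits
proof (intro allI impI, elim conjE)
  fix w l assume w: "\<forall>n. w n \<in> Range (op_minus T z)" "w \<longlonglongrightarrow> l"
  then obtain u v where uv: "\<And>n. (u n, v n) \<in> T" "\<And>n. w n = v n - z *\<^sub>C u n"
    unfolding Range_op_minus by metis
  have diff: "c * norm (u m - u n) \<le> norm (w m - w n)" for m n
  proof -
    have "(u m + (-1) *\<^sub>C u n, v m + (-1) *\<^sub>C v n) \<in> T"
      using T(2) uv(1) unfolding complex_linear_op_def by blast
    then have "(u m - u n, v m - v n) \<in> T" by simp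
    from c(2)[OF this] show ?thesis by (simp add: uv(2) complex_vector.scale_right_diff_distrib algebra_simps)
  qed
  have "Cauchy u"
  proof (rule metric_CauchyI)
    fix e :: real assume "e > 0"
    then have "c * e > 0" using c by simp
    then obtain N where N: "\<And>m n. m \<ge> N \<Longrightarrow> n \<ge> N \<Longrightarrow> dist (w m) (w n) < c * e"
      using metric_CauchyD[OF LIMSEQ_imp_Cauchy[OF w(2)]] by metis
    have "dist (u m) (u n) < e" if "m \<ge> N" "n \<ge> N" for m n
      using order_le_less_trans[OF diff[of m n] N[OF that, unfolded dist_norm]] c(1) by (simp add: dist_norm)
    then show "\<exists>N. \<forall>m\<ge>N. \<forall>n\<ge>N. dist (u m) (u n) < e" by blast
  qed
  then obtain a where a: "u \<longlonglongrightarrow> a" using Cauchy_convergent convergent_def by blast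
  have "(\<lambda>n. w n + z *\<^sub>C u n) \<longlonglongrightarrow> l + z *\<^sub>C a"
    by (intro tendsto_add w bounded_linear.tendsto[OF bounded_linear_scaleC] a)
  then have "v \<longlonglongrightarrow> l + z *\<^sub>C a" by (simp add: uv(2))
  then have "(a, l + z *\<^sub>C a) \<in> closure T" using a uv(1) by (intro closure_pairI)
  then have "(a, l + z *\<^sub>C a) \<in> T" using T(1) by simp
  then show "l \<in> Range (op_minus T z)" unfolding Range_op_minus by force
qed

section \<open>Resolvent set and singular sequences\<close>

lemma in_sublaplacian_opI:
  assumes "schwartz f" "square_integrable f" "square_integrable (sublaplacian f)"
  shows "(abs_heis_L2 f, abs_heis_L2 (sublaplacian f)) \<in> sublaplacian_op"
  using assms by (auto simp: sublaplacian_op_def L2_represents_def)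

text \<open>The range is stable under i, so real orthogonality to w and to i w gives the real and
  the imaginary part of the complex pairing. The conjugate on \<open>V\<close> is that of the
  Hermitian product.\<close>

lemma orthogonal_Range_pairing:
  assumes T: "complex_linear_op T" "sublaplacian_op \<subseteq> T"
    and orth: "\<And>w. w \<in> Range (op_minus T z) \<Longrightarrow> v \<bullet> w = 0" and V: "L2_represents v V"
    and f: "schwartz f" "square_integrable f" "square_integrable (sublaplacian f)"
  shows "(\<integral>x. cnj (V x) * (sublaplacian f x - z * f x) \<partial>lborel) = 0"
proof -
  let ?w = "abs_heis_L2 (sublaplacian f) - z *\<^sub>C abs_heis_L2 f"
  have wR: "?w \<in> Range (op_minus T z)"
    unfolding Range_op_minus using in_sublaplacian_opI[OF f] T(2) by blast
  have iw: "\<i> *\<^sub>C ?w \<in> Range (op_minus T z)"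
    by (rule complex_vector.subspace_scale[OF subspace_Range_op_minus[OF T(1)] wR])
  let ?W = "\<lambda>x. sublaplacian f x - z * f x"
  have "L2_represents (abs_heis_L2 f) f" "L2_represents (abs_heis_L2 (sublaplacian f)) (sublaplacian f)"
    using f by (simp_all add: L2_represents_def)
  then have W: "L2_represents ?w ?W" by (intro L2_represents_diff L2_represents_scaleC)
  have sW: "square_integrable ?W" using W by (simp add: L2_represents_def)
  have sV: "square_integrable (\<lambda>x. cnj (V x))" using V by (auto simp: L2_represents_def intro: square_integrable_cnj)
  have int: "integrable lborel (\<lambda>x. cnj (V x) * ?W x)" by (rule square_integrable_times[OF sV sW])
  have "Re (\<integral>x. cnj (V x) * ?W x \<partial>lborel) = (\<integral>x. Re (cnj (V x) * ?W x) \<partial>lborel)"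
    by (rule integral_bounded_linear[OF bounded_linear_Re int, symmetric])
  also have "\<dots> = (\<integral>x. V x \<bullet> ?W x \<partial>lborel)"
    by (rule Bochner_Integration.integral_cong[OF refl]) (simp add: inner_complex_def)
  also have "\<dots> = 0" using orth[OF wR] L2_represents_inner[OF V W] by simp
  finally have re: "Re (\<integral>x. cnj (V x) * ?W x \<partial>lborel) = 0" .
  have "Im (\<integral>x. cnj (V x) * ?W x \<partial>lborel) = (\<integral>x. Im (cnj (V x) * ?W x) \<partial>lborel)"
    by (rule integral_bounded_linear[OF bounded_linear_Im int, symmetric])
  also have "\<dots> = (\<integral>x. - (V x \<bullet> (\<i> * ?W x)) \<partial>lborel)"
    by (rule Bochner_Integration.integral_cong[OF refl]) (simp add: inner_complex_def algebra_simps)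
  also have "\<dots> = 0" using orth[OF iw] L2_represents_inner[OF V L2_represents_scaleC[OF W]] by simp
  finally show ?thesis using re by (simp add: complex_eq_iff)
qed

lemma zmon_comb_sublaplacian:
  assumes "rapid G"
  shows "zmon_comb (sublaplacian (zmon j l G))"
  unfolding sublaplacian_zmon[OF assms]
  by (intro zmon_comb_diff zmon_comb_cmult zmon_comb_zmon rapid_deriv assms)

text \<open>Totality asks for the pairings of both cnj V and V. The first are orthogonality itself.
  For the second the test functions are conjugated: the sub-Laplacian commutes with conjugation,
  which replaces z by cnj z.\<close>

lemma orthogonal_Range_zero:
  assumes T: "complex_linear_op T" "sublaplacian_op \<subseteq> T"
    and z: "z \<notin> complex_of_real ` {0..}"
    and orth: "\<And>w. w \<in> Range (op_minus T z) \<Longrightarrow> v \<bullet> w = 0"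
  shows "v = 0"
proof -
  obtain V where V: "L2_represents v V" using L2_represents_ex by blast
  have sV: "square_integrable V" using V by (simp add: L2_represents_def)
  have z': "cnj z \<notin> complex_of_real ` {0..}"
  proof
    assume "cnj z \<in> complex_of_real ` {0..}"
    then obtain r where "r \<ge> 0" "cnj z = of_real r" by auto
    then have "z = of_real r" by (metis complex_cnj_cnj complex_cnj_complex_of_real)
    then show False using z \<open>r \<ge> 0\<close> by blast
  qed
  have m: "schwartz (zmon j l G)" "square_integrable (zmon j l G)" "square_integrable (sublaplacian (zmon j l G))"
    if "rapid G" for j l G
    using that by (auto intro: zmon_comb_schwartz zmon_comb_square_integrable zmon_comb_zmon zmon_comb_sublaplacian)
  have "AE x in lborel. cnj (V x) = 0"
  proof (rule zmon_pairing_total[OF square_integrable_cnj[OF sV]])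
    fix j l G assume G: "rapid G"
    show "(\<integral>x. cnj (V x) * zmon j l G x \<partial>lborel) = 0"
      by (rule pairing_zmon_zero[OF square_integrable_cnj[OF sV] z _ G])
        (rule orthogonal_Range_pairing[OF T orth V m])
    show "(\<integral>x. cnj (cnj (V x)) * zmon j l G x \<partial>lborel) = 0"
      unfolding complex_cnj_cnj
    proof (rule pairing_zmon_zero[OF sV z' _ G])
      fix j l G assume G: "rapid G"
      let ?f = "\<lambda>x. cnj (zmon j l G x)"
      have L: "sublaplacian ?f = (\<lambda>x. cnj (sublaplacian (zmon j l G) x))"
        using sublaplacian_linear[OF m(1)[OF G] m(1)[OF G] bounded_linear_cnj bounded_linear_zero] by simp
      have "schwartz ?f"
        using schwartz_linear[OF m(1)[OF G] m(1)[OF G] bounded_linear_cnj bounded_linear_zero] by simp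
      from orthogonal_Range_pairing[OF T orth V this]
      have "(\<integral>x. cnj (V x) * (sublaplacian ?f x - z * ?f x) \<partial>lborel) = 0"
        using m[OF G] square_integrable_cnj by (auto simp: L)
      then have "cnj (\<integral>x. cnj (V x) * (sublaplacian ?f x - z * ?f x) \<partial>lborel) = 0" by simp
      moreover have "(\<integral>x. V x * (sublaplacian (zmon j l G) x - cnj z * zmon j l G x) \<partial>lborel)
          = (\<integral>x. cnj (cnj (V x) * (sublaplacian ?f x - z * ?f x)) \<partial>lborel)"
        by (rule Bochner_Integration.integral_cong[OF refl]) (simp add: L)
      ultimately show "(\<integral>x. V x * (sublaplacian (zmon j l G) x - cnj z * zmon j l G x) \<partial>lborel) = 0"
        by (simp only: Bochner_Integration.integral_cnj)
    qed
  qed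
  then show ?thesis unfolding L2_represents_zero_iff[OF V] by simp
qed

text \<open>The generalized eigenfunction \<open>exp (- m \<zeta>)\<close> for \<open>4 m\<close> is damped by \<open>exp (- csqrt \<zeta>)\<close>, whose
  logarithmic derivative becomes small after a translation of \<open>\<zeta>\<close>.\<close>

definition peak :: "real \<Rightarrow> nat \<Rightarrow> complex \<Rightarrow> complex" where
  "peak m k z = exp (- of_real m * z) * inverse (csqrt z) ^ k * exp (- of_real 1 * csqrt z)"

lemma rapid_peak:
  assumes m: "m \<ge> 0" shows "rapid (peak m k)"
  unfolding peak_def
proof (rule rapid_mult_bounded[OF rapid_exp_csqrt])
  show "(\<lambda>z. exp (- of_real m * z) * inverse (csqrt z) ^ k) holomorphic_on {z. 0 < Re z}"
    by (intro holomorphic_intros) (auto simp: complex_nonpos_Reals_iff)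
  fix d :: real assume d: "d > 0"
  have "norm (exp (- of_real m * z) * inverse (csqrt z) ^ k) \<le> 1 * inverse (sqrt d) ^ k" if z: "d \<le> Re z" for z
  proof -
    have "norm (exp (- of_real m * z)) \<le> 1" using z d m by simp
    moreover have "d \<le> norm z" using z complex_Re_le_cmod[of z] by linarith
    then have "inverse (sqrt (norm z)) ^ k \<le> inverse (sqrt d) ^ k"
      using d by (intro power_mono le_imp_inverse_le) auto
    ultimately show ?thesis
      unfolding norm_mult norm_power norm_inverse norm_csqrt by (intro mult_mono) auto
  qed
  then show "\<exists>B. \<forall>z. d \<le> Re z \<longrightarrow> norm (exp (- of_real m * z) * inverse (csqrt z) ^ k) \<le> B" by blast
qed simp

text \<open>The root q = csqrt z has derivative 1 / (2 q). Since the sub-Laplacian is - 4 d/dz on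
  functions of \<open>zeta\<close>, subtracting 4 m sends the function of index 0 to twice that of
  index 1, and index 1 to twice the sum of indices 2 and 3.\<close>

lemma deriv_peak:
  assumes "Re z > 0"
  shows "4 * deriv (peak m 0) z = - 4 * of_real m * peak m 0 z - 2 * peak m 1 z"
    and "4 * deriv (peak m 1) z = - 4 * of_real m * peak m 1 z - 2 * peak m 2 z - 2 * peak m 3 z"
proof -
  have nn: "z \<notin> \<real>\<^sub>\<le>\<^sub>0" and z0: "z \<noteq> 0" "csqrt z \<noteq> 0" using assms by (auto simp: complex_nonpos_Reals_iff)
  note cs = has_field_derivative_csqrt[OF nn]
  have "(peak m 0 has_field_derivative - of_real m * peak m 0 z - peak m 1 z / 2) (at z)"
    unfolding peak_def by (rule derivative_eq_intros cs refl nn | simp add: field_simps z0)+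
  note d = DERIV_imp_deriv[OF this]
  show "4 * deriv (peak m 0) z = - 4 * of_real m * peak m 0 z - 2 * peak m 1 z" unfolding d by (simp add: algebra_simps)
  have "(peak m 1 has_field_derivative - of_real m * peak m 1 z - peak m 2 z / 2 - peak m 3 z / 2) (at z)"
    unfolding peak_def
    by (rule derivative_eq_intros cs refl nn z0 | simp add: field_simps z0 power2_eq_square power3_eq_cube)+
  note d = DERIV_imp_deriv[OF this]
  show "4 * deriv (peak m 1) z = - 4 * of_real m * peak m 1 z - 2 * peak m 2 z - 2 * peak m 3 z" unfolding d by (simp add: algebra_simps)
qed

text \<open>The function of index 1 is, up to the factor 2, the image of index 0, which puts it in
  the range. Its own image is 2 / q + 2 / q^2 times itself pointwise, with q the root of the shifted
  argument, and this factor is uniformly small for a large shift.\<close>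

lemma approximate_eigenvectors:
  assumes T: "complex_linear_op T" "sublaplacian_op \<subseteq> T" and lam: "l \<ge> 0" and d: "\<delta> > 0"
  obtains h k where "h \<in> Range (op_minus T (of_real l))" "(h, k) \<in> op_minus T (of_real l)" "h \<noteq> 0" "norm k \<le> \<delta> * norm h"
proof -
  define m where "m = l / 4"
  have m: "m \<ge> 0" "l = 4 * m" using lam by (auto simp: m_def)
  \<comment> \<open>This gives |q| \<ge> sqrt t = 4 / \<delta>; with |q| \<ge> 1 the factor is at
    most 2 (\<delta> / 4) + 2 (\<delta> / 4) = \<delta>.\<close>
  define t where "t = (4 / \<delta>)\<^sup>2"
  let ?G = "\<lambda>k z. peak m k (z + of_real t)"
  have G: "rapid (?G k)" for k
    by (rule rapid_shift[OF rapid_peak[OF m(1)]]) (simp add: t_def)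
  have Re: "Re (zeta x + of_real t) > 0" for x
    using Re_zeta_ge[of x] by (simp add: t_def add_pos_nonneg)
  have dG: "deriv (?G k) (zeta x) = deriv (peak m k) (zeta x + of_real t)" for k x
    by (rule DERIV_imp_deriv, rule DERIV_shift[THEN iffD1])
      (rule rapid_has_field_derivative[OF rapid_peak[OF m(1)] Re])
  let ?f = "\<lambda>k. zmon 0 0 (?G k)"
  have L: "sublaplacian (?f k) x = - (4 * deriv (peak m k) (zeta x + of_real t))" for k x
    by (simp add: sublaplacian_zmon[OF G], simp add: zmon_def dG)
  have L0: "sublaplacian (?f 0) x - of_real l * ?f 0 x = 2 * ?f 1 x" for x
    unfolding L deriv_peak(1)[OF Re] by (simp add: zmon_def m(2))
  have L1: "sublaplacian (?f 1) x - of_real l * ?f 1 x = 2 * ?f 2 x + 2 * ?f 3 x" for x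
    unfolding L deriv_peak(2)[OF Re] by (simp add: zmon_def m(2))
  have mem: "(abs_heis_L2 (?f k), abs_heis_L2 (sublaplacian (?f k))) \<in> T" for k
    using T(2) in_sublaplacian_opI[OF zmon_comb_schwartz[OF zmon_comb_zmon[OF G]] zmon_comb_square_integrable[OF zmon_comb_zmon[OF G]]
      zmon_comb_square_integrable[OF zmon_comb_sublaplacian[OF G]]] by blast
  have r: "L2_represents (abs_heis_L2 (?f k)) (?f k)" "L2_represents (abs_heis_L2 (sublaplacian (?f k))) (sublaplacian (?f k))" for k
    by (simp_all add: L2_represents_def zmon_comb_square_integrable zmon_comb_zmon zmon_comb_sublaplacian G)
  define h where "h = abs_heis_L2 (?f 1)"
  define k where "k = abs_heis_L2 (sublaplacian (?f 1)) - of_real l *\<^sub>C h"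
  have hk: "(h, k) \<in> op_minus T (of_real l)"
    using mem[of 1] by (auto simp: op_minus_def h_def k_def)
  have two: "abs_heis_L2 (sublaplacian (?f 0)) - of_real l *\<^sub>C abs_heis_L2 (?f 0) \<in> Range (op_minus T (of_real l))"
    unfolding Range_op_minus using mem by blast
  have "L2_represents (abs_heis_L2 (sublaplacian (?f 0)) - of_real l *\<^sub>C abs_heis_L2 (?f 0)) (\<lambda>x. 2 * ?f 1 x)"
    using L2_represents_diff[OF r(2) L2_represents_scaleC[OF r(1)], of 0 "of_real l" 0] unfolding L0 .
  then have eq: "abs_heis_L2 (sublaplacian (?f 0)) - of_real l *\<^sub>C abs_heis_L2 (?f 0) = 2 *\<^sub>C h"
    using L2_represents_scaleC[OF r(1), of 2 1] by (simp add: L2_represents_def h_def)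
  have "(1 / 2) *\<^sub>C (2 *\<^sub>C h) \<in> Range (op_minus T (of_real l))"
    by (rule complex_vector.subspace_scale[OF subspace_Range_op_minus[OF T(1)] two[unfolded eq]])
  then have hR: "h \<in> Range (op_minus T (of_real l))" by (simp add: scaleC_scaleC)
  have nz: "?f 1 x \<noteq> 0" for x
    using Re[of x] by (auto simp: zmon_def peak_def dest: arg_cong[of _ _ Re])
  have h0: "h \<noteq> 0"
  proof
    assume "h = 0"
    then have "AE x in lborel. ?f 1 x = 0"
      using L2_represents_zero_iff[OF r(1)[of 1]] by (simp add: h_def)
    then have "AE x in (lborel :: heis measure). False" by eventually_elim (use nz in blast)
    then show False
      using AE_iff_null[of "lborel :: heis measure" "\<lambda>x. False"] by (simp add: null_sets_def)
  qed
  have k: "L2_represents k (\<lambda>x. 2 * ?f 2 x + 2 * ?f 3 x)"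
    using L2_represents_diff[OF r(2) L2_represents_scaleC[OF r(1)], of 1 "of_real l" 1] unfolding L1 k_def h_def .
  have pw: "norm (2 * ?f 2 x + 2 * ?f 3 x) \<le> \<delta> * norm (?f 1 x)" for x
  proof -
    define q where "q = csqrt (zeta x + of_real t)"
    have nq: "norm (zeta x + of_real t) \<ge> 1 + t"
      using complex_Re_le_cmod[of "zeta x + of_real t"] Re_zeta_ge[of x] by simp
    moreover have "t \<ge> 0" by (simp add: t_def)
    ultimately have q1: "norm q \<ge> 1" "norm q \<ge> sqrt t" by (auto simp: q_def)
    have st: "sqrt t = 4 / \<delta>" using d by (simp add: t_def)
    have "2 * ?f 2 x + 2 * ?f 3 x = (2 * inverse q + 2 * inverse q ^ 2) * ?f 1 x"
      by (simp add: zmon_def peak_def q_def power2_eq_square power3_eq_cube algebra_simps)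
    moreover have "norm (2 * inverse q + 2 * inverse q ^ 2) \<le> \<delta>"
    proof -
      have i: "norm (inverse q) \<le> 1" "norm (inverse q) \<le> \<delta> / 4"
        using q1 d le_imp_inverse_le[OF q1(1)] le_imp_inverse_le[OF q1(2)[unfolded st]] by (auto simp: norm_inverse)
      have "norm (2 * inverse q + 2 * inverse q ^ 2) \<le> norm (2 * inverse q) + norm (2 * inverse q ^ 2)"
        by (rule norm_triangle_ineq)
      also have "\<dots> = 2 * norm (inverse q) + 2 * (norm (inverse q) * norm (inverse q))"
        by (simp add: norm_mult power2_eq_square)
      also have "\<dots> \<le> 2 * (\<delta> / 4) + 2 * (1 * (\<delta> / 4))"
        using i d by (intro add_mono mult_left_mono mult_mono) auto
      finally show ?thesis by simp
    qed
    ultimately show ?thesis by (simp add: norm_mult mult_right_mono)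
  qed
  have "(norm k)\<^sup>2 \<le> (\<delta> * norm h)\<^sup>2"
  proof -
    have "(norm k)\<^sup>2 = (\<integral>x. (norm (2 * ?f 2 x + 2 * ?f 3 x))\<^sup>2 \<partial>lborel)" by (rule L2_represents_norm[OF k])
    also have "\<dots> \<le> (\<integral>x. \<delta>\<^sup>2 * (norm (?f 1 x))\<^sup>2 \<partial>lborel)"
    proof (rule integral_mono)
      show "integrable lborel (\<lambda>x. (norm (2 * ?f 2 x + 2 * ?f 3 x))\<^sup>2)"
        using k by (simp add: L2_represents_def square_integrable_def)
      show "integrable lborel (\<lambda>x. \<delta>\<^sup>2 * (norm (?f 1 x))\<^sup>2)"
        using r(1)[of 1] by (intro integrable_mult_right) (simp add: L2_represents_def square_integrable_def)
      show "(norm (2 * ?f 2 x + 2 * ?f 3 x))\<^sup>2 \<le> \<delta>\<^sup>2 * (norm (?f 1 x))\<^sup>2" for x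
        using power_mono[OF pw[of x] norm_ge_zero, of 2] by (simp add: power_mult_distrib)
    qed
    also have "\<dots> = (\<delta> * norm h)\<^sup>2"
      using L2_represents_norm[OF r(1)[of 1]] by (simp add: power_mult_distrib h_def)
    finally show ?thesis .
  qed
  then have "norm k \<le> \<delta> * norm h" by (rule power2_le_imp_le) (use d in simp)
  then show ?thesis using that[OF hR hk h0] by blast
qed

text \<open>If \<open>v = (T - \<lambda>) u\<close>, then \<open>v \<bullet> h = u \<bullet> (T - \<lambda>) h\<close> is bounded over all \<open>h\<close> with
  \<open>norm ((T - \<lambda>) h) \<le> 1\<close>, although such \<open>h\<close> in the range can be arbitrarily large.\<close>

lemma not_closed_Range:
  assumes T: "complex_linear_op T" "positive_symmetric_op T" "sublaplacian_op \<subseteq> T" and lam: "l \<ge> 0"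
  shows "\<not> closed (Range (op_minus T (of_real l)))"
proof
  let ?R = "Range (op_minus T (of_real l))"
  assume cl: "closed ?R"
  have sub: "complex_vector.subspace ?R" by (rule subspace_Range_op_minus[OF T(1)])
  define P where "P h \<longleftrightarrow> (\<exists>k. (h, k) \<in> op_minus T (of_real l) \<and> norm k \<le> 1)" for h
  have unb: "\<exists>h\<in>?R. P h \<and> norm h \<ge> C" for C :: real
  proof -
    \<comment> \<open>With ratio 1 / D in the approximate eigenvectors, rescaling \<open>h\<close>
      to norm D makes the norm of its image at most 1.\<close>
    define D where "D = max C 1"
    have D: "D > 0" "D \<ge> C" by (auto simp: D_def)
    obtain h k where h: "h \<in> ?R" "(h, k) \<in> op_minus T (of_real l)" "h \<noteq> 0" "norm k \<le> 1 / D * norm h"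
      using approximate_eigenvectors[OF T(1,3) lam, of "1 / D"] D by auto
    define c where "c = complex_of_real (D / norm h)"
    have "c *\<^sub>C h \<in> ?R" by (rule complex_vector.subspace_scale[OF sub h(1)])
    moreover have "norm (c *\<^sub>C h) = D" using h(3) D by (simp add: norm_scaleC c_def norm_divide)
    moreover have "(c *\<^sub>C h, c *\<^sub>C k) \<in> op_minus T (of_real l)"
    proof -
      obtain v where v: "(h, v) \<in> T" "k = v - of_real l *\<^sub>C h" using h(2) by (auto simp: op_minus_def)
      then have "(c *\<^sub>C h, c *\<^sub>C v) \<in> T" using T(1) by (auto simp: complex_linear_op_def)
      moreover have "c *\<^sub>C k = c *\<^sub>C v - of_real l *\<^sub>C (c *\<^sub>C h)"
        by (simp add: v complex_vector.scale_right_diff_distrib mult.commute)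
      ultimately show ?thesis by (auto simp: op_minus_def)
    qed
    moreover have "norm (c *\<^sub>C k) \<le> 1"
    proof -
      have "norm (c *\<^sub>C k) = D / norm h * norm k" using D by (simp add: norm_scaleC c_def norm_divide)
      also have "\<dots> \<le> D / norm h * (1 / D * norm h)" using D by (intro mult_left_mono h) auto
      also have "\<dots> = 1" using D h(3) by simp
      finally show ?thesis .
    qed
    ultimately show ?thesis using D unfolding P_def by (metis order_refl)
  qed
  obtain v where v: "v \<in> ?R" "\<And>C. \<exists>h. P h \<and> \<bar>v \<bullet> h\<bar> \<ge> C"
    using gliding_hump[OF complex_subspace_imp_subspace[OF sub] cl unb] by metis
  obtain a b where ab: "(a, b) \<in> T" "v = b - of_real l *\<^sub>C a" using v(1) unfolding Range_op_minus by blast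
  obtain h where h: "P h" "\<bar>v \<bullet> h\<bar> \<ge> norm a + 1" using v(2) by blast
  obtain h' where h': "(h, h') \<in> T" "norm (h' - of_real l *\<^sub>C h) \<le> 1" using h(1) by (auto simp: P_def op_minus_def)
  have "b \<bullet> h = a \<bullet> h'" using T(2) ab(1) h'(1) by (auto simp: positive_symmetric_op_def)
  then have "v \<bullet> h = a \<bullet> (h' - of_real l *\<^sub>C h)" by (simp add: ab(2) inner_simps scaleC_of_real)
  then have "\<bar>v \<bullet> h\<bar> \<le> norm a * norm (h' - of_real l *\<^sub>C h)" using Cauchy_Schwarz_ineq2 by metis
  also have "\<dots> \<le> norm a * 1" by (intro mult_left_mono h') auto
  finally show False using h(2) by simp
qed

section \<open>Comparison of the three essential spectra\<close>

lemma quotient_basis_UNIV: "quotient_basis (UNIV :: 'a::complex_vector set) {}"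
  unfolding quotient_basis_def by (auto simp: coset_def fun_eq_iff)

text \<open>The three notions agree because only two extreme situations occur. Off the half-line, T
  - z maps its domain bijectively onto the whole space, so kernel and cokernel are zero. On the
  half-line the range is not closed, which excludes Fredholmness of any index.\<close>

theorem theorem3p0p1:
  shows "essspec_DS sublaplacian_closure = complex_of_real ` {0..} \<and>
         essspec_Wolf sublaplacian_closure = complex_of_real ` {0..} \<and>
         essspec_Schechter sublaplacian_closure = complex_of_real ` {0..}"
proof -
  let ?T = sublaplacian_closure
  have lin: "complex_linear_op ?T" and sym: "positive_symmetric_op ?T" and sub: "sublaplacian_op \<subseteq> ?T" and cl: "closed ?T"
    unfolding sublaplacian_closure_def
    by (simp_all add: complex_linear_op_closure complex_linear_op_sublaplacian positive_symmetric_op_closure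
        positive_symmetric_op_sublaplacian closure_subset)
  have reg: "closed (Range (op_minus ?T z)) \<and> fredholm (op_minus ?T z) \<and> fredholm_index (op_minus ?T z) = 0"
    if z: "z \<notin> complex_of_real ` {0..}" for z
  proof -
    let ?R = "Range (op_minus ?T z)"
    obtain c where c: "c > 0" "\<And>u v. (u, v) \<in> ?T \<Longrightarrow> c * norm u \<le> norm (v - z *\<^sub>C u)"
      using op_minus_lower_bound[OF lin sym z] by metis
    have closed: "closed ?R" by (rule closed_Range_op_minus[OF cl lin c])
    have R: "?R = UNIV"
    proof (rule ccontr)
      assume "?R \<noteq> UNIV"
      then obtain x where "x \<notin> ?R" by blast
      then obtain v where "v \<noteq> 0" "\<And>y. y \<in> ?R \<Longrightarrow> v \<bullet> y = 0"
        using closed_subspace_orthogonal[OF complex_subspace_imp_subspace[OF subspace_Range_op_minus[OF lin]] closed] by metis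
      then show False using orthogonal_Range_zero[OF lin sub z] by blast
    qed
    have "u = 0" if "(u, 0) \<in> op_minus ?T z" for u
    proof -
      have uz: "(u, z *\<^sub>C u) \<in> ?T" using that by (auto simp: op_minus_def)
      show ?thesis using c(2)[OF uz] c(1) by (simp add: mult_le_0_iff)
    qed
    moreover have "(0, 0) \<in> op_minus ?T z"
      using lin unfolding op_minus_def complex_linear_op_def by force
    ultimately have ker: "op_kernel (op_minus ?T z) = {0}" by (auto simp: op_kernel_def)
    have fin: "finite_dim_quotient ?R" unfolding R finite_dim_quotient_def using quotient_basis_UNIV by blast
    \<comment> \<open>The empty set is a basis of the trivial quotient, and all bases have the same
      cardinality, so the choice inside \<open>dim_quotient\<close> is immaterial.\<close>
    have "dim_quotient ?R = 0"
      unfolding R using dim_quotient_eq_card[OF complex_vector.subspace_UNIV quotient_basis_UNIV] by simp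
    moreover have "complex_vector.dim {0 :: heis_L2} = 0"
      using complex_vector.dim_span_eq_card_independent[OF complex_vector.independent_empty] by simp
    ultimately have "fredholm_index (op_minus ?T z) = 0" by (simp add: fredholm_index_def ker)
    moreover have "fredholm (op_minus ?T z)"
      unfolding fredholm_def ker using closed fin by (auto intro!: exI[of _ "{}"])
    ultimately show ?thesis using closed by blast
  qed
  have sing: "\<not> closed (Range (op_minus ?T z))" if "z \<in> complex_of_real ` {0..}" for z
    using that not_closed_Range[OF lin sym sub] by auto
  then have "\<not> fredholm (op_minus ?T z)" if "z \<in> complex_of_real ` {0..}" for z
    using that by (auto simp: fredholm_def)
  then show ?thesis
    using reg sing unfolding essspec_DS_def essspec_Wolf_def essspec_Schechter_def by blast
qed

end
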